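(* Let $\alpha,\beta$ be independent random variables, uniformly distributed in $[0,1]$. Let $0\le\lambda_1\le\lambda_2\le\cdots\to\infty$ be the sequence of values of $(m-\alpha)^2+(n-\beta)^2$ at lattice points $(m,n)\in\mathbb{Z}^2$, and let $R_2[a,b](\lambda)$ be its pair correlation function, where $[a,b]\subset\mathbb{R}$ is a given interval. Then $$\lim_{\lambda\to\infty}R_2[a,b](\lambda)=\pi(b-a)$$ almost surely.
   Context: The sequence $(\lambda_j)$ lists the values of $(m-\alpha)^2+(n-\beta)^2$, $(m,n)\in\mathbb{Z}^2$, in nondecreasing order and with multiplicity; its mean density is $\pi$. The pair correlation function is $$R_2[a,b](\lambda)=\frac{1}{\pi\lambda}\#\{(j,k): j\neq k,\ \lambda_j\le\lambda,\ \lambda_k\le\lambda,\ a\le\lambda_j-\lambda_k\le b\}.$$ *)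

theory Defs
  imports "HOL-Probability.Probability"
begin

definition shifted_sq_dist :: "real \<Rightarrow> real \<Rightarrow> int \<times> int \<Rightarrow> real" where
  "shifted_sq_dist \<alpha> \<beta> = (\<lambda>(m, n). (of_int m - \<alpha>)\<^sup>2 + (of_int n - \<beta>)\<^sup>2)"

(* The bijection e makes each value occur in the list as often as it is attained on the index
   type, which is what "with multiplicity" means. *)
definition lists_values :: "('i \<Rightarrow> real) \<Rightarrow> (nat \<Rightarrow> real) \<Rightarrow> bool" where
  "lists_values f lam \<longleftrightarrow> mono lam \<and> (\<exists>e. bij e \<and> (\<forall>j. lam j = f (e j)))"

(* Indexed from 0: the usual lambda_1, lambda_2, ... are lattice_seq \<alpha> \<beta> 0, lattice_seq \<alpha> \<beta> 1, ...
   Existence and uniqueness of the list are proved in lattice_seq_ex1 below. *)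
definition lattice_seq :: "real \<Rightarrow> real \<Rightarrow> nat \<Rightarrow> real" where
  "lattice_seq \<alpha> \<beta> = (THE lam. lists_values (shifted_sq_dist \<alpha> \<beta>) lam)"

(* The factor pi in the denominator is the mean density of the sequence lattice_seq \<alpha> \<beta>. *)
definition pair_correlation :: "(nat \<Rightarrow> real) \<Rightarrow> real \<Rightarrow> real \<Rightarrow> real \<Rightarrow> real" where
  "pair_correlation lam a b L =
     real (card {(j, k). j \<noteq> k \<and> lam j \<le> L \<and> lam k \<le> L \<and>
                         a \<le> lam j - lam k \<and> lam j - lam k \<le> b}) / (pi * L)"

lemma lists_values_exists:
  fixes f :: "'i::countable \<Rightarrow> real"
  assumes inf: "infinite (UNIV :: 'i set)" and fin: "\<And>x. finite {i. f i \<le> x}"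
  shows "\<exists>lam. lists_values f lam"
proof -
  define lt where "lt i j \<longleftrightarrow> f i < f j \<or> (f i = f j \<and> to_nat i < to_nat j)" for i j
  define r where "r i = card {j. lt j i}" for i
  have fin_lt: "finite {j. lt j i}" for i
    by (rule finite_subset[OF _ fin[of "f i"]]) (auto simp: lt_def)
  have r_less: "r i < r j" if "lt i j" for i j
    unfolding r_def
  proof (rule psubset_card_mono[OF fin_lt])
    have "i \<in> {k. lt k j}" "i \<notin> {k. lt k i}" using that by (auto simp: lt_def)
    moreover have "{k. lt k i} \<subseteq> {k. lt k j}" using that by (auto simp: lt_def)
    ultimately show "{k. lt k i} \<subset> {k. lt k j}" by blast
  qed
  have total: "i = j \<or> lt i j \<or> lt j i" for i j
    using inj_to_nat[THEN injD, of i j] unfolding lt_def by linarith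
  have "inj r"
    by (rule injI) (metis total r_less less_irrefl)
  have down: "{..<r i} \<subseteq> range r" for i
  proof -
    have "r ` {j. lt j i} = {..<r i}"
    proof (rule card_subset_eq)
      show "r ` {j. lt j i} \<subseteq> {..<r i}" using r_less by auto
      have "card (r ` {j. lt j i}) = card {j. lt j i}"
        by (rule card_image) (rule inj_on_subset[OF \<open>inj r\<close>], simp)
      then show "card (r ` {j. lt j i}) = card {..<r i}" by (simp add: r_def)
    qed simp
    then show ?thesis by blast
  qed
  have "infinite (range r)" using inf \<open>inj r\<close> finite_imageD by blast
  have "surj r"
  proof -
    have "n \<in> range r" for n
    proof -
      obtain m where "m > n" "m \<in> range r"
        using \<open>infinite (range r)\<close> by (meson infinite_nat_iff_unbounded)
      then show ?thesis using down by blast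
    qed
    then show ?thesis by blast
  qed
  have "bij r" using \<open>inj r\<close> \<open>surj r\<close> by (simp add: bij_def)
  have "mono (\<lambda>n. f (inv r n))"
  proof (rule monoI)
    fix n m :: nat assume "n \<le> m"
    then have "\<not> r (inv r m) < r (inv r n)"
      by (simp add: surj_f_inv_f[OF \<open>surj r\<close>])
    then have "\<not> lt (inv r m) (inv r n)" using r_less by blast
    then show "f (inv r n) \<le> f (inv r m)" by (auto simp: lt_def)
  qed
  then show ?thesis
    unfolding lists_values_def using bij_imp_bij_inv[OF \<open>bij r\<close>] by blast
qed

lemma lists_values_count:
  assumes "lists_values f lam" and fin: "\<And>x. finite {i. f i \<le> x}"
  shows "finite {j. lam j \<le> x}" and "card {j. lam j \<le> x} = card {i. f i \<le> x}"
proof -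
  obtain e where e: "bij e" "\<And>j. lam j = f (e j)"
    using assms(1) unfolding lists_values_def by blast
  have img: "e ` {j. lam j \<le> x} = {i. f i \<le> x}"
  proof
    show "e ` {j. lam j \<le> x} \<subseteq> {i. f i \<le> x}" using e(2) by auto
    show "{i. f i \<le> x} \<subseteq> e ` {j. lam j \<le> x}"
    proof
      fix i assume "i \<in> {i. f i \<le> x}"
      moreover obtain j where "i = e j" using bij_is_surj[OF e(1)] by (metis surjD)
      ultimately show "i \<in> e ` {j. lam j \<le> x}" using e(2) by auto
    qed
  qed
  have inj: "inj_on e {j. lam j \<le> x}"
    using bij_is_inj[OF e(1)] by (rule inj_on_subset) simp
  show "finite {j. lam j \<le> x}" using finite_imageD[OF _ inj] img fin by simp
  show "card {j. lam j \<le> x} = card {i. f i \<le> x}" using card_image[OF inj] img by simp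
qed

lemma lists_values_le:
  assumes l1: "lists_values f lam" and l2: "lists_values f mu"
    and fin: "\<And>x. finite {i. f i \<le> x}"
  shows "mu j \<le> lam j"
proof (rule ccontr)
  assume "\<not> mu j \<le> lam j"
  then have less: "lam j < mu j" by simp
  have mono: "mono lam" "mono mu" using l1 l2 by (auto simp: lists_values_def)
  have "{..j} \<subseteq> {k. lam k \<le> lam j}" using monoD[OF mono(1)] by auto
  from card_mono[OF lists_values_count(1)[OF l1 fin] this]
  have "Suc j \<le> card {k. lam k \<le> lam j}" by simp
  also have "\<dots> = card {k. mu k \<le> lam j}"
    by (simp add: lists_values_count(2)[OF l1 fin] lists_values_count(2)[OF l2 fin])
  also have "\<dots> \<le> card {..<j}"
  proof (rule card_mono)
    show "{k. mu k \<le> lam j} \<subseteq> {..<j}"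
    proof
      fix k assume k: "k \<in> {k. mu k \<le> lam j}"
      show "k \<in> {..<j}"
      proof (rule ccontr)
        assume "k \<notin> {..<j}"
        then have "mu j \<le> mu k" using monoD[OF mono(2), of j k] by simp
        then show False using k less by simp
      qed
    qed
  qed simp
  finally show False by simp
qed

lemma finite_shifted_sq_dist_le: "finite {p. shifted_sq_dist \<alpha> \<beta> p \<le> x}"
proof -
  define c where "c = \<bar>x\<bar> + 1"
  have bound: "\<bar>y\<bar> \<le> c" if "y\<^sup>2 \<le> x" for y :: real
  proof -
    have "c\<^sup>2 = \<bar>x\<bar>\<^sup>2 + 2 * \<bar>x\<bar> + 1"
      unfolding c_def by (simp add: power2_sum)
    then have "x \<le> c\<^sup>2"
      using zero_le_power2[of "\<bar>x\<bar>"] by linarith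
    then have "\<bar>y\<bar>\<^sup>2 \<le> c\<^sup>2" using that by simp
    then show ?thesis by (rule power2_le_imp_le) (simp add: c_def)
  qed
  have "{p. shifted_sq_dist \<alpha> \<beta> p \<le> x}
        \<subseteq> {\<lfloor>\<alpha> - c\<rfloor>..\<lceil>\<alpha> + c\<rceil>} \<times> {\<lfloor>\<beta> - c\<rfloor>..\<lceil>\<beta> + c\<rceil>}"
  proof
    fix p assume p: "p \<in> {p. shifted_sq_dist \<alpha> \<beta> p \<le> x}"
    obtain m n where mn: "p = (m, n)" by (cases p)
    have s: "(of_int m - \<alpha>)\<^sup>2 + (of_int n - \<beta>)\<^sup>2 \<le> x"
      using p by (simp add: mn shifted_sq_dist_def)
    have "(of_int m - \<alpha>)\<^sup>2 \<le> x" "(of_int n - \<beta>)\<^sup>2 \<le> x"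
      using s zero_le_power2[of "of_int m - \<alpha>"] zero_le_power2[of "of_int n - \<beta>"] by linarith+
    from this[THEN bound]
    have "\<alpha> - c \<le> of_int m" "of_int m \<le> \<alpha> + c" "\<beta> - c \<le> of_int n" "of_int n \<le> \<beta> + c"
      by linarith+
    then show "p \<in> {\<lfloor>\<alpha> - c\<rfloor>..\<lceil>\<alpha> + c\<rceil>} \<times> {\<lfloor>\<beta> - c\<rfloor>..\<lceil>\<beta> + c\<rceil>}"
      unfolding mn by simp linarith
  qed
  then show ?thesis by (rule finite_subset) simp
qed

lemma lattice_seq_ex1: "\<exists>!lam. lists_values (shifted_sq_dist \<alpha> \<beta>) lam"
proof (rule ex_ex1I)
  show "\<exists>lam. lists_values (shifted_sq_dist \<alpha> \<beta>) lam"
    by (rule lists_values_exists) (simp_all add: finite_shifted_sq_dist_le finite_prod infinite_UNIV_int)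
next
  fix lam mu
  assume "lists_values (shifted_sq_dist \<alpha> \<beta>) lam" "lists_values (shifted_sq_dist \<alpha> \<beta>) mu"
  then show "lam = mu"
    by (intro ext antisym lists_values_le[OF _ _ finite_shifted_sq_dist_le])
qed

lemma lists_values_lattice_seq: "lists_values (shifted_sq_dist \<alpha> \<beta>) (lattice_seq \<alpha> \<beta>)"
  unfolding lattice_seq_def by (rule theI'[OF lattice_seq_ex1])

end

theory Submission
  imports Defs
begin

text \<open>
Write \<open>x = (\<alpha>, \<beta>)\<close> and \<open>L = R\<^sup>2\<close>. A pair of distinct lattice points \<open>p, q\<close> is recorded by its
difference \<open>d = p - q\<close> and by \<open>y = q - x\<close>. The two distances to \<open>x\<close> are at most \<open>R\<close> and the squared
distances differ by a number in \<open>[a, b]\<close> exactly when \<open>y\<close> lies in a strip orthogonal to \<open>d\<close>, of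
width \<open>(b - a) / (2\<bar>d\<bar>)\<close>, cut off by two discs of radius \<open>R\<close> (\<open>strip\<close>). So the number of close pairs
is \<open>\<Sum>d. F d x\<close>, where \<open>F d x\<close> counts the points of the translated lattice \<open>\<int>\<^sup>2 - x\<close> in the strip of \<open>d\<close>
(\<open>hits\<close>). The proof is a second moment argument for this sum.

Mean. Averaging over \<open>x\<close> in the unit square turns a lattice sum into an integral over the plane
(\<open>nn_integral_unfold\<close>), so the mean of \<open>F d\<close> is the area of the strip. In coordinates \<open>(u, t)\<close> with
\<open>y = ((u - \<bar>d\<bar>\<^sup>2) / (2\<bar>d\<bar>\<^sup>2)) d + t d\<^sup>\<bottom>\<close> this area is half the measure of a set described by
\<open>a \<le> u \<le> b\<close> and, up to bounded terms, \<open>\<bar>d\<bar>\<^sup>2 (t\<^sup>2 + 1/4) \<le> R\<^sup>2\<close>. Summing over \<open>d\<close> first and using that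
a disc of radius \<open>r\<close> has about \<open>pi r\<^sup>2\<close> lattice points, dominated convergence gives the mean
\<open>(1/2) R\<^sup>2 (b - a) \<integral> pi / (t\<^sup>2 + 1/4) dt = pi\<^sup>2 (b - a) R\<^sup>2\<close> (\<open>mean_good\<close>).

Variance. The mean of \<open>F d * F d'\<close> is the sum over \<open>t \<in> \<int>\<^sup>2\<close> of the area of the intersection of one strip
with the \<open>t\<close>-translate of the other; the integral over all real \<open>t\<close> is the product of the two areas. If
\<open>d, d'\<close> are not parallel, with determinant \<open>D\<close>, the two linear forms defining the strips can be
used as coordinates, with Jacobian \<open>4\<bar>D\<bar>\<close>; for fixed values of the two forms, the admissible \<open>t\<close> form
a convex set of diameter \<open>O(R)\<close>, whose lattice points number at most its area plus \<open>O(R)\<close>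
(\<open>convex_lattice_count\<close>). Hence the covariance is at most \<open>O(R / \<bar>D\<bar>)\<close> (\<open>sum_overlap_le\<close>). Counting
the \<open>d'\<close> with given determinant against \<open>d\<close>, and summing greatest common divisors, bounds the variance
by \<open>O(R\<^sup>4)\<close> times a negative power of \<open>R\<close> (\<open>second_moment_tally\<close>).

The differences whose first coordinate is below a cutoff \<open>w\<close> are treated separately (\<open>bad\<close>), because
the estimates for counts and covariances deteriorate for them; their total mean is \<open>O(R w log R)\<close>, which is negligible for
\<open>w = R powr (3/4)\<close> (\<open>sum_bad_le\<close>).

Along \<open>R = k ^ 16\<close> both error terms, divided by \<open>R\<^sup>4\<close> and \<open>R\<^sup>2\<close> respectively, are \<open>O(1 / k\<^sup>2)\<close>, hence
summable, which gives almost sure convergence along this sequence. The number of close pairs is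
monotone in \<open>L\<close> and consecutive values of \<open>R\<close> have ratio tending to 1, so the limit extends to all \<open>L\<close>
(\<open>tendsto_quotient_of_polynomial_subsequence\<close>).
\<close>

section \<open>Integration over the plane and sums over the lattice\<close>

lemma nn_integral_plane:
  fixes h :: "real \<times> real \<Rightarrow> ennreal"
  assumes [measurable]: "h \<in> borel_measurable borel"
  shows "(\<integral>\<^sup>+y. h y \<partial>lborel) = (\<integral>\<^sup>+x. \<integral>\<^sup>+y. h (x, y) \<partial>lborel \<partial>lborel)"
    and "(\<integral>\<^sup>+y. h y \<partial>lborel) = (\<integral>\<^sup>+y. \<integral>\<^sup>+x. h (x, y) \<partial>lborel \<partial>lborel)"
proof -
  have h: "h \<in> borel_measurable (lborel \<Otimes>\<^sub>M lborel)"
    by (simp add: lborel_prod)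
  show "(\<integral>\<^sup>+y. h y \<partial>lborel) = (\<integral>\<^sup>+x. \<integral>\<^sup>+y. h (x, y) \<partial>lborel \<partial>lborel)"
    using lborel.nn_integral_fst[OF h] by (simp add: lborel_prod)
  show "(\<integral>\<^sup>+y. h y \<partial>lborel) = (\<integral>\<^sup>+y. \<integral>\<^sup>+x. h (x, y) \<partial>lborel \<partial>lborel)"
    using lborel_pair.nn_integral_snd[OF h] by (simp add: lborel_prod)
qed

lemma nn_integral_plane_swap:
  fixes h :: "real \<times> real \<Rightarrow> real \<times> real \<Rightarrow> ennreal"
  assumes "case_prod h \<in> borel_measurable borel"
  shows "(\<integral>\<^sup>+y. \<integral>\<^sup>+x. h x y \<partial>lborel \<partial>lborel) = (\<integral>\<^sup>+x. \<integral>\<^sup>+y. h x y \<partial>lborel \<partial>lborel)"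
  by (rule lborel_pair.Fubini') (use assms in \<open>simp add: lborel_prod\<close>)

text \<open>
The argument of \<open>h\<close> is the inverse of the linear map \<open>y \<mapsto> (\<alpha> * fst y + \<beta> * snd y, \<gamma> * fst y + \<delta> * snd y)\<close>,
whose determinant is \<open>D\<close>. Since \<open>\<alpha> \<noteq> 0\<close>, the map is the composition of two maps that
each change a single coordinate, by an affine function of it when the other coordinate is fixed.
\<close>
lemma nn_integral_linear_subst:
  fixes h :: "real \<times> real \<Rightarrow> ennreal"
  assumes h[measurable]: "h \<in> borel_measurable borel" and \<alpha>: "\<alpha> \<noteq> 0"
    and D: "D = \<alpha> * \<delta> - \<beta> * \<gamma>" "D \<noteq> 0"
  shows "(\<integral>\<^sup>+w. h ((\<delta> * fst w - \<beta> * snd w) / D, (\<alpha> * snd w - \<gamma> * fst w) / D) \<partial>lborel)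
       = ennreal \<bar>D\<bar> * (\<integral>\<^sup>+y. h y \<partial>lborel)"
proof -
  have [measurable]: "h \<in> borel_measurable (borel \<Otimes>\<^sub>M borel)"
    using h by (simp add: borel_prod)
  have "(\<integral>\<^sup>+w. h ((\<delta> * fst w - \<beta> * snd w) / D, (\<alpha> * snd w - \<gamma> * fst w) / D) \<partial>lborel)
      = (\<integral>\<^sup>+x. \<integral>\<^sup>+y. h ((\<delta> * x - \<beta> * y) / D, (\<alpha> * y - \<gamma> * x) / D) \<partial>lborel \<partial>lborel)"
    by (subst nn_integral_plane(1)) (simp_all add: borel_prod[symmetric])
  also have "\<dots> = (\<integral>\<^sup>+x. ennreal \<bar>D / \<alpha>\<bar> * (\<integral>\<^sup>+y. h (x / \<alpha> - \<beta> * y / \<alpha>, y) \<partial>lborel) \<partial>lborel)"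
  proof (rule nn_integral_cong)
    fix x
    have "(\<integral>\<^sup>+y. h ((\<delta> * x - \<beta> * y) / D, (\<alpha> * y - \<gamma> * x) / D) \<partial>lborel)
       = ennreal \<bar>D / \<alpha>\<bar> * (\<integral>\<^sup>+y. h ((\<delta> * x - \<beta> * (\<gamma> * x / \<alpha> + D / \<alpha> * y)) / D,
            (\<alpha> * (\<gamma> * x / \<alpha> + D / \<alpha> * y) - \<gamma> * x) / D) \<partial>lborel)"
      by (rule nn_integral_real_affine) (use \<alpha> D in auto)
    also have "(\<lambda>y. h ((\<delta> * x - \<beta> * (\<gamma> * x / \<alpha> + D / \<alpha> * y)) / D,
            (\<alpha> * (\<gamma> * x / \<alpha> + D / \<alpha> * y) - \<gamma> * x) / D)) = (\<lambda>y. h (x / \<alpha> - \<beta> * y / \<alpha>, y))"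
    proof
      fix y
      have 1: "\<delta> * x - \<beta> * (\<gamma> * x / \<alpha> + D / \<alpha> * y) = D * (x / \<alpha> - \<beta> * y / \<alpha>)"
        using \<alpha> unfolding D(1) by (simp add: field_simps)
      have 2: "\<alpha> * (\<gamma> * x / \<alpha> + D / \<alpha> * y) - \<gamma> * x = D * y"
        using \<alpha> by (simp add: field_simps)
      show "h ((\<delta> * x - \<beta> * (\<gamma> * x / \<alpha> + D / \<alpha> * y)) / D,
            (\<alpha> * (\<gamma> * x / \<alpha> + D / \<alpha> * y) - \<gamma> * x) / D) = h (x / \<alpha> - \<beta> * y / \<alpha>, y)"
        unfolding 1 2 using D(2) by simp
    qed
    finally show "(\<integral>\<^sup>+y. h ((\<delta> * x - \<beta> * y) / D, (\<alpha> * y - \<gamma> * x) / D) \<partial>lborel)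
       = ennreal \<bar>D / \<alpha>\<bar> * (\<integral>\<^sup>+y. h (x / \<alpha> - \<beta> * y / \<alpha>, y) \<partial>lborel)" .
  qed
  also have "\<dots> = ennreal \<bar>D / \<alpha>\<bar> * (\<integral>\<^sup>+x. \<integral>\<^sup>+y. h (x / \<alpha> - \<beta> * y / \<alpha>, y) \<partial>lborel \<partial>lborel)"
    by (rule nn_integral_cmult) measurable
  also have "(\<integral>\<^sup>+x. \<integral>\<^sup>+y. h (x / \<alpha> - \<beta> * y / \<alpha>, y) \<partial>lborel \<partial>lborel)
      = (\<integral>\<^sup>+y. \<integral>\<^sup>+x. h (x / \<alpha> - \<beta> * y / \<alpha>, y) \<partial>lborel \<partial>lborel)"
    by (rule lborel_pair.Fubini'[symmetric]) measurable
  also have "\<dots> = (\<integral>\<^sup>+y. ennreal \<bar>\<alpha>\<bar> * (\<integral>\<^sup>+x. h (x, y) \<partial>lborel) \<partial>lborel)"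
  proof (rule nn_integral_cong)
    fix y
    have "(\<integral>\<^sup>+x. h (x / \<alpha> - \<beta> * y / \<alpha>, y) \<partial>lborel)
       = ennreal \<bar>\<alpha>\<bar> * (\<integral>\<^sup>+x. h ((\<beta> * y + \<alpha> * x) / \<alpha> - \<beta> * y / \<alpha>, y) \<partial>lborel)"
      by (rule nn_integral_real_affine) (use \<alpha> in auto)
    then show "(\<integral>\<^sup>+x. h (x / \<alpha> - \<beta> * y / \<alpha>, y) \<partial>lborel) = ennreal \<bar>\<alpha>\<bar> * (\<integral>\<^sup>+x. h (x, y) \<partial>lborel)"
      using \<alpha> by (simp add: add_divide_distrib)
  qed
  also have "\<dots> = ennreal \<bar>\<alpha>\<bar> * (\<integral>\<^sup>+y. h y \<partial>lborel)"
    by (simp add: nn_integral_cmult nn_integral_plane(2))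
  finally show ?thesis
    using \<alpha> by (simp add: mult.assoc[symmetric] ennreal_mult[symmetric] abs_mult)
qed

lemma nn_integral_lborel_translate:
  fixes h :: "'a::euclidean_space \<Rightarrow> ennreal"
  assumes [measurable]: "h \<in> borel_measurable borel"
  shows "(\<integral>\<^sup>+x. h (c + x) \<partial>lborel) = (\<integral>\<^sup>+x. h x \<partial>lborel)"
proof -
  have "(\<integral>\<^sup>+x. h x \<partial>lborel) = (\<integral>\<^sup>+x. h x \<partial>distr lborel borel ((+) c))"
    by (simp add: lborel_distr_plus)
  also have "\<dots> = (\<integral>\<^sup>+x. h (c + x) \<partial>lborel)"
    by (rule nn_integral_distr) auto
  finally show ?thesis ..
qed

lemma nn_integral_plane_reflect:
  fixes h :: "real \<times> real \<Rightarrow> ennreal"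
  assumes h[measurable]: "h \<in> borel_measurable borel"
  shows "(\<integral>\<^sup>+x. h (c - x) \<partial>lborel) = (\<integral>\<^sup>+x. h x \<partial>lborel)"
proof -
  have "(\<integral>\<^sup>+x. h (c - x) \<partial>lborel) = (\<integral>\<^sup>+x. h (c + - x) \<partial>lborel)" by simp
  also have "\<dots> = (\<integral>\<^sup>+x. h (c + x) \<partial>lborel)"
    using nn_integral_linear_subst[of "\<lambda>x. h (c + x)" "-1" 1 "-1" 0 0]
    by (simp add: uminus_prod_def)
  finally show ?thesis by (simp add: nn_integral_lborel_translate)
qed

definition lat :: "int \<times> int \<Rightarrow> real \<times> real" where
  "lat p = (of_int (fst p), of_int (snd p))"

lemma lat_simps [simp]:
  "fst (lat p) = of_int (fst p)" "snd (lat p) = of_int (snd p)"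
  "lat p + lat q = lat (p + q)" "lat p - lat q = lat (p - q)"
  by (simp_all add: lat_def)

abbreviation unit_square :: "(real \<times> real) set" where
  "unit_square \<equiv> {0..<1} \<times> {0..<1}"

lemma borel_unit_square [measurable]: "unit_square \<in> sets borel"
  by (simp add: borel_prod[symmetric])

lemma nn_integral_unit_square: "(\<integral>\<^sup>+x. indicator unit_square x \<partial>lborel) = 1"
proof -
  have "emeasure lborel unit_square = 1"
    by (simp add: lborel_prod[symmetric] lborel.emeasure_pair_measure_Times)
  then show ?thesis by (subst nn_integral_indicator) simp_all
qed

text \<open>
The squares \<open>lat q - unit_square\<close> tile the plane, so integrating the periodic function
\<open>x \<mapsto> \<Sum>q. h (lat q - x)\<close> over one period collects the integral of \<open>h\<close> over all tiles.
\<close>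
lemma nn_integral_unfold:
  fixes h :: "real \<times> real \<Rightarrow> ennreal"
  assumes h[measurable]: "h \<in> borel_measurable borel"
  shows "(\<integral>\<^sup>+x. indicator unit_square x * (\<integral>\<^sup>+q. h (lat q - x) \<partial>count_space UNIV) \<partial>lborel)
       = (\<integral>\<^sup>+y. h y \<partial>lborel)"
proof -
  have "(\<integral>\<^sup>+x. indicator unit_square x * (\<integral>\<^sup>+q. h (lat q - x) \<partial>count_space UNIV) \<partial>lborel)
     = (\<integral>\<^sup>+x. \<integral>\<^sup>+q. indicator unit_square x * h (lat q - x) \<partial>count_space UNIV \<partial>lborel)"
    by (simp add: nn_integral_cmult)
  also have "\<dots> = (\<integral>\<^sup>+q. \<integral>\<^sup>+x. indicator unit_square x * h (lat q - x) \<partial>lborel \<partial>count_space UNIV)"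
    by (rule nn_integral_count_space_nn_integral) (auto intro!: borel_measurable_times)
  also have "\<dots> = (\<integral>\<^sup>+q. \<integral>\<^sup>+y. indicator unit_square (lat q - y) * h y \<partial>lborel \<partial>count_space UNIV)"
  proof (rule nn_integral_cong)
    fix q
    show "(\<integral>\<^sup>+x. indicator unit_square x * h (lat q - x) \<partial>lborel)
        = (\<integral>\<^sup>+y. indicator unit_square (lat q - y) * h y \<partial>lborel)"
      using nn_integral_plane_reflect[of "\<lambda>y. indicator unit_square (lat q - y) * h y" "lat q"] by simp
  qed
  also have "\<dots> = (\<integral>\<^sup>+y. \<integral>\<^sup>+q. indicator unit_square (lat q - y) * h y \<partial>count_space UNIV \<partial>lborel)"
    by (rule nn_integral_count_space_nn_integral[symmetric]) (auto intro!: borel_measurable_times)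
  also have "\<dots> = (\<integral>\<^sup>+y. h y \<partial>lborel)"
  proof (rule nn_integral_cong)
    fix y :: "real \<times> real"
    have "indicator unit_square (lat q - y) = (indicator {(\<lceil>fst y\<rceil>, \<lceil>snd y\<rceil>)} q :: ennreal)" for q
    proof -
      have "lat q - y \<in> unit_square \<longleftrightarrow> q = (\<lceil>fst y\<rceil>, \<lceil>snd y\<rceil>)"
      proof -
        have "lat q - y \<in> unit_square \<longleftrightarrow> (fst y \<le> of_int (fst q) \<and> of_int (fst q) < fst y + 1)
            \<and> (snd y \<le> of_int (snd q) \<and> of_int (snd q) < snd y + 1)"
          by (auto simp: mem_Times_iff)
        also have "\<dots> \<longleftrightarrow> \<lceil>fst y\<rceil> = fst q \<and> \<lceil>snd y\<rceil> = snd q"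
          unfolding ceiling_eq_iff by linarith
        finally show ?thesis by (auto simp: prod_eq_iff)
      qed
      then show ?thesis by (simp add: indicator_def)
    qed
    then show "(\<integral>\<^sup>+q. indicator unit_square (lat q - y) * h y \<partial>count_space UNIV) = h y"
      by (simp add: nn_integral_multc one_ennreal_def[symmetric])
  qed
  finally show ?thesis .
qed

lemma nn_integral_count_card:
  "finite A \<Longrightarrow> (\<integral>\<^sup>+q. indicator A q \<partial>count_space UNIV) = ennreal (real (card A))"
  by (simp add: emeasure_count_space ennreal_of_nat_eq_real_of_nat)

lemma finite_lat_bounded:
  assumes "bounded B" shows "finite {q. lat q - x \<in> B}"
proof -
  obtain e where e: "\<And>y. y \<in> B \<Longrightarrow> norm y \<le> e" using assms by (auto simp: bounded_iff)
  define n where "n = \<lceil>e + norm x\<rceil>"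
  have "{q. lat q - x \<in> B} \<subseteq> {-n..n} \<times> {-n..n}"
  proof safe
    fix i j assume "lat (i, j) - x \<in> B"
    then have *: "norm (lat (i, j)) \<le> of_int n"
      using e[of "lat (i, j) - x"] norm_triangle_ineq[of "lat (i, j) - x" x] unfolding n_def by simp linarith
    have "\<bar>real_of_int i\<bar> \<le> of_int n" "\<bar>real_of_int j\<bar> \<le> of_int n"
      using * norm_fst_le[of "real_of_int i" "real_of_int j"] norm_snd_le[of "real_of_int j" "real_of_int i"]
      by (auto simp: lat_def)
    then show "i \<in> {-n..n}" "j \<in> {-n..n}" by auto
  qed
  then show ?thesis by (rule finite_subset) simp
qed

lemma finite_lat_bounded0: "bounded B \<Longrightarrow> finite {q. lat q \<in> B}"
  using finite_lat_bounded[of B 0] by simp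

lemma norm_unit_square: "x \<in> unit_square \<Longrightarrow> norm x \<le> 2"
  using norm_Pair_le[of "fst x" "snd x"] by auto

lemma integral_disc:
  "r \<ge> 0 \<Longrightarrow> (\<integral>\<^sup>+y. indicator (cball (0 :: real \<times> real) r) y \<partial>lborel) = ennreal (pi * r\<^sup>2)"
  by (simp add: emeasure_cball eval_unit_ball_vol power2_eq_square)

text \<open>
Moving a lattice point by a vector of the unit square changes its norm by at most 2. So the number of lattice
points in a disc is compared with the number of points of \<open>\<int>\<^sup>2 - x\<close> in the discs of radius \<open>r - 2\<close> and
\<open>r + 2\<close>, and the mean of the latter over \<open>x\<close> is the area of the disc by unfolding.
\<close>
lemma gauss_circle:
  assumes "r \<ge> 0"
  shows "real (card {d. norm (lat d) \<le> r}) \<le> pi * (r + 2)\<^sup>2"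
    and "r \<ge> 2 \<Longrightarrow> pi * (r - 2)\<^sup>2 \<le> real (card {d. norm (lat d) \<le> r})"
proof -
  let ?N = "card {d. norm (lat d) \<le> r}"
  have fin: "finite {q. norm (lat q - x) \<le> s}" for x s
    using finite_lat_bounded[of "cball 0 s" x] by simp
  have fin0: "finite {q. norm (lat q) \<le> s}" for s using fin[of 0] by simp
  have eq: "(\<integral>\<^sup>+q. indicator (cball 0 s) (lat q - x) \<partial>count_space UNIV)
      = ennreal (real (card {q. norm (lat q - x) \<le> s}))" for s x
  proof -
    have "indicator (cball 0 s) (lat q - x) = (indicator {q. norm (lat q - x) \<le> s} q :: ennreal)" for q
      by (simp add: indicator_def)
    then show ?thesis using nn_integral_count_card[OF fin] by simp
  qed
  have tri: "norm (lat d) \<le> norm (lat d - x) + 2" "norm (lat d - x) \<le> norm (lat d) + 2"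
    if "x \<in> unit_square" for d x
    using norm_unit_square[OF that] norm_triangle_ineq[of "lat d - x" x]
      norm_triangle_ineq4[of "lat d" x] by auto
  have N: "(\<integral>\<^sup>+x. indicator unit_square x * ennreal (real ?N) \<partial>lborel) = ennreal (real ?N)"
    by (simp add: nn_integral_multc nn_integral_unit_square del: nn_integral_indicator)
  have "card {d. norm (lat d) \<le> r} \<le> card {q. norm (lat q - x) \<le> r + 2}" if "x \<in> unit_square" for x
    using tri(2)[OF that] by (intro card_mono fin subsetI) (smt (verit) mem_Collect_eq)
  then have up: "indicator unit_square x * ennreal (real ?N) \<le>
      indicator unit_square x * ennreal (real (card {q. norm (lat q - x) \<le> r + 2}))" for x
    by (auto simp add: indicator_def simp del: mem_Sigma_iff)
  have "card {q. norm (lat q - x) \<le> r - 2} \<le> card {d. norm (lat d) \<le> r}" if "x \<in> unit_square" for x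
    using tri(1)[OF that] by (intro card_mono fin0 subsetI) (smt (verit) mem_Collect_eq)
  then have lo: "indicator unit_square x * ennreal (real (card {q. norm (lat q - x) \<le> r - 2})) \<le>
      indicator unit_square x * ennreal (real ?N)" for x
    by (auto simp add: indicator_def simp del: mem_Sigma_iff)
  have disc: "(\<integral>\<^sup>+x. indicator unit_square x *
      (\<integral>\<^sup>+q. indicator (cball 0 s) (lat q - x) \<partial>count_space UNIV) \<partial>lborel) = ennreal (pi * s\<^sup>2)"
    if "s \<ge> 0" for s :: real
  proof -
    have "indicator (cball 0 s) \<in> borel_measurable (borel :: (real \<times> real) measure)"
      by (intro borel_measurable_indicator borel_closed closed_cball)
    from nn_integral_unfold[OF this] integral_disc[OF that] show ?thesis by (rule trans)
  qed
  have "(\<integral>\<^sup>+x. indicator unit_square x * ennreal (real ?N) \<partial>lborel) \<le>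
      (\<integral>\<^sup>+x. indicator unit_square x * ennreal (real (card {q. norm (lat q - x) \<le> r + 2})) \<partial>lborel)"
    by (intro nn_integral_mono up)
  also have "\<dots> = ennreal (pi * (r + 2)\<^sup>2)"
    using disc[of "r + 2"] assms unfolding eq by (simp only: add_nonneg_nonneg zero_le_numeral simp_thms)
  finally show "real ?N \<le> pi * (r + 2)\<^sup>2"
    unfolding N by (subst (asm) ennreal_le_iff) auto
  assume r: "r \<ge> 2"
  then have "ennreal (pi * (r - 2)\<^sup>2) =
      (\<integral>\<^sup>+x. indicator unit_square x * ennreal (real (card {q. norm (lat q - x) \<le> r - 2})) \<partial>lborel)"
    using disc[of "r - 2"] unfolding eq by (simp only: diff_ge_0_iff_ge simp_thms)
  also have "\<dots> \<le> (\<integral>\<^sup>+x. indicator unit_square x * ennreal (real ?N) \<partial>lborel)"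
    by (intro nn_integral_mono lo)
  finally show "pi * (r - 2)\<^sup>2 \<le> real ?N"
    unfolding N by (subst (asm) ennreal_le_iff) auto
qed

section \<open>Lattice points in convex sets\<close>

text \<open>
Let \<open>n0\<close> be a point of \<open>A\<close> where \<open>l\<close> is largest. Quasiconcavity keeps \<open>l\<close> at least \<open>l n\<close> between \<open>n\<close> and \<open>n0\<close>, in particular
on the unit interval that starts at \<open>n\<close> in the direction of \<open>n0\<close>. For different \<open>n\<close> these intervals do not overlap, so their
contributions are bounded by the integral; the value at \<open>n0\<close>, which has no interval, is bounded by \<open>B\<close>.
\<close>
lemma sum_int_le_nn_integral_quasiconcave:
  fixes l :: "real \<Rightarrow> ennreal"
  assumes [measurable]: "l \<in> borel_measurable borel"
    and quasi: "\<And>x y z. x \<le> z \<Longrightarrow> z \<le> y \<Longrightarrow> min (l x) (l y) \<le> l z"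
    and bound: "\<And>x. l x \<le> B" and A: "finite A"
  shows "(\<Sum>n\<in>A. l (of_int n)) \<le> (\<integral>\<^sup>+x. l x \<partial>lborel) + B"
proof (cases "A = {}")
  case False
  obtain n0 where n0: "n0 \<in> A" "\<And>n. n \<in> A \<Longrightarrow> l (of_int n) \<le> l (of_int n0)"
  proof -
    have "Max ((\<lambda>n. l (of_int n)) ` A) \<in> (\<lambda>n. l (of_int n)) ` A"
      using False A by (intro Max_in) auto
    then obtain n where "n \<in> A" "l (of_int n) = Max ((\<lambda>n. l (of_int n)) ` A)" by auto
    then show ?thesis using that[of n] A by simp
  qed
  define \<sigma> where "\<sigma> n = (if n < n0 then n else n - 1)" for n
  define J where "J n = {of_int (\<sigma> n) <..< of_int (\<sigma> n) + (1::real)}" for n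
  have disj: "disjoint_family_on J (A - {n0})"
    unfolding disjoint_family_on_def
  proof safe
    fix m n x assume mn: "m \<in> A" "n \<in> A" "m \<noteq> n" "m \<noteq> n0" "n \<noteq> n0" and x: "x \<in> J m" "x \<in> J n"
    have "real_of_int (\<sigma> m) < of_int (\<sigma> n) + 1" "real_of_int (\<sigma> n) < of_int (\<sigma> m) + 1"
      using x by (auto simp: J_def)
    then have "\<sigma> m = \<sigma> n" by linarith
    then show "x \<in> {}" using mn by (auto simp: \<sigma>_def split: if_splits)
  qed
  have each: "l (of_int n) \<le> (\<integral>\<^sup>+x. l x * indicator (J n) x \<partial>lborel)" if n: "n \<in> A - {n0}" for n
  proof -
    have "l (of_int n) \<le> l x" if "x \<in> J n" for x
    proof (cases "n < n0")
      case True
      then have "real_of_int n + 1 \<le> of_int n0" by linarith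
      then have "min (l (of_int n)) (l (of_int n0)) \<le> l x"
        using that True by (intro quasi) (auto simp: J_def \<sigma>_def)
      then show ?thesis using n0(2)[of n] n by (simp add: min_absorb1)
    next
      case False
      then have "n0 + 1 \<le> n" using n by auto
      then have "real_of_int n0 + 1 \<le> of_int n" by linarith
      then have "min (l (of_int n0)) (l (of_int n)) \<le> l x"
        using that False by (intro quasi) (auto simp: J_def \<sigma>_def)
      then show ?thesis using n0(2)[of n] n by (simp add: min_absorb2)
    qed
    then have "(\<integral>\<^sup>+x. l (of_int n) * indicator (J n) x \<partial>lborel) \<le> (\<integral>\<^sup>+x. l x * indicator (J n) x \<partial>lborel)"
      by (intro nn_integral_mono) (auto simp: indicator_def)
    then show ?thesis by (simp add: nn_integral_cmult J_def)
  qed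
  have "(\<Sum>n\<in>A - {n0}. l (of_int n)) \<le> (\<Sum>n\<in>A - {n0}. \<integral>\<^sup>+x. l x * indicator (J n) x \<partial>lborel)"
    by (intro sum_mono each)
  also have "\<dots> = (\<integral>\<^sup>+x. (\<Sum>n\<in>A - {n0}. l x * indicator (J n) x) \<partial>lborel)"
    by (rule nn_integral_sum[symmetric]) (simp add: J_def)
  also have "\<dots> = (\<integral>\<^sup>+x. l x * indicator (\<Union>n\<in>A - {n0}. J n) x \<partial>lborel)"
    using A disj by (simp add: sum_distrib_left[symmetric] indicator_UN_disjoint)
  also have "\<dots> \<le> (\<integral>\<^sup>+x. l x \<partial>lborel)"
    by (intro nn_integral_mono) (auto simp: indicator_def)
  finally show ?thesis
    using A n0(1) bound by (subst sum.remove[of A n0]) (auto simp: add.commute intro!: add_mono)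
qed simp

lemma card_int_in_interval:
  fixes p q :: real
  assumes "p \<le> q"
  shows "real (card {n::int. p \<le> of_int n \<and> of_int n \<le> q}) \<le> q - p + 1"
proof -
  have "{n::int. p \<le> of_int n \<and> of_int n \<le> q} = {\<lceil>p\<rceil>..\<lfloor>q\<rfloor>}" by (auto simp: ceiling_le_iff le_floor_iff)
  then have "real (card {n::int. p \<le> of_int n \<and> of_int n \<le> q}) = real (nat (\<lfloor>q\<rfloor> - \<lceil>p\<rceil> + 1))" by simp
  also have "\<dots> \<le> q - p + 1" using assms by linarith
  finally show ?thesis .
qed

text \<open>
The number of lattice points in a vertical slice exceeds the length of the slice by at most 1. By convexity the length
of the slices is a quasiconcave function, so its sum over integer abscissae exceeds its integral, the area of \<open>C\<close>, by
at most the longest length \<open>2 * M\<close>; there are at most \<open>2 * M + 1\<close> slices.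
\<close>
lemma convex_lattice_count:
  fixes C :: "(real \<times> real) set"
  assumes C: "closed C" "convex C" and sub: "C \<subseteq> {-M..M} \<times> {-M..M}" and M: "M \<ge> 0"
  shows "(\<integral>\<^sup>+q. indicator C (lat q) \<partial>count_space UNIV) \<le> emeasure lborel C + ennreal (4 * M + 1)"
proof -
  define S where "S x = {y. (x, y) \<in> C}" for x
  define l where "l x = emeasure lborel (S x)" for x
  have Cb[measurable]: "C \<in> sets (lborel \<Otimes>\<^sub>M lborel)"
    using C(1) by (metis borel_closed borel_prod sets_lborel sets_pair_measure_cong)
  have Sub: "S x \<subseteq> {-M..M}" and S0: "x \<notin> {-M..M} \<Longrightarrow> S x = {}" for x using sub by (auto simp: S_def)
  have S: "S x = {} \<or> (\<exists>p q. p \<le> q \<and> S x = {p..q})" for x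
  proof -
    have "closed (S x)" unfolding S_def using C(1)
      using continuous_closed_vimage[OF C(1), of "Pair x"] by (simp add: vimage_def continuous_intros)
    moreover have "bounded (S x)" using Sub bounded_subset[OF bounded_closed_interval] by blast
    ultimately have "compact (S x)" by (simp add: compact_eq_bounded_closed)
    moreover have "convex (S x)"
    proof (rule convexI)
      fix y z u v :: real assume *: "y \<in> S x" "z \<in> S x" "0 \<le> u" "0 \<le> v" "u + v = 1"
      have "u *\<^sub>R (x, y) + v *\<^sub>R (x, z) \<in> C"
        using * C(2) by (intro convexD) (auto simp: S_def)
      moreover have "u * x + v * x = x" using \<open>u + v = 1\<close> by (simp add: distrib_right[symmetric])
      ultimately show "u *\<^sub>R y + v *\<^sub>R z \<in> S x" by (simp add: S_def)
    qed
    ultimately obtain p q where "S x = {p..q}"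
      using connected_compact_interval_1[of "S x"] convex_connected by auto
    then show ?thesis by (cases "p \<le> q") auto
  qed
  have l_measurable[measurable]: "l \<in> borel_measurable borel"
  proof -
    have "l = (\<lambda>x. emeasure lborel (Pair x -` C))" by (simp add: l_def S_def vimage_def fun_eq_iff)
    then show ?thesis using lborel.measurable_emeasure_Pair[OF Cb] by simp
  qed
  have l_bound: "l x \<le> ennreal (2 * M)" for x
    using emeasure_mono[OF Sub[of x], of lborel] M by (simp add: l_def)
  have quasi: "min (l x) (l y) \<le> l z" if "x \<le> z" "z \<le> y" for x y z
  proof (cases "S x = {} \<or> S y = {}")
    case True then show ?thesis by (auto simp: l_def)
  next
    case False
    then obtain p q p' q' where *: "S x = {p..q}" "p \<le> q" "S y = {p'..q'}" "p' \<le> q'"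
      using S[of x] S[of y] by auto
    obtain u v where uv: "u \<ge> 0" "v \<ge> 0" "u + v = 1" "z = u * x + v * y"
    proof (cases "x = y")
      case True then show ?thesis using that[of 1 0] \<open>x \<le> z\<close> \<open>z \<le> y\<close> by auto
    next
      case False
      then have "x < y" using that \<open>x \<le> z\<close> \<open>z \<le> y\<close> by auto
      show ?thesis
      proof (rule that[of "(y - z) / (y - x)" "(z - x) / (y - x)"])
        show "(y - z) / (y - x) + (z - x) / (y - x) = 1"
          using \<open>x < y\<close> by (simp add: add_divide_distrib[symmetric])
        have "((y - z) * x + (z - x) * y) = z * (y - x)" by (simp add: algebra_simps)
        then show "z = (y - z) / (y - x) * x + (z - x) / (y - x) * y"
          using \<open>x < y\<close> by (simp add: add_divide_distrib[symmetric])
      qed (use \<open>x < y\<close> \<open>x \<le> z\<close> \<open>z \<le> y\<close> in auto)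
    qed
    have mem: "u * r + v * s \<in> S z" if "r \<in> S x" "s \<in> S y" for r s
    proof -
      have "u *\<^sub>R (x, r) + v *\<^sub>R (y, s) \<in> C"
        using that uv C(2) by (intro convexD) (auto simp: S_def)
      then show ?thesis using uv(4) by (simp add: S_def)
    qed
    then have nonempty: "S z \<noteq> {}" using * by fastforce
    then obtain p'' q'' where z: "S z = {p''..q''}" "p'' \<le> q''" using S[of z] by auto
    have "u * p + v * p' \<in> S z" "u * q + v * q' \<in> S z" using * by (auto intro!: mem)
    then have "u * (q - p) + v * (q' - p') \<le> q'' - p''" using z by (simp add: algebra_simps)
    moreover have "min (q - p) (q' - p') \<le> u * (q - p) + v * (q' - p')"
    proof -
      have "u * min (q - p) (q' - p') \<le> u * (q - p)" "v * min (q - p) (q' - p') \<le> v * (q' - p')"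
        using uv by (auto intro: mult_left_mono)
      then have "(u + v) * min (q - p) (q' - p') \<le> u * (q - p) + v * (q' - p')"
        by (simp add: distrib_right)
      then show ?thesis using uv by simp
    qed
    ultimately have "min (q - p) (q' - p') \<le> q'' - p''" by linarith
    then have "q - p \<le> q'' - p'' \<or> q' - p' \<le> q'' - p''" by linarith
    then show ?thesis
      using * z by (auto simp: l_def min_le_iff_disj ennreal_leI)
  qed
  have slice: "(\<integral>\<^sup>+j. indicator C (lat (i, j)) \<partial>count_space UNIV) \<le> l (of_int i) + 1" for i
  proof (cases "S (of_int i) = {}")
    case True
    then have "indicator C (lat (i, j)) = (0::ennreal)" for j by (auto simp: S_def lat_def)
    then show ?thesis by simp
  next
    case False
    then obtain p q where pq: "S (of_int i) = {p..q}" "p \<le> q" using S[of "of_int i"] by auto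
    have fin: "finite {n::int. p \<le> of_int n \<and> of_int n \<le> q}"
      by (rule finite_subset[of _ "{\<lceil>p\<rceil>..\<lfloor>q\<rfloor>}"]) (auto simp: ceiling_le_iff le_floor_iff)
    have "(lat (i, j) \<in> C) = (j \<in> {n. p \<le> of_int n \<and> of_int n \<le> q})" for j
    proof -
      have "(lat (i, j) \<in> C) = (of_int j \<in> S (of_int i))" by (simp add: S_def lat_def)
      then show ?thesis using pq by simp
    qed
    then have "indicator C (lat (i, j)) = (indicator {n. p \<le> of_int n \<and> of_int n \<le> q} j :: ennreal)" for j
      by (simp add: indicator_def)
    then have "(\<integral>\<^sup>+j. indicator C (lat (i, j)) \<partial>count_space UNIV)
        = ennreal (real (card {n::int. p \<le> of_int n \<and> of_int n \<le> q}))"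
      using nn_integral_count_card[OF fin] by simp
    also have "\<dots> \<le> ennreal (q - p + 1)" by (intro ennreal_leI card_int_in_interval pq)
    also have "\<dots> = l (of_int i) + 1" using pq by (simp add: l_def ennreal_plus)
    finally show ?thesis .
  qed
  define A where "A = {-\<lfloor>M\<rfloor>..\<lfloor>M\<rfloor>}"
  have "(\<integral>\<^sup>+q. indicator C (lat q) \<partial>count_space UNIV)
      = (\<integral>\<^sup>+i. \<integral>\<^sup>+j. indicator C (lat (i, j)) \<partial>count_space UNIV \<partial>count_space UNIV)"
    using nn_integral_fst_count_space[of "\<lambda>q. indicator C (lat q)"] by simp
  also have "\<dots> = (\<Sum>i\<in>A. \<integral>\<^sup>+j. indicator C (lat (i, j)) \<partial>count_space UNIV)"
  proof (rule nn_integral_count_space')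
    fix i assume "i \<notin> A"
    then have "real_of_int i \<notin> {-M..M}" unfolding A_def
      by (simp add: le_floor_iff) linarith
    then have "S (of_int i) = {}" by (rule S0)
    then have "indicator C (lat (i, j)) = (0::ennreal)" for j by (auto simp: S_def lat_def)
    then show "(\<integral>\<^sup>+j. indicator C (lat (i, j)) \<partial>count_space UNIV) = 0" by simp
  qed (auto simp: A_def)
  also have "\<dots> \<le> (\<Sum>i\<in>A. l (of_int i) + 1)"
    by (intro sum_mono slice)
  also have "\<dots> = (\<Sum>i\<in>A. l (of_int i)) + ennreal (real (card A))"
    by (simp add: sum.distrib ennreal_of_nat_eq_real_of_nat)
  also have "\<dots> \<le> ((\<integral>\<^sup>+x. l x \<partial>lborel) + ennreal (2 * M)) + ennreal (2 * M + 1)"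
  proof (intro add_mono sum_int_le_nn_integral_quasiconcave)
    have "real (card A) \<le> 2 * M + 1" using M unfolding A_def by simp
    then show "ennreal (real (card A)) \<le> ennreal (2 * M + 1)" by (rule ennreal_leI)
  qed (use quasi l_bound in \<open>auto simp: A_def\<close>)
  also have "(\<integral>\<^sup>+x. l x \<partial>lborel) = emeasure lborel C"
    using lborel.emeasure_pair_measure_alt[OF Cb] by (simp add: l_def S_def vimage_def lborel_prod)
  also have "emeasure lborel C + ennreal (2 * M) + ennreal (2 * M + 1) = emeasure lborel C + ennreal (4 * M + 1)"
    using M by (simp add: add.assoc ennreal_plus[symmetric] del: ennreal_plus)
  finally show ?thesis .
qed

section \<open>Strips and their overlaps\<close>

text \<open>
For \<open>y = q - x\<close> and \<open>y + d = p - x\<close> the quantity \<open>2 * (d \<bullet> y) + d \<bullet> d\<close> is the difference of the squared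
distances of \<open>p\<close> and \<open>q\<close> from \<open>x\<close>.
\<close>
definition strip :: "real \<Rightarrow> real \<Rightarrow> real \<Rightarrow> real \<times> real \<Rightarrow> (real \<times> real) set" where
  "strip a b R d = {y. norm y \<le> R \<and> norm (y + d) \<le> R \<and> a \<le> 2 * (d \<bullet> y) + d \<bullet> d \<and> 2 * (d \<bullet> y) + d \<bullet> d \<le> b}"

lemma closed_strip: "closed (strip a b R d)"
  unfolding strip_def by (intro closed_Collect_conj closed_Collect_le continuous_intros)

lemma borel_strip [measurable]: "strip a b R d \<in> sets borel"
  by (rule borel_closed[OF closed_strip])

lemma bounded_strip: "bounded (strip a b R d)"
  by (auto simp: bounded_iff strip_def)

lemma emeasure_strip: "emeasure lborel (strip a b R d) = ennreal (measure lborel (strip a b R d))"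
  using emeasure_bounded_finite[OF bounded_strip, of a b R d]
  by (intro emeasure_eq_ennreal_measure) (simp add: less_top)

lemma slab_subset_interval:
  fixes k :: real
  assumes "k \<noteq> 0"
  obtains p where "{x. a \<le> k * x + c \<and> k * x + c \<le> b} \<subseteq> {p..p + (b - a) / \<bar>k\<bar>}"
proof -
  define m where "m = ((a + b) / 2 - c) / k"
  define h where "h = (b - a) / (2 * \<bar>k\<bar>)"
  have "{x. a \<le> k * x + c \<and> k * x + c \<le> b} \<subseteq> {m - h..m - h + (b - a) / \<bar>k\<bar>}"
  proof
    fix x assume "x \<in> {x. a \<le> k * x + c \<and> k * x + c \<le> b}"
    then have "\<bar>k * x + c - (a + b) / 2\<bar> \<le> (b - a) / 2" by (auto simp: abs_le_iff field_simps)
    moreover have "k * x + c - (a + b) / 2 = k * (x - m)" using assms by (simp add: m_def field_simps)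
    ultimately have "\<bar>k\<bar> * \<bar>x - m\<bar> \<le> (b - a) / 2" by (simp add: abs_mult)
    then have "\<bar>x - m\<bar> \<le> h" using assms by (simp add: h_def field_simps)
    moreover have "(b - a) / \<bar>k\<bar> = 2 * h" using assms by (simp add: h_def diff_divide_distrib)
    ultimately show "x \<in> {m - h..m - h + (b - a) / \<bar>k\<bar>}" by (auto simp: abs_le_iff)
  qed
  then show ?thesis by (rule that)
qed

lemma emeasure_slab_le:
  fixes k :: real
  assumes "k \<noteq> 0" "a \<le> b"
  shows "emeasure lborel {x. a \<le> k * x + c \<and> k * x + c \<le> b} \<le> ennreal ((b - a) / \<bar>k\<bar>)"
proof -
  obtain p where "{x. a \<le> k * x + c \<and> k * x + c \<le> b} \<subseteq> {p..p + (b - a) / \<bar>k\<bar>}"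
    using slab_subset_interval[OF \<open>k \<noteq> 0\<close>] .
  then have "emeasure lborel {x. a \<le> k * x + c \<and> k * x + c \<le> b} \<le> emeasure lborel {p..p + (b - a) / \<bar>k\<bar>}"
    by (intro emeasure_mono) auto
  then show ?thesis using assms by simp
qed

lemma emeasure_le_of_slices:
  assumes [measurable]: "S \<in> sets (borel :: (real \<times> real) measure)" and "R \<ge> 0"
    and S: "\<And>y. y \<in> S \<Longrightarrow> \<bar>fst y\<bar> \<le> R \<and> \<bar>snd y\<bar> \<le> R"
  shows "(\<And>y. emeasure lborel {x. (x, y) \<in> S} \<le> ennreal e) \<Longrightarrow> emeasure lborel S \<le> ennreal (2 * R) * ennreal e"
    and "(\<And>x. emeasure lborel {y. (x, y) \<in> S} \<le> ennreal e) \<Longrightarrow> emeasure lborel S \<le> ennreal (2 * R) * ennreal e"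
proof -
  have sl[measurable]: "{x. (x, y) \<in> S} \<in> sets borel" "{z. (y, z) \<in> S} \<in> sets borel" for y
  proof -
    have "S \<in> sets (borel \<Otimes>\<^sub>M borel)" using assms(1) unfolding borel_prod .
    then have "(\<lambda>x. (x, y)) -` S \<in> sets borel" "Pair y -` S \<in> sets borel" by (auto intro: sets_Pair2 sets_Pair1)
    then show "{x. (x, y) \<in> S} \<in> sets borel" "{z. (y, z) \<in> S} \<in> sets borel" by (auto simp: vimage_def)
  qed
  {
    assume e: "\<And>y. emeasure lborel {x. (x, y) \<in> S} \<le> ennreal e"
    have "emeasure lborel S = (\<integral>\<^sup>+y. \<integral>\<^sup>+x. indicator S (x, y) \<partial>lborel \<partial>lborel)"
      using nn_integral_plane(2)[of "indicator S"] by simp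
    also have "\<dots> \<le> (\<integral>\<^sup>+y. indicator {-R..R} y * ennreal e \<partial>lborel)"
    proof (rule nn_integral_mono)
      fix y :: real
      have "(\<integral>\<^sup>+x. indicator S (x, y) \<partial>lborel) = (\<integral>\<^sup>+x. indicator {x. (x, y) \<in> S} x \<partial>lborel)"
        by (simp add: indicator_def)
      also have "\<dots> = emeasure lborel {x. (x, y) \<in> S}" by simp
      also have "\<dots> \<le> indicator {-R..R} y * ennreal e"
      proof (cases "y \<in> {-R..R}")
        case False
        then have "{x. (x, y) \<in> S} = {}" using S by (force simp: abs_le_iff)
        then show ?thesis by simp
      qed (use e in simp)
      finally show "(\<integral>\<^sup>+x. indicator S (x, y) \<partial>lborel) \<le> indicator {-R..R} y * ennreal e" .
    qed
    also have "\<dots> = ennreal (2 * R) * ennreal e" using \<open>R \<ge> 0\<close> by (simp add: nn_integral_multc)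
    finally show "emeasure lborel S \<le> ennreal (2 * R) * ennreal e" .
  }
  {
    assume e: "\<And>x. emeasure lborel {y. (x, y) \<in> S} \<le> ennreal e"
    have "emeasure lborel S = (\<integral>\<^sup>+x. \<integral>\<^sup>+y. indicator S (x, y) \<partial>lborel \<partial>lborel)"
      using nn_integral_plane(1)[of "indicator S"] by simp
    also have "\<dots> \<le> (\<integral>\<^sup>+y. indicator {-R..R} y * ennreal e \<partial>lborel)"
    proof (rule nn_integral_mono)
      fix x :: real
      have "(\<integral>\<^sup>+y. indicator S (x, y) \<partial>lborel) = (\<integral>\<^sup>+y. indicator {y. (x, y) \<in> S} y \<partial>lborel)"
        by (simp add: indicator_def)
      also have "\<dots> = emeasure lborel {y. (x, y) \<in> S}" by simp
      also have "\<dots> \<le> indicator {-R..R} x * ennreal e"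
      proof (cases "x \<in> {-R..R}")
        case False
        then have "{y. (x, y) \<in> S} = {}" using S by (force simp: abs_le_iff)
        then show ?thesis by simp
      qed (use e in simp)
      finally show "(\<integral>\<^sup>+y. indicator S (x, y) \<partial>lborel) \<le> indicator {-R..R} x * ennreal e" .
    qed
    also have "\<dots> = ennreal (2 * R) * ennreal e" using \<open>R \<ge> 0\<close> by (simp add: nn_integral_multc)
    finally show "emeasure lborel S \<le> ennreal (2 * R) * ennreal e" .
  }
qed

text \<open>
In the direction of a nonzero coordinate \<open>c\<close> of \<open>d\<close>, every slice of the strip lies in an interval of length
\<open>(b - a) / (2 * \<bar>c\<bar>)\<close>, and the other coordinate of a point of the strip ranges over an interval of length \<open>2 * R\<close>.
\<close>
lemma emeasure_strip_le:
  assumes "R \<ge> 0" "a \<le> b"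
  shows "fst d \<noteq> 0 \<Longrightarrow> emeasure lborel (strip a b R d) \<le> ennreal (R * (b - a) / \<bar>fst d\<bar>)"
    and "snd d \<noteq> 0 \<Longrightarrow> emeasure lborel (strip a b R d) \<le> ennreal (R * (b - a) / \<bar>snd d\<bar>)"
proof -
  have bd: "\<bar>fst y\<bar> \<le> R \<and> \<bar>snd y\<bar> \<le> R" if "y \<in> strip a b R d" for y
    using that norm_fst_le[of "fst y" "snd y"] norm_snd_le[of "snd y" "fst y"] by (auto simp: strip_def)
  {
    assume "fst d \<noteq> 0"
    have "emeasure lborel {x. (x, y) \<in> strip a b R d} \<le> ennreal ((b - a) / \<bar>2 * fst d\<bar>)" for y
    proof -
      have "emeasure lborel {x. (x, y) \<in> strip a b R d} \<le>
          emeasure lborel {x. a \<le> 2 * fst d * x + (2 * snd d * y + d \<bullet> d) \<and> 2 * fst d * x + (2 * snd d * y + d \<bullet> d) \<le> b}"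
        by (intro emeasure_mono) (auto simp: strip_def inner_prod_def algebra_simps)
      also have "\<dots> \<le> ennreal ((b - a) / \<bar>2 * fst d\<bar>)"
        by (rule emeasure_slab_le) (use \<open>fst d \<noteq> 0\<close> assms in auto)
      finally show ?thesis .
    qed
    from emeasure_le_of_slices(1)[OF borel_strip \<open>R \<ge> 0\<close> bd this]
    show "emeasure lborel (strip a b R d) \<le> ennreal (R * (b - a) / \<bar>fst d\<bar>)"
      using assms by (simp add: ennreal_mult[symmetric] abs_mult)
  }
  {
    assume "snd d \<noteq> 0"
    have "emeasure lborel {y. (x, y) \<in> strip a b R d} \<le> ennreal ((b - a) / \<bar>2 * snd d\<bar>)" for x
    proof -
      have "emeasure lborel {y. (x, y) \<in> strip a b R d} \<le>
          emeasure lborel {y. a \<le> 2 * snd d * y + (2 * fst d * x + d \<bullet> d) \<and> 2 * snd d * y + (2 * fst d * x + d \<bullet> d) \<le> b}"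
        by (intro emeasure_mono) (auto simp: strip_def inner_prod_def algebra_simps)
      also have "\<dots> \<le> ennreal ((b - a) / \<bar>2 * snd d\<bar>)"
        by (rule emeasure_slab_le) (use \<open>snd d \<noteq> 0\<close> assms in auto)
      finally show ?thesis .
    qed
    from emeasure_le_of_slices(2)[OF borel_strip \<open>R \<ge> 0\<close> bd this]
    show "emeasure lborel (strip a b R d) \<le> ennreal (R * (b - a) / \<bar>snd d\<bar>)"
      using assms by (simp add: ennreal_mult[symmetric] abs_mult)
  }
qed

definition overlap :: "(real \<times> real) set \<Rightarrow> (real \<times> real) set \<Rightarrow> real \<times> real \<Rightarrow> ennreal" where
  "overlap S S' t = (\<integral>\<^sup>+y. indicator S y * indicator S' (y + t) \<partial>lborel)"

lemma measurable_overlap_integrand: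
  assumes [measurable]: "S \<in> sets borel" "S' \<in> sets (borel :: (real \<times> real) measure)"
  shows "(\<lambda>y. indicator S y * indicator S' (y + t) :: ennreal) \<in> borel_measurable borel"
  by measurable

lemma nn_integral_overlap:
  assumes [measurable]: "S \<in> sets borel" "S' \<in> sets borel"
  shows "(\<integral>\<^sup>+t. overlap S S' t \<partial>lborel) = emeasure lborel S * emeasure lborel S'"
proof -
  have "(\<integral>\<^sup>+t. overlap S S' t \<partial>lborel)
     = (\<integral>\<^sup>+y. \<integral>\<^sup>+t. indicator S y * indicator S' (y + t) \<partial>lborel \<partial>lborel)"
    unfolding overlap_def
  proof (rule nn_integral_plane_swap)
    have [measurable]: "fst \<in> borel_measurable (borel :: ((real \<times> real) \<times> (real \<times> real)) measure)"
        "(\<lambda>x :: (real \<times> real) \<times> (real \<times> real). fst x + snd x) \<in> borel_measurable borel"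
      by (intro borel_measurable_continuous_onI continuous_intros)+
    show "(\<lambda>(y, t). indicator S y * indicator S' (y + t) :: ennreal) \<in> borel_measurable borel"
      unfolding split_beta' by measurable
  qed
  also have "\<dots> = (\<integral>\<^sup>+y. indicator S y * emeasure lborel S' \<partial>lborel)"
    by (simp add: nn_integral_cmult nn_integral_lborel_translate[of "indicator S'"])
  also have "\<dots> = emeasure lborel S * emeasure lborel S'"
    by (simp add: nn_integral_multc)
  finally show ?thesis .
qed

lemma convex_affine_vimage:
  assumes "\<And>u v s t. u + v = 1 \<Longrightarrow> f (u *\<^sub>R s + v *\<^sub>R t) = u *\<^sub>R f s + v *\<^sub>R f t" "convex S"
  shows "convex {t. f t \<in> S}"
  using assms by (auto simp: convex_def)

text \<open>
For independent \<open>d, d'\<close> the sum over the lattice of the overlaps is compared with their integral over the plane, which is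
the product of the areas. The point \<open>Y w t\<close> is the solution \<open>y\<close> of \<open>2 * (d \<bullet> y) = fst w\<close> and
\<open>2 * (d' \<bullet> (y + t)) = snd w\<close>. In the variable \<open>w\<close> the two slab conditions no longer involve \<open>t\<close>: they say that \<open>w\<close>
lies in a fixed square \<open>I\<close> of side \<open>b - a\<close>. The remaining conditions put four affine functions of \<open>t\<close> into a
disc, so for fixed \<open>w\<close> they describe a convex set of \<open>t\<close>, contained in a square of side \<open>4 * R\<close>. The lattice
point bound for convex sets applies to it; its error \<open>8 * R + 1\<close> is multiplied by the area of \<open>I\<close> and the Jacobian
\<open>1 / (4 * \<bar>D\<bar>)\<close>.
\<close>
lemma sum_overlap_le:
  fixes d d' :: "real \<times> real"
  assumes R: "R \<ge> 0" and ab: "a \<le> b" and d: "fst d \<noteq> 0"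
    and D: "D = fst d * snd d' - snd d * fst d'" "D \<noteq> 0"
  shows "(\<integral>\<^sup>+q. overlap (strip a b R d) (strip a b R d') (lat q) \<partial>count_space UNIV)
       \<le> emeasure lborel (strip a b R d) * emeasure lborel (strip a b R d')
         + ennreal ((b - a)\<^sup>2 * (8 * R + 1) / (4 * \<bar>D\<bar>))"
proof -
  let ?S = "strip a b R d" and ?S' = "strip a b R d'"
  define Y where "Y w t = ((snd d' * fst w - snd d * (snd w - 2 * (d' \<bullet> t))) / (2 * D),
      (fst d * (snd w - 2 * (d' \<bullet> t)) - fst d' * fst w) / (2 * D))" for w t :: "real \<times> real"
  define I where "I = {a - d \<bullet> d..b - d \<bullet> d} \<times> {a - d' \<bullet> d'..b - d' \<bullet> d'}"
  define K where "K = {(w, t). norm (Y w t) \<le> R \<and> norm (Y w t + d) \<le> R \<and>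
      norm (Y w t + t) \<le> R \<and> norm (Y w t + t + d') \<le> R}"
  have Y1: "2 * (d \<bullet> Y w t) = fst w" for w t
  proof -
    have "2 * (d \<bullet> Y w t) = (fst d * (snd d' * fst w - snd d * (snd w - 2 * (d' \<bullet> t)))
        + snd d * (fst d * (snd w - 2 * (d' \<bullet> t)) - fst d' * fst w)) / D"
      by (simp add: Y_def inner_prod_def add_divide_distrib)
    also have "\<dots> = (D * fst w) / D" by (simp add: D(1) algebra_simps)
    finally show ?thesis using D(2) by simp
  qed
  have Y2: "2 * (d' \<bullet> Y w t) = snd w - 2 * (d' \<bullet> t)" for w t
  proof -
    have "2 * (d' \<bullet> Y w t) = (fst d' * (snd d' * fst w - snd d * (snd w - 2 * (d' \<bullet> t)))
        + snd d' * (fst d * (snd w - 2 * (d' \<bullet> t)) - fst d' * fst w)) / D"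
      unfolding Y_def inner_prod_def by (simp add: add_divide_distrib)
    also have "\<dots> = (D * (snd w - 2 * (d' \<bullet> t))) / D" by (simp add: D(1) algebra_simps)
    finally show ?thesis using D(2) by simp
  qed
  have Yaff: "Y w (u *\<^sub>R s + v *\<^sub>R t) = u *\<^sub>R Y w s + v *\<^sub>R Y w t" if "u + v = 1" for u v s t w
  proof -
    have v: "v = 1 - u" using that by simp
    show ?thesis unfolding v Y_def
      by (simp add: inner_add_right add_divide_distrib diff_divide_distrib algebra_simps)
  qed
  have cont: "continuous_on UNIV (\<lambda>x. Y (fst x) (snd x))"
    unfolding Y_def by (intro continuous_intros) (use D(2) in auto)
  have K_closed: "closed K"
    unfolding K_def split_beta' by (intro closed_Collect_conj closed_Collect_le continuous_intros cont)
  have I_closed: "closed I" unfolding I_def by (intro closed_Times) auto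
  have meas: "(\<lambda>(w, t). indicator I w * indicator K (w, t) :: ennreal) \<in> borel_measurable borel"
  proof -
    have [measurable]: "{x. fst x \<in> I} \<in> sets (borel :: ((real \<times> real) \<times> (real \<times> real)) measure)"
      using continuous_closed_vimage[OF I_closed, of fst] by (intro borel_closed) (auto simp: vimage_def)
    have [measurable]: "K \<in> sets borel" by (rule borel_closed[OF K_closed])
    have "(\<lambda>x. indicator {x. fst x \<in> I} x * indicator K x :: ennreal) \<in> borel_measurable borel"
      by measurable
    moreover have "(\<lambda>x. indicator {x. fst x \<in> I} x * indicator K x :: ennreal) = (\<lambda>(w, t). indicator I w * indicator K (w, t))"
      by (auto simp: fun_eq_iff indicator_def)
    ultimately show ?thesis by simp
  qed
  have K_slice: "{t. (w, t) \<in> K} \<in> sets borel" "{w. (w, t) \<in> K} \<in> sets borel" for w t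
    using continuous_closed_vimage[OF K_closed, of "Pair w"] continuous_closed_vimage[OF K_closed, of "\<lambda>w. (w, t)"]
    by (auto simp: vimage_def intro!: borel_closed continuous_intros)
  have slice_w: "(\<lambda>w. indicator I w * indicator K (w, t) :: ennreal) \<in> borel_measurable borel" for t
  proof -
    have "(\<lambda>w. indicator I w * indicator {w. (w, t) \<in> K} w :: ennreal) \<in> borel_measurable borel"
      using K_slice borel_closed[OF I_closed] by measurable
    then show ?thesis by (simp add: indicator_def)
  qed
  have slice_t: "(\<lambda>t. indicator K (w, t) :: ennreal) \<in> borel_measurable borel" for w
  proof -
    have "(\<lambda>t. indicator {t. (w, t) \<in> K} t :: ennreal) \<in> borel_measurable borel"
      by (intro borel_measurable_indicator K_slice)
    then show ?thesis by (simp add: indicator_def)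
  qed
  define c where "c = 1 / (4 * \<bar>D\<bar>)"
  have c: "c \<ge> 0" by (simp add: c_def)
  (* Substituting w for y turns the slab condition for d' into one that depends on t only through a translation of w;
     undoing this translation moves the dependence on t into Y. *)
  have ov: "overlap ?S ?S' t = ennreal c * (\<integral>\<^sup>+w. indicator I w * indicator K (w, t) \<partial>lborel)" for t
  proof -
    define h where "h y = (indicator ?S y * indicator ?S' (y + t) :: ennreal)" for y
    have h[measurable]: "h \<in> borel_measurable borel" unfolding h_def by measurable
    have "h (Y w t) = indicator I w * indicator K (w, t)" for w
      using Y1[of w t] Y2[of w t]
      by (cases w) (auto simp: h_def I_def K_def strip_def indicator_def inner_add_right algebra_simps)
    then have "(\<integral>\<^sup>+w. indicator I w * indicator K (w, t) \<partial>lborel) = (\<integral>\<^sup>+w. h (Y w t) \<partial>lborel)" by simp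
    also have "\<dots> = (\<integral>\<^sup>+w. h (Y ((0, 2 * (d' \<bullet> t)) + w) t) \<partial>lborel)"
    proof (rule nn_integral_lborel_translate[symmetric])
      have "(\<lambda>w. Y w t) \<in> borel_measurable borel"
        unfolding Y_def by (intro borel_measurable_continuous_onI continuous_intros) (use D(2) in auto)
      then show "(\<lambda>w. h (Y w t)) \<in> borel_measurable borel" by measurable
    qed
    also have "\<dots> = (\<integral>\<^sup>+w. h (((2 * snd d') * fst w - (2 * snd d) * snd w) / (4 * D),
        ((2 * fst d) * snd w - (2 * fst d') * fst w) / (4 * D)) \<partial>lborel)"
    proof (rule nn_integral_cong)
      fix w :: "real \<times> real"
      have "(snd d' * fst w - snd d * snd w) / (2 * D) = ((2 * snd d') * fst w - (2 * snd d) * snd w) / (4 * D)"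
        "(fst d * snd w - fst d' * fst w) / (2 * D) = ((2 * fst d) * snd w - (2 * fst d') * fst w) / (4 * D)"
        using D(2) by (simp_all add: field_simps)
      then show "h (Y ((0, 2 * (d' \<bullet> t)) + w) t) = h (((2 * snd d') * fst w - (2 * snd d) * snd w) / (4 * D),
        ((2 * fst d) * snd w - (2 * fst d') * fst w) / (4 * D))" by (simp add: Y_def)
    qed
    also have "\<dots> = ennreal \<bar>4 * D\<bar> * (\<integral>\<^sup>+y. h y \<partial>lborel)"
      by (rule nn_integral_linear_subst[OF h]) (use d D in \<open>auto simp: algebra_simps\<close>)
    finally have *: "(\<integral>\<^sup>+w. indicator I w * indicator K (w, t) \<partial>lborel) = ennreal \<bar>4 * D\<bar> * overlap ?S ?S' t"
      by (simp add: overlap_def h_def)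
    have "ennreal c * ennreal \<bar>4 * D\<bar> = 1"
      using D(2) by (simp add: c_def ennreal_mult[symmetric] abs_mult)
    then show ?thesis unfolding * by (simp add: mult.assoc[symmetric])
  qed
  (* A point t of the slice is the difference of Y w t + t and Y w t, two points of the disc, so it has norm at most 2 R. *)
  have count: "(\<integral>\<^sup>+q. indicator K (w, lat q) \<partial>count_space UNIV)
      \<le> (\<integral>\<^sup>+t. indicator K (w, t) \<partial>lborel) + ennreal (8 * R + 1)" for w
  proof -
    define C where "C = {t. (w, t) \<in> K}"
    have C: "C = {t. Y w t \<in> cball 0 R} \<inter> {t. Y w t + d \<in> cball 0 R} \<inter>
        {t. Y w t + t \<in> cball 0 R} \<inter> {t. Y w t + t + d' \<in> cball 0 R}"
      by (auto simp: C_def K_def)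
    have shift: "x + e = u *\<^sub>R e + (x + v *\<^sub>R e)" if "u + v = 1" for u v and x e :: "real \<times> real"
    proof -
      have "u *\<^sub>R e + (x + v *\<^sub>R e) = x + (u + v) *\<^sub>R e" by (simp add: algebra_simps)
      then show ?thesis using that by simp
    qed
    have "convex C" unfolding C
    proof (intro convex_Int convex_affine_vimage convex_cball)
      fix u v :: real and s t :: "real \<times> real" assume uv: "u + v = 1"
      show "Y w (u *\<^sub>R s + v *\<^sub>R t) = u *\<^sub>R Y w s + v *\<^sub>R Y w t" by (rule Yaff[OF uv])
      show "Y w (u *\<^sub>R s + v *\<^sub>R t) + d = u *\<^sub>R (Y w s + d) + v *\<^sub>R (Y w t + d)"
        unfolding Yaff[OF uv] using shift[OF uv, of _ d] by (simp add: algebra_simps)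
      show "Y w (u *\<^sub>R s + v *\<^sub>R t) + (u *\<^sub>R s + v *\<^sub>R t) = u *\<^sub>R (Y w s + s) + v *\<^sub>R (Y w t + t)"
        unfolding Yaff[OF uv] by (simp add: algebra_simps)
      show "Y w (u *\<^sub>R s + v *\<^sub>R t) + (u *\<^sub>R s + v *\<^sub>R t) + d' = u *\<^sub>R (Y w s + s + d') + v *\<^sub>R (Y w t + t + d')"
        unfolding Yaff[OF uv] using shift[OF uv, of _ d'] by (simp add: algebra_simps)
    qed
    moreover have "closed C"
      using continuous_closed_vimage[OF K_closed, of "Pair w"] by (simp add: C_def vimage_def continuous_intros)
    moreover have "C \<subseteq> {-(2 * R)..2 * R} \<times> {-(2 * R)..2 * R}"
    proof
      fix t assume "t \<in> C"
      then have "norm (Y w t) \<le> R" "norm (Y w t + t) \<le> R" by (auto simp: C_def K_def)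
      then have "norm t \<le> 2 * R" using norm_triangle_ineq4[of "Y w t + t" "Y w t"] by simp
      then show "t \<in> {-(2 * R)..2 * R} \<times> {-(2 * R)..2 * R}"
        using norm_fst_le[of "fst t" "snd t"] norm_snd_le[of "snd t" "fst t"]
        by (auto simp: mem_Times_iff abs_le_iff)
    qed
    ultimately have "(\<integral>\<^sup>+q. indicator C (lat q) \<partial>count_space UNIV) \<le> emeasure lborel C + ennreal (4 * (2 * R) + 1)"
      using R by (intro convex_lattice_count) auto
    moreover have "(\<integral>\<^sup>+t. indicator K (w, t) \<partial>lborel) = (\<integral>\<^sup>+t. indicator C t \<partial>lborel)"
      by (simp add: C_def indicator_def)
    moreover have "(\<integral>\<^sup>+t. indicator C t \<partial>lborel) = emeasure lborel C"
      using K_slice by (simp add: C_def)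
    moreover have "indicator K (w, lat q) = (indicator C (lat q) :: ennreal)" for q
      by (simp add: C_def indicator_def)
    ultimately show ?thesis by simp
  qed
  have I_meas: "(\<integral>\<^sup>+w. indicator I w \<partial>lborel) = ennreal ((b - a)\<^sup>2)"
  proof -
    have "emeasure lborel I = ennreal ((b - a)\<^sup>2)"
      using ab unfolding I_def lborel_prod[symmetric]
      by (subst lborel.emeasure_pair_measure_Times) (auto simp: ennreal_mult[symmetric] power2_eq_square)
    moreover have "I \<in> sets borel" using I_closed by (rule borel_closed)
    ultimately show ?thesis by simp
  qed
  have "(\<integral>\<^sup>+q. overlap ?S ?S' (lat q) \<partial>count_space UNIV)
      = ennreal c * (\<integral>\<^sup>+q. \<integral>\<^sup>+w. indicator I w * indicator K (w, lat q) \<partial>lborel \<partial>count_space UNIV)"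
    unfolding ov by (rule nn_integral_cmult) simp
  also have "(\<integral>\<^sup>+q. \<integral>\<^sup>+w. indicator I w * indicator K (w, lat q) \<partial>lborel \<partial>count_space UNIV)
      = (\<integral>\<^sup>+w. \<integral>\<^sup>+q. indicator I w * indicator K (w, lat q) \<partial>count_space UNIV \<partial>lborel)"
    using slice_w by (intro nn_integral_count_space_nn_integral[symmetric]) auto
  also have "\<dots> \<le> (\<integral>\<^sup>+w. (\<integral>\<^sup>+t. indicator I w * indicator K (w, t) \<partial>lborel) + ennreal (8 * R + 1) * indicator I w \<partial>lborel)"
  proof (rule nn_integral_mono)
    fix w
    have "(\<integral>\<^sup>+q. indicator I w * indicator K (w, lat q) \<partial>count_space UNIV)
        = indicator I w * (\<integral>\<^sup>+q. indicator K (w, lat q) \<partial>count_space UNIV)"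
      by (rule nn_integral_cmult) simp
    also have "\<dots> \<le> indicator I w * ((\<integral>\<^sup>+t. indicator K (w, t) \<partial>lborel) + ennreal (8 * R + 1))"
      by (intro mult_left_mono count) simp
    also have "\<dots> = (\<integral>\<^sup>+t. indicator I w * indicator K (w, t) \<partial>lborel) + ennreal (8 * R + 1) * indicator I w"
      using slice_t by (subst nn_integral_cmult) (auto simp: distrib_left mult.commute)
    finally show "(\<integral>\<^sup>+q. indicator I w * indicator K (w, lat q) \<partial>count_space UNIV)
      \<le> (\<integral>\<^sup>+t. indicator I w * indicator K (w, t) \<partial>lborel) + ennreal (8 * R + 1) * indicator I w" .
  qed
  also have "\<dots> = (\<integral>\<^sup>+w. \<integral>\<^sup>+t. indicator I w * indicator K (w, t) \<partial>lborel \<partial>lborel)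
      + ennreal (8 * R + 1) * ennreal ((b - a)\<^sup>2)"
  proof -
    have m: "(\<lambda>w. \<integral>\<^sup>+t. indicator I w * indicator K (w, t) \<partial>lborel) \<in> borel_measurable lborel"
      by (rule lborel.borel_measurable_nn_integral) (use meas in \<open>simp add: lborel_prod\<close>)
    have "I \<in> sets borel" using I_closed by (rule borel_closed)
    then show ?thesis
      using m by (subst nn_integral_add) (auto simp: nn_integral_cmult I_meas)
  qed
  also have "(\<integral>\<^sup>+w. \<integral>\<^sup>+t. indicator I w * indicator K (w, t) \<partial>lborel \<partial>lborel)
      = (\<integral>\<^sup>+t. \<integral>\<^sup>+w. indicator I w * indicator K (w, t) \<partial>lborel \<partial>lborel)"
    by (rule nn_integral_plane_swap[symmetric]) (rule meas)
  finally have "(\<integral>\<^sup>+q. overlap ?S ?S' (lat q) \<partial>count_space UNIV) \<le>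
      ennreal c * (\<integral>\<^sup>+t. \<integral>\<^sup>+w. indicator I w * indicator K (w, t) \<partial>lborel \<partial>lborel)
      + ennreal c * (ennreal (8 * R + 1) * ennreal ((b - a)\<^sup>2))"
    by (simp add: distrib_left mult_left_mono)
  also have "ennreal c * (\<integral>\<^sup>+t. \<integral>\<^sup>+w. indicator I w * indicator K (w, t) \<partial>lborel \<partial>lborel)
      = (\<integral>\<^sup>+t. overlap ?S ?S' t \<partial>lborel)"
    unfolding ov
  proof (rule nn_integral_cmult[symmetric])
    have "(\<lambda>(t, w). indicator I w * indicator K (w, t) :: ennreal) \<in> borel_measurable (lborel \<Otimes>\<^sub>M lborel)"
      using measurable_pair_swap[of "\<lambda>(w, t). indicator I w * indicator K (w, t) :: ennreal" lborel lborel borel] meas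
      by (simp add: lborel_prod split_beta')
    then show "(\<lambda>t. \<integral>\<^sup>+w. indicator I w * indicator K (w, t) \<partial>lborel) \<in> borel_measurable lborel"
      by (rule lborel.borel_measurable_nn_integral)
  qed
  also have "\<dots> = emeasure lborel ?S * emeasure lborel ?S'"
    by (rule nn_integral_overlap) auto
  also have "ennreal c * (ennreal (8 * R + 1) * ennreal ((b - a)\<^sup>2)) = ennreal ((b - a)\<^sup>2 * (8 * R + 1) / (4 * \<bar>D\<bar>))"
  proof -
    have "ennreal c * (ennreal (8 * R + 1) * ennreal ((b - a)\<^sup>2)) = ennreal (c * ((8 * R + 1) * (b - a)\<^sup>2))"
      using R c by (simp add: ennreal_mult del: ennreal_plus)
    then show ?thesis by (simp add: c_def mult_ac)
  qed
  finally show ?thesis .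
qed

section \<open>The mean number of close pairs\<close>

text \<open>
The strip in coordinates \<open>(u, t)\<close> for which \<open>y = - d / 2 + (u / (2 * \<bar>d\<bar>\<^sup>2)) d + t d\<^sup>\<bottom>\<close>: there \<open>u\<close> is the difference of the
squared norms of \<open>y + d\<close> and \<open>y\<close>, and the term \<open>\<bar>u\<bar> / 2\<close> merges the conditions on these two norms into one.
Scaling the second coordinate by the length of \<open>d\<close> makes the Jacobian independent of \<open>d\<close>.
\<close>
definition strip_coords :: "real \<Rightarrow> real \<Rightarrow> real \<Rightarrow> real \<times> real \<Rightarrow> (real \<times> real) set" where
  "strip_coords a b R d = {z. a \<le> fst z \<and> fst z \<le> b \<and>
     (d \<bullet> d) * ((snd z)\<^sup>2 + 1/4) + (fst z)\<^sup>2 / (4 * (d \<bullet> d)) + \<bar>fst z\<bar> / 2 \<le> R\<^sup>2}"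

lemma borel_strip_coords [measurable]: "strip_coords a b R d \<in> sets borel"
proof -
  have "closed (strip_coords a b R d)"
  proof (cases "d \<bullet> d = 0")
    case True
    show ?thesis unfolding strip_coords_def True
      by (simp, intro closed_Collect_conj closed_Collect_le continuous_intros)
  next
    case False
    then show ?thesis unfolding strip_coords_def
      by (intro closed_Collect_conj closed_Collect_le continuous_intros) auto
  qed
  then show ?thesis by (rule borel_closed)
qed

lemma emeasure_strip_eq:
  assumes d: "fst d \<noteq> 0" and R: "R \<ge> 0"
  shows "2 * emeasure lborel (strip a b R d) = emeasure lborel (strip_coords a b R d)"
proof -
  define n where "n = d \<bullet> d"
  have n: "n > 0" using d by (cases d) (auto simp: n_def zero_prod_def simp del: inner_Pair)
  have n': "n = (fst d)\<^sup>2 + (snd d)\<^sup>2" by (simp add: n_def inner_prod_def power2_eq_square)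
  (* The substitution is linear after moving the centre -d/2 of the strip u = 0 to the origin. *)
  define h where "h y = (indicator (strip a b R d) (- ((1/2) *\<^sub>R d) + y) :: ennreal)" for y
  have h[measurable]: "h \<in> borel_measurable borel" unfolding h_def by measurable
  define Y where "Y z = ((fst d / n * fst z - 2 * snd d * snd z) / 2, (2 * fst d * snd z - (- snd d / n) * fst z) / 2)"
    for z :: "real \<times> real"
  have dY: "d \<bullet> Y z = fst z / 2" for z
  proof -
    have "d \<bullet> Y z = ((fst d)\<^sup>2 + (snd d)\<^sup>2) * fst z / (2 * n)"
      using n by (simp add: Y_def inner_prod_def field_simps power2_eq_square)
    then show ?thesis using n by (simp add: n'[symmetric])
  qed
  have YY: "Y z \<bullet> Y z = (fst z)\<^sup>2 / (4 * n) + (snd z)\<^sup>2 * n" for z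
  proof -
    have "Y z \<bullet> Y z = ((fst d)\<^sup>2 + (snd d)\<^sup>2) * (fst z)\<^sup>2 / (4 * n\<^sup>2) + (snd z)\<^sup>2 * ((fst d)\<^sup>2 + (snd d)\<^sup>2)"
      using n by (simp add: Y_def inner_prod_def field_simps power2_eq_square)
    then show ?thesis using n unfolding n'[symmetric] by (simp add: power2_eq_square)
  qed
  have "h (Y z) = indicator (strip_coords a b R d) z" for z
  proof -
    have 1: "norm (- ((1/2) *\<^sub>R d) + Y z) \<le> R \<longleftrightarrow> n * ((snd z)\<^sup>2 + 1/4) + (fst z)\<^sup>2 / (4 * n) - fst z / 2 \<le> R\<^sup>2"
    proof -
      have e: "(- ((1/2) *\<^sub>R d) + Y z) \<bullet> (- ((1/2) *\<^sub>R d) + Y z) = Y z \<bullet> Y z - d \<bullet> Y z + n / 4"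
        by (simp add: inner_add_left inner_add_right inner_diff_left inner_diff_right inner_commute n_def)
      show ?thesis unfolding norm_le_square e YY dY using R by (simp add: algebra_simps)
    qed
    have 2: "norm (- ((1/2) *\<^sub>R d) + Y z + d) \<le> R \<longleftrightarrow> n * ((snd z)\<^sup>2 + 1/4) + (fst z)\<^sup>2 / (4 * n) + fst z / 2 \<le> R\<^sup>2"
    proof -
      have e1: "- ((1/2) *\<^sub>R d) + Y z + d = (1/2) *\<^sub>R d + Y z" by (simp add: prod_eq_iff)
      have e2: "((1/2) *\<^sub>R d + Y z) \<bullet> ((1/2) *\<^sub>R d + Y z) = Y z \<bullet> Y z + d \<bullet> Y z + n / 4"
        by (simp add: inner_add_left inner_add_right inner_commute n_def)
      show ?thesis unfolding e1 norm_le_square e2 YY dY using R by (simp add: algebra_simps)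
    qed
    have 3: "2 * (d \<bullet> (- ((1/2) *\<^sub>R d) + Y z)) + n = fst z"
      using dY[of z] by (simp add: inner_add_right inner_diff_right n_def)
    show ?thesis
      unfolding h_def indicator_def strip_def strip_coords_def mem_Collect_eq 1 2 3 n_def[symmetric]
      by (cases "fst z \<ge> 0") auto
  qed
  then have "emeasure lborel (strip_coords a b R d) = (\<integral>\<^sup>+z. h (Y z) \<partial>lborel)" by simp
  also have "\<dots> = ennreal \<bar>2\<bar> * (\<integral>\<^sup>+y. h y \<partial>lborel)"
    unfolding Y_def
  proof (rule nn_integral_linear_subst[OF h])
    have "2 * fst d * (fst d / n) - 2 * snd d * (- snd d / n) = 2 * ((fst d)\<^sup>2 + (snd d)\<^sup>2) / n"
      by (simp add: power2_eq_square add_divide_distrib)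
    then show "2 = 2 * fst d * (fst d / n) - 2 * snd d * (- snd d / n)" using n by (simp add: n'[symmetric])
  qed (use d in auto)
  also have "(\<integral>\<^sup>+y. h y \<partial>lborel) = emeasure lborel (strip a b R d)"
    unfolding h_def by (subst nn_integral_lborel_translate) simp_all
  finally show ?thesis by simp
qed

definition good :: "real \<Rightarrow> real \<Rightarrow> (int \<times> int) set" where
  "good R w = {d. w \<le> \<bar>real_of_int (fst d)\<bar> \<and> norm (lat d) \<le> 2 * R}"

lemma finite_good: "finite (good R w)"
  by (rule finite_subset[OF _ finite_lat_bounded0[OF bounded_cball[of 0 "2 * R"]]]) (auto simp: good_def)

lemma norm_lat_ge_1: assumes "d \<noteq> 0" shows "1 \<le> norm (lat d)"
proof (cases "fst d = 0")
  case True
  then have "snd d \<noteq> 0" using assms by (auto simp: prod_eq_iff)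
  then have "1 \<le> \<bar>real_of_int (snd d)\<bar>" by linarith
  then show ?thesis using norm_snd_le[of "real_of_int (snd d)" "real_of_int (fst d)"] by (simp add: lat_def)
next
  case False
  then have "1 \<le> \<bar>real_of_int (fst d)\<bar>" by linarith
  then show ?thesis using norm_fst_le[of "real_of_int (fst d)" "real_of_int (snd d)"] by (simp add: lat_def)
qed

lemma card_punctured_disc:
  assumes "r \<ge> 0"
  shows "real (card {d. d \<noteq> 0 \<and> norm (lat d) \<le> r}) \<le> 9 * pi * r\<^sup>2"
proof (cases "r < 1")
  case True
  have e: "{d. d \<noteq> 0 \<and> norm (lat d) \<le> r} = {}"
  proof -
    have "\<not> (d \<noteq> 0 \<and> norm (lat d) \<le> r)" for d using norm_lat_ge_1[of d] True by linarith
    then show ?thesis by blast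
  qed
  show ?thesis unfolding e using assms by simp
next
  case False
  have "real (card {d. d \<noteq> 0 \<and> norm (lat d) \<le> r}) \<le> real (card {d. norm (lat d) \<le> r})"
    using finite_lat_bounded0[OF bounded_cball[of 0 r]] by (intro of_nat_mono card_mono) auto
  also have "\<dots> \<le> pi * (r + 2)\<^sup>2" by (rule gauss_circle) fact
  also have "\<dots> \<le> pi * (3 * r)\<^sup>2" using False by (intro mult_left_mono power_mono) auto
  finally show ?thesis by (simp add: power_mult_distrib)
qed

lemma nn_integral_cauchy_density:
  "(\<integral>\<^sup>+t. ennreal (1 / (t\<^sup>2 + 1/4)) \<partial>lborel) = ennreal (2 * pi)"
proof -
  let ?f = "\<lambda>t::real. 1 / (t\<^sup>2 + 1/4)"
  have pos: "t\<^sup>2 + 1/4 > (0::real)" for t by (simp add: add_nonneg_pos)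
  have half: "(\<integral>\<^sup>+t. ennreal (?f t) * indicator {0..} t \<partial>lborel) = ennreal pi"
  proof -
    have "(\<integral>\<^sup>+t. ennreal (?f t) * indicator {0..} t \<partial>lborel) = ennreal (pi - 2 * arctan (2 * 0))"
    proof (rule nn_integral_FTC_atLeast)
      show "((\<lambda>t::real. 2 * arctan (2 * t)) has_real_derivative ?f t) (at t)" for t :: real
        using pos[of t]
        by (auto intro!: derivative_eq_intros simp: field_simps power2_eq_square)
      have "((\<lambda>t::real. 2 * arctan (2 * t)) \<longlongrightarrow> 2 * (pi / 2)) at_top"
        by (intro tendsto_intros filterlim_compose[OF tendsto_arctan_at_top]
            filterlim_tendsto_pos_mult_at_top[OF tendsto_const _ filterlim_ident]) auto
      then show "((\<lambda>t::real. 2 * arctan (2 * t)) \<longlongrightarrow> pi) at_top" by simp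
    qed (use pos in \<open>auto intro: less_imp_le\<close>)
    then show ?thesis by simp
  qed
  have "(\<integral>\<^sup>+t. ennreal (?f t) * indicator {..0} t \<partial>lborel) = (\<integral>\<^sup>+t. ennreal (?f t) * indicator {0..} t \<partial>lborel)"
    by (subst nn_integral_real_affine[where c = "-1" and t = 0])
       (auto simp: indicator_def intro!: nn_integral_cong)
  have "(\<integral>\<^sup>+t. ennreal (?f t) \<partial>lborel)
      = (\<integral>\<^sup>+t. ennreal (?f t) * indicator {0..} t + ennreal (?f t) * indicator {..0} t \<partial>lborel)"
  proof (rule nn_integral_cong_AE)
    have "AE t in lborel. t \<noteq> (0::real)" by (rule AE_lborel_singleton)
    then show "AE t in lborel. ennreal (?f t) = ennreal (?f t) * indicator {0..} t + ennreal (?f t) * indicator {..0} t"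
      by eventually_elim (auto simp: indicator_def)
  qed
  also have "\<dots> = ennreal pi + ennreal pi"
    using half \<open>_ = (\<integral>\<^sup>+t. ennreal (?f t) * indicator {0..} t \<partial>lborel)\<close> by (subst nn_integral_add) auto
  finally show ?thesis by (simp add: ennreal_plus[symmetric] del: ennreal_plus)
qed

text \<open>
For fixed coordinates \<open>z = (u, t)\<close> the number of \<open>d\<close> whose strip contains \<open>z\<close> is, up to lower order terms, the number of lattice
points in the disc of radius \<open>R / sqrt (t\<^sup>2 + 1/4)\<close>. Divided by \<open>R\<^sup>2\<close> it tends to \<open>pi / (t\<^sup>2 + 1/4)\<close>, and it stays below
9 times that value, an integrable function. Removing the \<open>d\<close> with small first coordinate costs \<open>O(w R)\<close> points.
\<close>
lemma mean_good:
  fixes R w :: "nat \<Rightarrow> real"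
  assumes ab: "a \<le> b" and w: "\<And>k. w k \<ge> 1" and R: "\<And>k. R k \<ge> 1"
    and lim: "(\<lambda>k. 1 / R k) \<longlonglongrightarrow> 0" "(\<lambda>k. w k / R k) \<longlonglongrightarrow> 0"
  shows "(\<lambda>k. (\<Sum>d\<in>good (R k) (w k). measure lborel (strip a b (R k) (lat d))) / (R k)\<^sup>2)
           \<longlonglongrightarrow> pi\<^sup>2 * (b - a)"
proof -
  define A where "A k z = {d \<in> good (R k) (w k). z \<in> strip_coords a b (R k) (lat d)}" for k z
  define f where "f k z = ennreal (real (card (A k z)) / (R k)\<^sup>2)" for k z
  define g where "g z = indicator ({a..b} \<times> UNIV) z * ennreal (pi / ((snd z)\<^sup>2 + 1/4))" for z :: "real \<times> real"
  have finA: "finite (A k z)" for k z by (rule finite_subset[OF _ finite_good]) (auto simp: A_def)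
  have R0: "R k > 0" for k using R[of k] by linarith
  have pos: "t\<^sup>2 + 1/4 \<ge> (1/4::real)" for t by simp
  have good_nz: "fst d \<noteq> 0" "d \<noteq> 0" if "d \<in> good (R k) (w k)" for d k
    using that w[of k] by (auto simp: good_def)
  have nn: "lat d \<bullet> lat d = (norm (lat d))\<^sup>2" for d by (simp add: power2_norm_eq_inner)
  have card_sum: "ennreal (real (card (A k z))) = (\<Sum>d\<in>good (R k) (w k). indicator (strip_coords a b (R k) (lat d)) z)" for k z
  proof -
    have "(\<Sum>d\<in>good (R k) (w k). indicator (strip_coords a b (R k) (lat d)) z :: ennreal) = (\<Sum>d\<in>good (R k) (w k). if d \<in> A k z then 1 else 0)"
      by (intro sum.cong) (auto simp: A_def indicator_def)
    also have "\<dots> = (\<Sum>d\<in>A k z. 1)"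
      by (subst sum.inter_filter[symmetric, OF finite_good]) (simp add: A_def Int_def conj_commute)
    finally show ?thesis by (simp add: ennreal_of_nat_eq_real_of_nat)
  qed
  have f_meas[measurable]: "f k \<in> borel_measurable borel" for k
  proof -
    have "f k = (\<lambda>z. (\<Sum>d\<in>good (R k) (w k). indicator (strip_coords a b (R k) (lat d)) z) * ennreal (1 / (R k)\<^sup>2))"
      using R0 by (simp add: f_def fun_eq_iff card_sum[symmetric] ennreal_mult[symmetric])
    then show ?thesis by simp
  qed
  have g_meas[measurable]: "g \<in> borel_measurable borel"
  proof -
    have "closed ({a..b} \<times> (UNIV :: real set))" by (intro closed_Times) auto
    then have [measurable]: "{a..b} \<times> (UNIV :: real set) \<in> sets borel" by (rule borel_closed)
    have [measurable]: "snd \<in> borel_measurable (borel :: (real \<times> real) measure)"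
      by (intro borel_measurable_continuous_onI continuous_intros)
    show ?thesis unfolding g_def by measurable
  qed
  have int_f: "(\<integral>\<^sup>+z. f k z \<partial>lborel)
      = ennreal (2 * (\<Sum>d\<in>good (R k) (w k). measure lborel (strip a b (R k) (lat d))) / (R k)\<^sup>2)" for k
  proof -
    have "(\<integral>\<^sup>+z. f k z \<partial>lborel) = (\<integral>\<^sup>+z. (\<Sum>d\<in>good (R k) (w k). indicator (strip_coords a b (R k) (lat d)) z) * ennreal (1 / (R k)\<^sup>2) \<partial>lborel)"
      using R0 by (simp add: f_def card_sum[symmetric] ennreal_mult[symmetric])
    also have "\<dots> = (\<Sum>d\<in>good (R k) (w k). emeasure lborel (strip_coords a b (R k) (lat d))) * ennreal (1 / (R k)\<^sup>2)"
      by (simp add: nn_integral_multc nn_integral_sum)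
    also have "(\<Sum>d\<in>good (R k) (w k). emeasure lborel (strip_coords a b (R k) (lat d)))
        = (\<Sum>d\<in>good (R k) (w k). ennreal (2 * measure lborel (strip a b (R k) (lat d))))"
    proof (intro sum.cong refl)
      fix d assume "d \<in> good (R k) (w k)"
      then have "2 * emeasure lborel (strip a b (R k) (lat d)) = emeasure lborel (strip_coords a b (R k) (lat d))"
        using good_nz R0[of k] by (intro emeasure_strip_eq) auto
      then show "emeasure lborel (strip_coords a b (R k) (lat d)) = ennreal (2 * measure lborel (strip a b (R k) (lat d)))"
        by (simp add: emeasure_strip ennreal_mult)
    qed
    also have "\<dots> = ennreal (2 * (\<Sum>d\<in>good (R k) (w k). measure lborel (strip a b (R k) (lat d))))"
      by (subst sum_ennreal) (auto simp: sum_distrib_left)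
    finally show ?thesis using R0 by (simp add: ennreal_mult[symmetric] sum_nonneg)
  qed
  have A_norm: "norm (lat d) \<le> R k / sqrt ((snd z)\<^sup>2 + 1/4)" if "d \<in> A k z" for d k z
  proof -
    have "(lat d \<bullet> lat d) * ((snd z)\<^sup>2 + 1/4) \<le> (R k)\<^sup>2"
    proof -
      have "0 \<le> (fst z)\<^sup>2 / (4 * (lat d \<bullet> lat d)) + \<bar>fst z\<bar> / 2" by (intro add_nonneg_nonneg) auto
      moreover have "(lat d \<bullet> lat d) * ((snd z)\<^sup>2 + 1/4) + (fst z)\<^sup>2 / (4 * (lat d \<bullet> lat d)) + \<bar>fst z\<bar> / 2 \<le> (R k)\<^sup>2"
        using that unfolding A_def strip_coords_def by blast
      ultimately show ?thesis by linarith
    qed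
    then have "(norm (lat d) * sqrt ((snd z)\<^sup>2 + 1/4))\<^sup>2 \<le> (R k)\<^sup>2" using pos[of "snd z"] by (simp add: power_mult_distrib nn)
    then have "norm (lat d) * sqrt ((snd z)\<^sup>2 + 1/4) \<le> R k" by (rule power2_le_imp_le) (use R0[of k] in simp)
    then show ?thesis using pos[of "snd z"] by (subst pos_le_divide_eq) (auto intro!: add_nonneg_pos)
  qed
  have A_empty: "A k z = {}" if "z \<notin> {a..b} \<times> UNIV" for k z
    using that by (auto simp: A_def strip_coords_def mem_Times_iff)
  have rt2: "sqrt (t\<^sup>2 + 1/4) \<ge> 1/2" for t :: real
    by (rule real_le_rsqrt) (simp add: power2_eq_square)
  have bound: "f k z \<le> 9 * g z" for k z
  proof (cases "z \<in> {a..b} \<times> UNIV")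
    case True
    let ?r = "R k / sqrt ((snd z)\<^sup>2 + 1/4)"
    have r: "?r \<ge> 0" using R0[of k] by simp
    have "real (card (A k z)) \<le> real (card {d. d \<noteq> 0 \<and> norm (lat d) \<le> ?r})"
    proof (intro of_nat_mono card_mono)
      show "finite {d. d \<noteq> 0 \<and> norm (lat d) \<le> ?r}"
        by (rule finite_subset[OF _ finite_lat_bounded0[OF bounded_cball[of 0 ?r]]]) auto
      show "A k z \<subseteq> {d. d \<noteq> 0 \<and> norm (lat d) \<le> ?r}"
        using A_norm[of _ k z] good_nz unfolding A_def by blast
    qed
    also have "\<dots> \<le> 9 * pi * ?r\<^sup>2" by (rule card_punctured_disc[OF r])
    also have "\<dots> = 9 * (pi / ((snd z)\<^sup>2 + 1/4)) * (R k)\<^sup>2" using pos[of "snd z"] by (simp add: power_divide)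
    finally have card_le: "real (card (A k z)) / (R k)\<^sup>2 \<le> 9 * (pi / ((snd z)\<^sup>2 + 1/4))" using R0[of k] by (simp add: pos_divide_le_eq)
    have "f k z \<le> ennreal (9 * (pi / ((snd z)\<^sup>2 + 1/4)))" unfolding f_def using card_le by (rule ennreal_leI)
    also have "\<dots> = ennreal 9 * ennreal (pi / ((snd z)\<^sup>2 + 1/4))" by (rule ennreal_mult') simp
    also have "\<dots> = 9 * g z" using True by (simp add: g_def)
    finally show ?thesis .
  next
    case False then show ?thesis by (simp add: f_def A_empty)
  qed
  have pointwise: "(\<lambda>k. f k z) \<longlonglongrightarrow> g z" for z
  proof (cases "z \<in> {a..b} \<times> UNIV")
    case True
    define T where "T = (snd z)\<^sup>2 + 1/4"
    have T: "T \<ge> 1/4" using pos by (simp add: T_def)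
    have sT: "sqrt T \<ge> 1/2" using rt2 by (simp add: T_def)
    define c where "c = (fst z)\<^sup>2 / 4 + \<bar>fst z\<bar> / 2"
    have c0: "c \<ge> 0" by (simp add: c_def)
    have upper: "real (card (A k z)) / (R k)\<^sup>2 \<le> pi / T + 8 * pi * (1 / R k) + 4 * pi * (1 / R k)\<^sup>2" for k
    proof -
      let ?r = "R k / sqrt T"
      have r: "?r \<ge> 0" using R0[of k] T by simp
      have "real (card (A k z)) \<le> real (card {d. norm (lat d) \<le> ?r})"
      proof (intro of_nat_mono card_mono)
        show "finite {d. norm (lat d) \<le> ?r}" using finite_lat_bounded0[OF bounded_cball[of 0 ?r]] by simp
        show "A k z \<subseteq> {d. norm (lat d) \<le> ?r}" using A_norm[of _ k z] unfolding T_def by blast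
      qed
      also have "\<dots> \<le> pi * (?r + 2)\<^sup>2" by (rule gauss_circle[OF r])
      also have "(?r + 2)\<^sup>2 = (R k)\<^sup>2 / T + 4 * ?r + 4" using T by (simp add: power2_sum power_divide)
      also have "pi * \<dots> \<le> pi * ((R k)\<^sup>2 / T + 8 * R k + 4)"
      proof -
        have "R k * (1/2) \<le> R k * sqrt T" using R0[of k] sT by (intro mult_left_mono) auto
        moreover have "0 < sqrt T" using sT by linarith
        ultimately have "?r \<le> 2 * R k" by (simp only: pos_divide_le_eq)
        then show ?thesis by (intro mult_left_mono) auto
      qed
      finally have "real (card (A k z)) / (R k)\<^sup>2 \<le> pi * ((R k)\<^sup>2 / T + 8 * R k + 4) / (R k)\<^sup>2"
        by (intro divide_right_mono) auto
      also have "\<dots> = pi / T + 8 * pi * (1 / R k) + 4 * pi * (1 / R k)\<^sup>2"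
        using R0[of k] T by (simp add: field_simps power2_eq_square)
      finally show ?thesis .
    qed
    (* On the disc of radius sqrt X the condition defining strip_coords holds, since u^2 / (4 |d|^2) <= u^2 / 4;
       the expansion of (sqrt X - 2)^2 together with sqrt X <= 2 R gives the term 8 R. *)
    have lower: "pi / T - pi * c / T * (1 / R k)\<^sup>2 - 8 * pi * (1 / R k) - (2 * (w k / R k) + 1 / R k) * (4 + 1 / R k)
        \<le> real (card (A k z)) / (R k)\<^sup>2" for k
    proof -
      define X where "X = ((R k)\<^sup>2 - c) / T"
      define B where "B = {d. norm (lat d) \<le> sqrt X}"
      define E where "E = {d. \<bar>real_of_int (fst d)\<bar> \<le> w k \<and> \<bar>real_of_int (snd d)\<bar> \<le> 2 * R k}"
      have finB: "finite B" using finite_lat_bounded0[OF bounded_cball[of 0 "sqrt X"]] by (simp add: B_def)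
      have Ebox: "E = {-\<lfloor>w k\<rfloor>..\<lfloor>w k\<rfloor>} \<times> {-\<lfloor>2 * R k\<rfloor>..\<lfloor>2 * R k\<rfloor>}"
      proof -
        have *: "\<bar>real_of_int i\<bar> \<le> y \<longleftrightarrow> - \<lfloor>y\<rfloor> \<le> i \<and> i \<le> \<lfloor>y\<rfloor>" for i y by linarith
        show ?thesis unfolding E_def * by auto
      qed
      have finE: "finite E" unfolding Ebox by simp
      have cardE: "real (card E) \<le> (2 * w k + 1) * (4 * R k + 1)"
      proof -
        have "real (card E) = real (nat (2 * \<lfloor>w k\<rfloor> + 1)) * real (nat (2 * \<lfloor>2 * R k\<rfloor> + 1))"
          unfolding Ebox by (simp add: card_cartesian_product)
        also have "\<dots> \<le> (2 * w k + 1) * (4 * R k + 1)"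
          using w[of k] R0[of k] by (intro mult_mono) (linarith+)
        finally show ?thesis .
      qed
      have Xle: "X \<le> (2 * R k)\<^sup>2"
      proof -
        have "(R k)\<^sup>2 - c \<le> (2 * R k)\<^sup>2 * (1/4)" using c0 by simp
        also have "\<dots> \<le> (2 * R k)\<^sup>2 * T" using T by (intro mult_left_mono) auto
        finally show ?thesis unfolding X_def using T by (subst pos_divide_le_eq) auto
      qed
      have sub: "B - E \<subseteq> A k z" if X: "X \<ge> 0"
      proof
        fix d assume d: "d \<in> B - E"
        have dn: "(norm (lat d))\<^sup>2 \<le> X"
          using power_mono[of "norm (lat d)" "sqrt X" 2] d X by (simp add: B_def)
        have "norm (lat d) \<le> 2 * R k"
          by (rule power2_le_imp_le[OF order_trans[OF dn Xle]]) (use R0[of k] in simp)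
        moreover from this have "\<bar>real_of_int (snd d)\<bar> \<le> 2 * R k"
          using norm_snd_le[of "real_of_int (snd d)" "real_of_int (fst d)"] by (simp add: lat_def)
        ultimately have "d \<in> good (R k) (w k)" using d by (auto simp: good_def E_def)
        moreover have "z \<in> strip_coords a b (R k) (lat d)"
        proof -
          have "1 \<le> norm (lat d)" using good_nz[OF \<open>d \<in> good _ _\<close>] by (intro norm_lat_ge_1)
          then have "1 \<le> (norm (lat d))\<^sup>2" by simp
          then have "(fst z)\<^sup>2 / (4 * (norm (lat d))\<^sup>2) \<le> (fst z)\<^sup>2 / 4" by (intro divide_left_mono) auto
          moreover have "(norm (lat d))\<^sup>2 * T \<le> (R k)\<^sup>2 - c" using dn T by (simp add: X_def pos_le_divide_eq)
          ultimately show ?thesis using True by (auto simp: strip_coords_def nn T_def[symmetric] c_def)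
        qed
        ultimately show "d \<in> A k z" by (simp add: A_def)
      qed
      have "pi * (X - 8 * R k) - (2 * w k + 1) * (4 * R k + 1) \<le> real (card (A k z))"
      proof (cases "X \<ge> 4")
        case False
        have "pi * (X - 8 * R k) \<le> 0" using False R[of k] by (intro mult_nonneg_nonpos) auto
        moreover have "(2 * w k + 1) * (4 * R k + 1) \<ge> 0" using w[of k] R[of k] by auto
        ultimately show ?thesis by linarith
      next
        case True
        then have s: "sqrt X \<ge> 2" by (intro real_le_rsqrt) auto
        have s2: "sqrt X \<le> 2 * R k" using Xle R0[of k] by (intro real_le_lsqrt) auto
        have "pi * (X - 8 * R k) \<le> pi * (sqrt X - 2)\<^sup>2"
        proof -
          have "(sqrt X - 2)\<^sup>2 = X - 4 * sqrt X + 4" using True by (simp add: power2_diff)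
          then show ?thesis using s2 by (intro mult_left_mono) auto
        qed
        also have "\<dots> \<le> real (card B)" unfolding B_def by (rule gauss_circle(2)) (use s in linarith)+
        also have "real (card B) \<le> real (card (B - E)) + real (card E)"
        proof -
          have "card B \<le> card ((B - E) \<union> E)" using finB finE by (intro card_mono) auto
          also have "\<dots> \<le> card (B - E) + card E" by (rule card_Un_le)
          finally show ?thesis by linarith
        qed
        also have "real (card (B - E)) \<le> real (card (A k z))"
          using sub True finA by (intro of_nat_mono card_mono) auto
        finally show ?thesis using cardE by linarith
      qed
      then have "(pi * (X - 8 * R k) - (2 * w k + 1) * (4 * R k + 1)) / (R k)\<^sup>2 \<le> real (card (A k z)) / (R k)\<^sup>2"
        by (intro divide_right_mono) auto
      moreover have "(pi * (X - 8 * R k) - (2 * w k + 1) * (4 * R k + 1)) / (R k)\<^sup>2 =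
          pi / T - pi * c / T * (1 / R k)\<^sup>2 - 8 * pi * (1 / R k) - (2 * (w k / R k) + 1 / R k) * (4 + 1 / R k)"
        using R0[of k] T unfolding X_def by (simp add: field_simps power2_eq_square)
      ultimately show ?thesis by simp
    qed
    have "(\<lambda>k. real (card (A k z)) / (R k)\<^sup>2) \<longlonglongrightarrow> pi / T"
    proof (rule tendsto_sandwich[OF always_eventually[OF allI[OF lower]] always_eventually[OF allI[OF upper]]])
      show "(\<lambda>k. pi / T - pi * c / T * (1 / R k)\<^sup>2 - 8 * pi * (1 / R k) - (2 * (w k / R k) + 1 / R k) * (4 + 1 / R k)) \<longlonglongrightarrow> pi / T"
        by (rule tendsto_eq_intros lim refl | simp)+
      show "(\<lambda>k. pi / T + 8 * pi * (1 / R k) + 4 * pi * (1 / R k)\<^sup>2) \<longlonglongrightarrow> pi / T"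
        by (rule tendsto_eq_intros lim refl | simp)+
    qed
    then show ?thesis using True T by (simp add: f_def g_def T_def tendsto_ennrealI)
  next
    case False then show ?thesis by (simp add: f_def A_empty g_def)
  qed
  have int_g: "(\<integral>\<^sup>+z. g z \<partial>lborel) = ennreal (2 * (pi\<^sup>2 * (b - a)))"
  proof -
    have "g (u, t) = indicator {a..b} u * (ennreal pi * ennreal (1 / (t\<^sup>2 + 1/4)))" for u t
      using pos[of t] by (simp add: g_def indicator_times ennreal_mult'[symmetric])
    then have "(\<integral>\<^sup>+z. g z \<partial>lborel)
        = (\<integral>\<^sup>+u. indicator {a..b} u * (\<integral>\<^sup>+t. ennreal pi * ennreal (1 / (t\<^sup>2 + 1/4)) \<partial>lborel) \<partial>lborel)"
      by (simp add: nn_integral_plane(1)[OF g_meas] nn_integral_cmult)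
    also have "(\<integral>\<^sup>+t. ennreal pi * ennreal (1 / (t\<^sup>2 + 1/4)) \<partial>lborel) = ennreal pi * ennreal (2 * pi)"
      by (subst nn_integral_cmult) (simp_all add: nn_integral_cauchy_density)
    also have "(\<integral>\<^sup>+u. indicator {a..b} u * (ennreal pi * ennreal (2 * pi)) \<partial>lborel) = ennreal (2 * (pi\<^sup>2 * (b - a)))"
      using ab by (simp add: nn_integral_multc ennreal_mult[symmetric] power2_eq_square mult_ac)
    finally show ?thesis .
  qed
  have "(\<lambda>k. \<integral>\<^sup>+z. f k z \<partial>lborel) \<longlonglongrightarrow> (\<integral>\<^sup>+z. g z \<partial>lborel)"
  proof (rule nn_integral_dominated_convergence)
    show "(\<integral>\<^sup>+z. 9 * g z \<partial>lborel) < \<infinity>" by (simp add: nn_integral_cmult int_g ennreal_mult_less_top)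
  qed (use bound pointwise in auto)
  then have "(\<lambda>k. 2 * (\<Sum>d\<in>good (R k) (w k). measure lborel (strip a b (R k) (lat d))) / (R k)\<^sup>2)
       \<longlonglongrightarrow> 2 * (pi\<^sup>2 * (b - a))"
    unfolding int_f int_g by (subst (asm) tendsto_ennreal_iff) (use ab in \<open>auto intro!: sum_nonneg always_eventually divide_nonneg_nonneg mult_nonneg_nonneg\<close>)
  from tendsto_mult_left[OF this, of "1/2"] show ?thesis by simp
qed

section \<open>Arithmetic sums over difference vectors\<close>

definition wedge :: "int \<times> int \<Rightarrow> int \<times> int \<Rightarrow> int" where
  "wedge d e = fst d * snd e - snd d * fst e"

lemma card_congruent_le:
  fixes X :: "int set" and m :: int and B :: real
  assumes m: "m > 0" and B: "B \<ge> 0" and X: "\<And>x. x \<in> X \<Longrightarrow> \<bar>real_of_int x\<bar> \<le> B"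
    and cong: "\<And>x y. x \<in> X \<Longrightarrow> y \<in> X \<Longrightarrow> m dvd x - y"
  shows "real (card X) \<le> 2 * B / real_of_int m + 1"
proof (cases "X = {}")
  case False
  have "X \<subseteq> {-\<lfloor>B\<rfloor>..\<lfloor>B\<rfloor>}"
  proof
    fix x assume "x \<in> X"
    then have "\<bar>real_of_int x\<bar> \<le> B" by (rule X)
    then show "x \<in> {-\<lfloor>B\<rfloor>..\<lfloor>B\<rfloor>}" unfolding atLeastAtMost_iff by linarith
  qed
  then have fin: "finite X" by (rule finite_subset) simp
  define x0 where "x0 = Min X"
  have x0: "x0 \<in> X" "\<And>x. x \<in> X \<Longrightarrow> x0 \<le> x" using Min_in[OF fin False] Min_le[OF fin] unfolding x0_def by blast+
  define f where "f x = (x - x0) div m" for x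
  have f: "f x * m = x - x0" if "x \<in> X" for x
    using cong[OF that x0(1)] by (simp add: f_def)
  have "inj_on f X"
  proof (rule inj_onI)
    fix x y assume "x \<in> X" "y \<in> X" "f x = f y"
    then have "x - x0 = y - x0" using f[of x] f[of y] by metis
    then show "x = y" by simp
  qed
  moreover have "f ` X \<subseteq> {0..\<lfloor>2 * B / m\<rfloor>}"
  proof safe
    fix x assume x: "x \<in> X"
    have "0 \<le> f x" using x0(2)[OF x] m by (simp add: f_def pos_imp_zdiv_nonneg_iff)
    moreover have "real_of_int (f x) * m \<le> 2 * B"
    proof -
      have "real_of_int (f x) * m = real_of_int x - real_of_int x0" using f[OF x] by (metis of_int_diff of_int_mult)
      then show ?thesis using X[OF x] X[OF x0(1)] by linarith
    qed
    then have "real_of_int (f x) \<le> 2 * B / m" using m by (simp add: pos_le_divide_eq)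
    ultimately show "f x \<in> {0..\<lfloor>2 * B / m\<rfloor>}" by (simp add: le_floor_iff)
  qed
  ultimately have "card X \<le> card {0..\<lfloor>2 * B / m\<rfloor>}" by (intro card_inj_on_le[of f]) auto
  also have "\<dots> = nat (\<lfloor>2 * B / m\<rfloor> + 1)" by simp
  finally have "real (card X) \<le> real (nat (\<lfloor>2 * B / m\<rfloor> + 1))" by simp
  also have "\<dots> \<le> 2 * B / m + 1"
  proof -
    have "2 * B / m \<ge> 0" using m B by simp
    then show ?thesis by linarith
  qed
  finally show ?thesis .
qed (use m B in simp)

lemma good_bounds:
  assumes "d \<in> good R w"
  shows "w \<le> \<bar>real_of_int (fst d)\<bar>" "\<bar>real_of_int (fst d)\<bar> \<le> 2 * R" "\<bar>real_of_int (snd d)\<bar> \<le> 2 * R"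
  using assms norm_fst_le[of "real_of_int (fst d)" "real_of_int (snd d)"]
    norm_snd_le[of "real_of_int (snd d)" "real_of_int (fst d)"]
  by (auto simp: good_def lat_def)

text \<open>
If \<open>e\<close> and \<open>e'\<close> have the same determinant against \<open>d\<close>, then \<open>e - e'\<close> is an integral multiple of \<open>d / gcd\<close>. So the first
coordinate determines \<open>e\<close> and lies in a fixed residue class modulo \<open>\<bar>fst d\<bar> / gcd \<ge> w / gcd\<close>.
\<close>
lemma card_good_wedge_le:
  assumes w: "w \<ge> 1" and d: "d \<in> good R w"
  shows "real (card {e \<in> good R w. wedge d e = k}) \<le> 6 * R * real_of_int (gcd (fst d) (snd d)) / w"
proof -
  define g where "g = gcd (fst d) (snd d)"
  have d1: "fst d \<noteq> 0" using good_bounds(1)[OF d] w by auto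
  then have g: "g > 0" by (simp add: g_def)
  define m where "m = \<bar>fst d\<bar> div g"
  have mg: "m * g = \<bar>fst d\<bar>" by (simp add: m_def g_def)
  have m: "m > 0" using mg d1 g by (metis abs_ge_zero abs_eq_0 mult_eq_0_iff order_le_less zero_less_mult_pos2)
  have wR: "w \<le> 2 * R" using good_bounds[OF d] by linarith
  define X where "X = {e \<in> good R w. wedge d e = k}"
  have inj: "inj_on fst X"
  proof (rule inj_onI)
    fix x y assume "x \<in> X" "y \<in> X" and eq: "fst x = fst y"
    then have "fst d * snd x - snd d * fst x = fst d * snd y - snd d * fst y" by (simp add: X_def wedge_def)
    then have "fst d * snd x = fst d * snd y" unfolding eq by linarith
    then show "x = y" using d1 eq by (simp add: prod_eq_iff)
  qed
  have "real (card (fst ` X)) \<le> 2 * (2 * R) / real_of_int m + 1"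
  proof (rule card_congruent_le[OF m])
    show "0 \<le> 2 * R" using wR w by simp
    show "\<bar>real_of_int x\<bar> \<le> 2 * R" if "x \<in> fst ` X" for x
      using that good_bounds(2) by (auto simp: X_def)
    show "m dvd x - y" if xy: "x \<in> fst ` X" "y \<in> fst ` X" for x y
    proof -
      obtain s t where st: "s \<in> X" "t \<in> X" "x = fst s" "y = fst t" using xy by blast
      have "fst d * (snd s - snd t) = snd d * (x - y)"
        using st by (simp add: X_def wedge_def algebra_simps)
      moreover obtain p q where pq: "fst d = g * p" "snd d = g * q" "coprime p q"
        using gcd_coprime_exists[of "fst d" "snd d"] g unfolding g_def by (metis gcd_eq_0_iff mult.commute less_irrefl)
      ultimately have "g * (p * (snd s - snd t)) = g * (q * (x - y))" by (simp add: mult.assoc)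
      then have "p * (snd s - snd t) = q * (x - y)" using g by simp
      then have "p dvd q * (x - y)" by (metis dvd_triv_left)
      then have "p dvd x - y" using pq(3) by (simp add: coprime_dvd_mult_right_iff)
      moreover have "m = \<bar>p\<bar>" using g by (simp add: m_def pq(1) abs_mult)
      ultimately show ?thesis by simp
    qed
  qed
  also have "2 * (2 * R) / real_of_int m = 4 * R * g / \<bar>real_of_int (fst d)\<bar>"
  proof -
    have "real_of_int m * g = \<bar>real_of_int (fst d)\<bar>" using mg by (metis of_int_abs of_int_mult)
    then have *: "\<bar>real_of_int (fst d)\<bar> = real_of_int m * g" ..
    show ?thesis unfolding * using m g by simp
  qed
  also have "\<dots> \<le> 4 * R * g / w"
    using good_bounds(1)[OF d] w wR g by (intro divide_left_mono) auto
  also have "1 \<le> 2 * R * g / w"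
  proof -
    have "w * 1 \<le> 2 * R * g" using wR g w by (intro mult_mono) auto
    then show ?thesis using w by (simp add: pos_le_divide_eq)
  qed
  finally show ?thesis using card_image[OF inj] by (simp add: X_def g_def)
qed

lemma sum_inverse_nonzero:
  "(\<Sum>k\<in>{-int N..int N} - {0}. 1 / \<bar>real_of_int k\<bar>) = 2 * harm N"
proof -
  have pos: "(\<Sum>k\<in>{1..int N}. 1 / \<bar>real_of_int k\<bar>) = harm N"
  proof -
    have "{1..int N} = int ` {1..N}" by (simp add: image_int_atLeastAtMost)
    then show ?thesis by (simp add: sum.reindex harm_def inverse_eq_divide)
  qed
  have "{-int N..int N} - {0} = {1..int N} \<union> uminus ` {1..int N}" by (auto simp: image_def intro: bexI[of _ "- _"])
  then have "(\<Sum>k\<in>{-int N..int N} - {0}. 1 / \<bar>real_of_int k\<bar>)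
      = (\<Sum>k\<in>{1..int N}. 1 / \<bar>real_of_int k\<bar>) + (\<Sum>k\<in>uminus ` {1..int N}. 1 / \<bar>real_of_int k\<bar>)"
    by (simp only:) (rule sum.union_disjoint, auto)
  also have "(\<Sum>k\<in>uminus ` {1..int N}. 1 / \<bar>real_of_int k\<bar>) = (\<Sum>k\<in>{1..int N}. 1 / \<bar>real_of_int k\<bar>)"
    by (subst sum.reindex) (auto simp: inj_on_def)
  finally show ?thesis unfolding pos by simp
qed

lemma sum_inverse_wedge_le:
  assumes w: "w \<ge> 1" and d: "d \<in> good R w" and N: "8 * R\<^sup>2 \<le> real N"
  shows "(\<Sum>e\<in>{e \<in> good R w. wedge d e \<noteq> 0}. 1 / \<bar>real_of_int (wedge d e)\<bar>)
      \<le> 12 * R * real_of_int (gcd (fst d) (snd d)) / w * harm N"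
proof -
  let ?S = "{e \<in> good R w. wedge d e \<noteq> 0}" and ?T = "{-int N..int N} - {0}"
  let ?c = "6 * R * real_of_int (gcd (fst d) (snd d)) / w"
  have fin: "finite ?S" by (rule finite_subset[OF _ finite_good]) auto
  have img: "wedge d ` ?S \<subseteq> ?T"
  proof safe
    fix e assume e: "e \<in> good R w"
    have "\<bar>real_of_int (wedge d e)\<bar> \<le> \<bar>real_of_int (fst d)\<bar> * \<bar>real_of_int (snd e)\<bar> + \<bar>real_of_int (snd d)\<bar> * \<bar>real_of_int (fst e)\<bar>"
      unfolding wedge_def of_int_diff of_int_mult by (metis abs_mult abs_triangle_ineq4)
    also have "\<dots> \<le> (2 * R) * (2 * R) + (2 * R) * (2 * R)"
      using good_bounds[OF d] good_bounds[OF e] w by (intro add_mono mult_mono) auto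
    also have "\<dots> \<le> real N" using N by (simp add: power2_eq_square)
    finally have "\<bar>wedge d e\<bar> \<le> int N" by linarith
    then show "wedge d e \<in> {-int N..int N}" by auto
  qed
  have "(\<Sum>e\<in>?S. 1 / \<bar>real_of_int (wedge d e)\<bar>)
      = (\<Sum>k\<in>?T. \<Sum>e\<in>{e \<in> ?S. wedge d e = k}. 1 / \<bar>real_of_int (wedge d e)\<bar>)"
    by (rule sum.group[symmetric, OF fin _ img]) simp
  also have "\<dots> \<le> (\<Sum>k\<in>?T. ?c * (1 / \<bar>real_of_int k\<bar>))"
  proof (rule sum_mono)
    fix k assume k: "k \<in> ?T"
    have eq: "{e \<in> ?S. wedge d e = k} = {e \<in> good R w. wedge d e = k}" using k by auto
    have "(\<Sum>e\<in>{e \<in> ?S. wedge d e = k}. 1 / \<bar>real_of_int (wedge d e)\<bar>)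
        = real (card {e \<in> good R w. wedge d e = k}) * (1 / \<bar>real_of_int k\<bar>)"
      unfolding eq by simp
    also have "\<dots> \<le> ?c * (1 / \<bar>real_of_int k\<bar>)"
      by (intro mult_right_mono card_good_wedge_le w d) auto
    finally show "(\<Sum>e\<in>{e \<in> ?S. wedge d e = k}. 1 / \<bar>real_of_int (wedge d e)\<bar>) \<le> ?c * (1 / \<bar>real_of_int k\<bar>)" .
  qed
  also have "\<dots> = ?c * (2 * harm N)" by (simp only: sum_distrib_left[symmetric] sum_inverse_nonzero)
  finally show ?thesis by simp
qed

text \<open>
The gcd of \<open>d\<close> is at most the sum of all its common divisors \<open>h\<close>, and there are at most \<open>(6 * R / h)\<^sup>2\<close> vectors with both
coordinates divisible by \<open>h\<close>.
\<close>
lemma sum_gcd_good_le: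
  assumes w: "w \<ge> 1" and R: "R \<ge> 1" and N: "real N = 2 * R"
  shows "(\<Sum>d\<in>good R w. real_of_int (gcd (fst d) (snd d))) \<le> 36 * R\<^sup>2 * harm N"
proof -
  define M where "M h = {x::int. \<bar>real_of_int x\<bar> \<le> 2 * R \<and> int h dvd x}" for h
  have finM: "finite (M h)" for h
  proof (rule finite_subset)
    show "M h \<subseteq> {-\<lfloor>2 * R\<rfloor>..\<lfloor>2 * R\<rfloor>}"
    proof
      fix x assume "x \<in> M h"
      then have "\<bar>real_of_int x\<bar> \<le> 2 * R" by (simp add: M_def)
      then show "x \<in> {-\<lfloor>2 * R\<rfloor>..\<lfloor>2 * R\<rfloor>}" unfolding atLeastAtMost_iff by linarith
    qed
  qed simp
  have cardM: "real (card (M h)) \<le> 6 * R / h" if h: "h \<in> {1..N}" for h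
  proof -
    have "real (card (M h)) \<le> 2 * (2 * R) / real_of_int (int h) + 1"
      by (rule card_congruent_le) (use h R in \<open>auto simp: M_def intro: dvd_diff\<close>)
    moreover have "1 \<le> 2 * R / h"
    proof -
      have "real h \<le> 2 * R" using h N by (simp add: N[symmetric])
      then show ?thesis using h by (simp add: pos_le_divide_eq)
    qed
    ultimately show ?thesis using h by (simp add: field_simps)
  qed
  have "(\<Sum>d\<in>good R w. real_of_int (gcd (fst d) (snd d)))
     \<le> (\<Sum>d\<in>good R w. \<Sum>h\<in>{1..N}. real h * of_bool (int h dvd fst d \<and> int h dvd snd d))"
  proof (rule sum_mono)
    fix d assume d: "d \<in> good R w"
    define g where "g = nat (gcd (fst d) (snd d))"
    have d1: "fst d \<noteq> 0" using good_bounds(1)[OF d] w by auto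
    have ig: "int g = gcd (fst d) (snd d)" by (simp add: g_def)
    have "gcd (fst d) (snd d) > 0" using d1 by simp
    then have "g \<ge> 1" unfolding g_def by linarith
    moreover have "real g \<le> 2 * R"
    proof -
      have "int g \<le> \<bar>fst d\<bar>" unfolding ig using dvd_imp_le_int[OF d1 gcd_dvd1] by simp
      then show ?thesis using good_bounds(2)[OF d] by linarith
    qed
    ultimately have g: "g \<in> {1..N}" by (simp add: N[symmetric])
    have "real g = real g * of_bool (int g dvd fst d \<and> int g dvd snd d)" by (simp add: ig)
    also have "\<dots> \<le> (\<Sum>h\<in>{1..N}. real h * of_bool (int h dvd fst d \<and> int h dvd snd d))"
      by (rule member_le_sum[OF g]) auto
    finally show "real_of_int (gcd (fst d) (snd d)) \<le> (\<Sum>h\<in>{1..N}. real h * of_bool (int h dvd fst d \<and> int h dvd snd d))"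
      using ig by (metis of_int_of_nat_eq)
  qed
  also have "\<dots> = (\<Sum>h\<in>{1..N}. real h * (\<Sum>d\<in>good R w. of_bool (int h dvd fst d \<and> int h dvd snd d)))"
    by (subst sum.swap) (simp add: sum_distrib_left)
  also have "\<dots> \<le> (\<Sum>h\<in>{1..N}. 36 * R\<^sup>2 * inverse (real h))"
  proof (rule sum_mono)
    fix h assume h: "h \<in> {1..N}"
    have "(\<Sum>d\<in>good R w. of_bool (int h dvd fst d \<and> int h dvd snd d)) = real (card {d \<in> good R w. int h dvd fst d \<and> int h dvd snd d})"
      by (simp add: of_bool_def sum.If_cases[OF finite_good] Int_def)
    also have "\<dots> \<le> real (card (M h \<times> M h))"
    proof (intro of_nat_mono card_mono)
      show "finite (M h \<times> M h)" using finM by simp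
      show "{d \<in> good R w. int h dvd fst d \<and> int h dvd snd d} \<subseteq> M h \<times> M h"
        using good_bounds(2,3) by (auto simp: M_def mem_Times_iff)
    qed
    also have "\<dots> = real (card (M h)) * real (card (M h))" by (simp add: card_cartesian_product)
    also have "\<dots> \<le> (6 * R / h) * (6 * R / h)" using R by (intro mult_mono cardM h) auto
    finally have "real h * (\<Sum>d\<in>good R w. of_bool (int h dvd fst d \<and> int h dvd snd d)) \<le> real h * ((6 * R / h) * (6 * R / h))"
      by (rule mult_left_mono) simp
    also have "\<dots> = 36 * R\<^sup>2 * inverse (real h)" using h by (simp add: field_simps power2_eq_square)
    finally show "real h * (\<Sum>d\<in>good R w. of_bool (int h dvd fst d \<and> int h dvd snd d)) \<le> 36 * R\<^sup>2 * inverse (real h)" .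
  qed
  also have "\<dots> = 36 * R\<^sup>2 * harm N" by (simp add: harm_def sum_distrib_left)
  finally show ?thesis .
qed

definition bad :: "real \<Rightarrow> real \<Rightarrow> (int \<times> int) set" where
  "bad R w = {d. d \<noteq> 0 \<and> \<bar>real_of_int (fst d)\<bar> < w \<and> norm (lat d) \<le> 2 * R}"

lemma finite_bad: "finite (bad R w)"
  by (rule finite_subset[OF _ finite_lat_bounded0[OF bounded_cball[of 0 "2 * R"]]]) (auto simp: bad_def)

text \<open>
For each of the \<open>O(w)\<close> values of the first coordinate, the bound \<open>R * (b - a) / \<bar>snd d\<bar>\<close> is summed over the second
coordinate; the vectors on the horizontal axis are bounded through their first coordinate.
\<close>
lemma sum_bad_le:
  assumes ab: "a \<le> b" and w: "w \<ge> 1" and R: "R \<ge> 1" and N: "real N = 2 * R"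
  shows "(\<Sum>d\<in>bad R w. measure lborel (strip a b R (lat d))) \<le> R * (b - a) * ((2 * w + 2) * (2 * harm N))"
proof -
  let ?T = "{-int N..int N} - {0}" and ?W = "{-\<lfloor>w\<rfloor>..\<lfloor>w\<rfloor>}"
  have bd: "\<bar>fst d\<bar> \<le> int N" "\<bar>snd d\<bar> \<le> int N" "fst d \<in> ?W" if "d \<in> bad R w" for d
  proof -
    have "\<bar>real_of_int (fst d)\<bar> \<le> 2 * R" "\<bar>real_of_int (snd d)\<bar> \<le> 2 * R" "\<bar>real_of_int (fst d)\<bar> < w"
      using that norm_fst_le[of "real_of_int (fst d)" "real_of_int (snd d)"]
        norm_snd_le[of "real_of_int (snd d)" "real_of_int (fst d)"]
      by (auto simp: bad_def lat_def)
    then show "\<bar>fst d\<bar> \<le> int N" "\<bar>snd d\<bar> \<le> int N" "fst d \<in> ?W" unfolding N[symmetric] atLeastAtMost_iff by linarith+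
  qed
  let ?B1 = "{d \<in> bad R w. snd d \<noteq> 0}" and ?B2 = "{d \<in> bad R w. snd d = 0}"
  have c0: "R * (b - a) \<ge> 0" using R ab by simp
  have m1: "measure lborel (strip a b R (lat d)) \<le> R * (b - a) * (1 / \<bar>real_of_int (snd d)\<bar>)" if "snd d \<noteq> 0" for d
    using emeasure_strip_le(2)[of R a b "lat d"] that R ab c0
    by (simp add: measure_def enn2real_leI)
  have m2: "measure lborel (strip a b R (lat d)) \<le> R * (b - a) * (1 / \<bar>real_of_int (fst d)\<bar>)" if "fst d \<noteq> 0" for d
    using emeasure_strip_le(1)[of R a b "lat d"] that R ab c0
    by (simp add: measure_def enn2real_leI)
  have split: "(\<Sum>d\<in>bad R w. measure lborel (strip a b R (lat d)))
     = (\<Sum>d\<in>?B1. measure lborel (strip a b R (lat d))) + (\<Sum>d\<in>?B2. measure lborel (strip a b R (lat d)))"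
  proof -
    have "bad R w = ?B1 \<union> ?B2" by auto
    then show ?thesis
      using finite_bad[of R w] by (subst \<open>bad R w = ?B1 \<union> ?B2\<close>, intro sum.union_disjoint) auto
  qed
  have s1: "(\<Sum>d\<in>?B1. measure lborel (strip a b R (lat d))) \<le> R * (b - a) * ((2 * w + 1) * (2 * harm N))"
  proof -
    have "(\<Sum>d\<in>?B1. measure lborel (strip a b R (lat d))) \<le> (\<Sum>d\<in>?B1. R * (b - a) * (1 / \<bar>real_of_int (snd d)\<bar>))"
      by (intro sum_mono m1) auto
    also have "\<dots> \<le> (\<Sum>d\<in>?W \<times> ?T. R * (b - a) * (1 / \<bar>real_of_int (snd d)\<bar>))"
    proof (rule sum_mono2)
      show "?B1 \<subseteq> ?W \<times> ?T"
      proof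
        fix d assume "d \<in> ?B1"
        then show "d \<in> ?W \<times> ?T" using bd[of d] by (auto simp: mem_Times_iff abs_le_iff)
      qed
    qed (use c0 in auto)
    also have "\<dots> = (\<Sum>i\<in>?W. \<Sum>j\<in>?T. R * (b - a) * (1 / \<bar>real_of_int j\<bar>))"
      by (simp only: sum.cartesian_product split_beta')
    also have "\<dots> = (\<Sum>i\<in>?W. R * (b - a) * (2 * harm N))"
      by (intro sum.cong refl) (simp only: sum_distrib_left[symmetric] sum_inverse_nonzero)
    also have "\<dots> = real (card ?W) * (R * (b - a) * (2 * harm N))"
      by (rule sum_constant)
    also have "\<dots> \<le> (2 * w + 1) * (R * (b - a) * (2 * harm N))"
    proof (rule mult_right_mono)
      show "real (card ?W) \<le> 2 * w + 1" using w by simp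
      show "0 \<le> R * (b - a) * (2 * harm N)" using c0 by (simp add: harm_nonneg)
    qed
    finally show ?thesis by (simp add: algebra_simps)
  qed
  have s2: "(\<Sum>d\<in>?B2. measure lborel (strip a b R (lat d))) \<le> R * (b - a) * (2 * harm N)"
  proof -
    have "(\<Sum>d\<in>?B2. measure lborel (strip a b R (lat d))) \<le> (\<Sum>d\<in>?B2. R * (b - a) * (1 / \<bar>real_of_int (fst d)\<bar>))"
      by (intro sum_mono m2) (auto simp: bad_def prod_eq_iff)
    also have "\<dots> = (\<Sum>i\<in>fst ` ?B2. R * (b - a) * (1 / \<bar>real_of_int i\<bar>))"
      by (subst sum.reindex) (auto simp: inj_on_def prod_eq_iff)
    also have "\<dots> \<le> (\<Sum>i\<in>?T. R * (b - a) * (1 / \<bar>real_of_int i\<bar>))"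
    proof (rule sum_mono2)
      show "fst ` ?B2 \<subseteq> ?T"
      proof
        fix i assume "i \<in> fst ` ?B2"
        then obtain d where "d \<in> bad R w" "snd d = 0" "i = fst d" by auto
        then show "i \<in> ?T" using bd[of d] by (auto simp: bad_def prod_eq_iff abs_le_iff)
      qed
    qed (use c0 in auto)
    also have "\<dots> = R * (b - a) * (2 * harm N)"
      by (simp only: sum_distrib_left[symmetric] sum_inverse_nonzero)
    finally show ?thesis .
  qed
  have "R * (b - a) * ((2 * w + 1) * (2 * harm N)) + R * (b - a) * (2 * harm N)
      = R * (b - a) * ((2 * w + 2) * (2 * harm N))"
    by (simp add: algebra_simps)
  then show ?thesis using split s1 s2 by linarith
qed

lemma harm_le: "n > 0 \<Longrightarrow> harm n \<le> 1 + ln (real n)"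
  using euler_mascheroni_sequence_decreasing[of 1 n] by (simp add: harm_expand)

section \<open>First and second moments on the torus\<close>

definition hits :: "(real \<times> real) set \<Rightarrow> real \<times> real \<Rightarrow> nat" where
  "hits S x = card {q. lat q - x \<in> S}"

lemma ennreal_hits:
  assumes "bounded S"
  shows "ennreal (real (hits S x)) = (\<integral>\<^sup>+q. indicator S (lat q - x) \<partial>count_space UNIV)"
proof -
  have "indicator S (lat q - x) = (indicator {q. lat q - x \<in> S} q :: ennreal)" for q
    by (simp add: indicator_def)
  then show ?thesis
    using nn_integral_count_card[OF finite_lat_bounded[OF assms, of x]] by (simp add: hits_def)
qed

lemma measurable_lattice_sum:
  fixes f :: "real \<times> real \<Rightarrow> int \<times> int \<Rightarrow> ennreal"
  assumes [measurable]: "\<And>q. (\<lambda>x. f x q) \<in> borel_measurable borel"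
  shows "(\<lambda>x. \<integral>\<^sup>+q. f x q \<partial>count_space UNIV) \<in> borel_measurable borel"
proof -
  interpret sigma_finite_measure "count_space UNIV :: (int \<times> int) measure"
    by (rule sigma_finite_measure_count_space)
  have "(\<lambda>(q, x). f x q) \<in> borel_measurable (count_space UNIV \<Otimes>\<^sub>M borel)"
    by (rule measurable_pair_measure_countable1) simp_all
  from measurable_pair_swap[OF this]
  have "case_prod f \<in> borel_measurable (borel \<Otimes>\<^sub>M count_space UNIV)" by (simp add: split_beta')
  then show ?thesis by (rule borel_measurable_nn_integral)
qed

lemma measurable_hits [measurable]:
  assumes "bounded S" and [measurable]: "S \<in> sets borel"
  shows "(\<lambda>x. real (hits S x)) \<in> borel_measurable borel"
proof -
  have "(\<lambda>x. ennreal (real (hits S x))) \<in> borel_measurable borel"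
    unfolding ennreal_hits[OF assms(1)] by (rule measurable_lattice_sum) measurable
  then have "(\<lambda>x. enn2real (ennreal (real (hits S x)))) \<in> borel_measurable borel" by measurable
  then show ?thesis by simp
qed

definition torus :: "(real \<times> real) measure" where
  "torus = density lborel (indicator unit_square)"

lemma sets_torus [simp, measurable_cong]: "sets torus = sets borel"
  by (simp add: torus_def)

lemma space_torus [simp]: "space torus = UNIV"
  by (simp add: torus_def)

lemma nn_integral_torus:
  "f \<in> borel_measurable borel \<Longrightarrow> (\<integral>\<^sup>+x. f x \<partial>torus) = (\<integral>\<^sup>+x. indicator unit_square x * f x \<partial>lborel)"
  unfolding torus_def by (subst nn_integral_density) auto

lemma prob_space_torus: "prob_space torus"
  by standard (use nn_integral_torus[of "\<lambda>_. 1"] nn_integral_unit_square in simp)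

lemma expectation_hits:
  assumes "bounded S" and S[measurable]: "S \<in> sets borel"
  shows "(\<integral>\<^sup>+x. ennreal (real (hits S x)) \<partial>torus) = emeasure lborel S"
proof -
  have "(\<integral>\<^sup>+x. ennreal (real (hits S x)) \<partial>torus)
      = (\<integral>\<^sup>+x. indicator unit_square x * (\<integral>\<^sup>+q. indicator S (lat q - x) \<partial>count_space UNIV) \<partial>lborel)"
    using measurable_hits[OF assms] by (simp add: nn_integral_torus ennreal_hits[OF assms(1), symmetric])
  also have "\<dots> = (\<integral>\<^sup>+y. indicator S y \<partial>lborel)"
    by (rule nn_integral_unfold) measurable
  finally show ?thesis by simp
qed

text \<open>
Pairs of hits are grouped by the translation \<open>t\<close> between the two lattice points: the product of the counts is the periodization
of \<open>y \<mapsto> indicator S y * (\<Sum>t. indicator S' (y + t))\<close>, to which unfolding applies.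
\<close>
lemma correlation_hits:
  assumes "bounded S" "bounded S'" and [measurable]: "S \<in> sets borel" "S' \<in> sets borel"
  shows "(\<integral>\<^sup>+x. ennreal (real (hits S x)) * ennreal (real (hits S' x)) \<partial>torus)
       = (\<integral>\<^sup>+q. overlap S S' (lat q) \<partial>count_space UNIV)"
proof -
  have [measurable]: "(\<lambda>x. real (hits S x)) \<in> borel_measurable borel" "(\<lambda>x. real (hits S' x)) \<in> borel_measurable borel"
    by (intro measurable_hits assms)+
  (* For every q the inner sum at the point lat q - x is the count for S', because it runs over a translate of the lattice. *)
  define h where "h y = indicator S y * (\<integral>\<^sup>+t. indicator S' (y + lat t) \<partial>count_space UNIV)" for y
  have [measurable]: "(\<lambda>y. \<integral>\<^sup>+t. indicator S' (y + lat t) \<partial>count_space UNIV :: ennreal) \<in> borel_measurable borel"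
    by (rule measurable_lattice_sum) measurable
  have h[measurable]: "h \<in> borel_measurable borel" unfolding h_def by measurable
  have shift: "(\<integral>\<^sup>+t. indicator S' (lat q - x + lat t) \<partial>count_space UNIV) = ennreal (real (hits S' x))" for q x
  proof -
    have "bij (\<lambda>t. q + t)" by (rule bij_plus)
    from nn_integral_bij_count_space[OF this, of "\<lambda>t. indicator S' (lat t - x)"]
    show ?thesis by (simp add: ennreal_hits[OF assms(2)] lat_simps(3)[symmetric] algebra_simps del: lat_simps)
  qed
  have "(\<integral>\<^sup>+x. ennreal (real (hits S x)) * ennreal (real (hits S' x)) \<partial>torus)
      = (\<integral>\<^sup>+x. indicator unit_square x * (\<integral>\<^sup>+q. h (lat q - x) \<partial>count_space UNIV) \<partial>lborel)"
    by (simp add: nn_integral_torus h_def shift nn_integral_multc ennreal_hits[OF assms(1), symmetric])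
  also have "\<dots> = (\<integral>\<^sup>+y. h y \<partial>lborel)" by (rule nn_integral_unfold[OF h])
  also have "\<dots> = (\<integral>\<^sup>+y. \<integral>\<^sup>+t. indicator S y * indicator S' (y + lat t) \<partial>count_space UNIV \<partial>lborel)"
    by (simp add: h_def nn_integral_cmult)
  also have "\<dots> = (\<integral>\<^sup>+t. overlap S S' (lat t) \<partial>count_space UNIV)"
    unfolding overlap_def by (rule nn_integral_count_space_nn_integral) (simp_all add: measurable_overlap_integrand)
  finally show ?thesis .
qed

text \<open>
The norm leaves at most \<open>2 * R + 1\<close> values for the second coordinate of the lattice point; for each of them the first coordinate
lies in an interval of length at most \<open>b - a\<close>.
\<close>
lemma hits_strip_le:
  assumes ab: "a \<le> b" and R: "R \<ge> 0" and d: "\<bar>fst d\<bar> \<ge> 1"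
  shows "real (hits (strip a b R d) x) \<le> (2 * R + 1) * (b - a + 1)"
proof -
  define J where "J = {j::int. snd x - R \<le> of_int j \<and> of_int j \<le> snd x + R}"
  define I where "I j = {i. lat (i, j) - x \<in> strip a b R d}" for j
  have finJ: "finite J"
    by (rule finite_subset[of _ "{\<lceil>snd x - R\<rceil>..\<lfloor>snd x + R\<rfloor>}"]) (auto simp: J_def ceiling_le_iff le_floor_iff)
  have cardI: "real (card (I j)) \<le> b - a + 1" for j
  proof -
    define c where "c = d \<bullet> d - 2 * fst d * fst x + 2 * snd d * (of_int j - snd x)"
    have "2 * fst d \<noteq> 0" using d by auto
    then obtain p where p: "{y. a \<le> (2 * fst d) * y + c \<and> (2 * fst d) * y + c \<le> b} \<subseteq> {p..p + (b - a) / \<bar>2 * fst d\<bar>}"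
      by (rule slab_subset_interval)
    have len: "(b - a) / \<bar>2 * fst d\<bar> \<le> b - a"
      using d ab mult_left_mono[of 1 "\<bar>2 * fst d\<bar>" "b - a"] by (simp add: divide_le_eq)
    have "I j \<subseteq> {i. p \<le> real_of_int i \<and> real_of_int i \<le> p + (b - a)}"
    proof
      fix i assume "i \<in> I j"
      then have "real_of_int i \<in> {y. a \<le> (2 * fst d) * y + c \<and> (2 * fst d) * y + c \<le> b}"
        by (cases x, cases d) (auto simp: I_def strip_def c_def lat_def algebra_simps)
      then have "real_of_int i \<in> {p..p + (b - a) / \<bar>2 * fst d\<bar>}" using p by blast
      then show "i \<in> {i. p \<le> real_of_int i \<and> real_of_int i \<le> p + (b - a)}" using len by auto
    qed
    moreover have "finite {i. p \<le> real_of_int i \<and> real_of_int i \<le> p + (b - a)}"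
      by (rule finite_subset[of _ "{\<lceil>p\<rceil>..\<lfloor>p + (b - a)\<rfloor>}"]) (auto simp: ceiling_le_iff le_floor_iff)
    ultimately have "card (I j) \<le> card {i. p \<le> real_of_int i \<and> real_of_int i \<le> p + (b - a)}" by (intro card_mono)
    then show ?thesis using card_int_in_interval[of p "p + (b - a)"] ab by simp
  qed
  have finI: "finite (I j)" for j
  proof -
    have "(\<lambda>i. (i, j)) ` I j \<subseteq> {q. lat q - x \<in> strip a b R d}" by (auto simp: I_def)
    then have "finite ((\<lambda>i. (i, j)) ` I j)" by (rule finite_subset) (rule finite_lat_bounded[OF bounded_strip])
    then show ?thesis by (rule finite_imageD) (auto simp: inj_on_def)
  qed
  have "{q. lat q - x \<in> strip a b R d} \<subseteq> (\<Union>j\<in>J. (\<lambda>i. (i, j)) ` I j)"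
  proof
    fix q assume q: "q \<in> {q. lat q - x \<in> strip a b R d}"
    then have "norm (lat q - x) \<le> R" by (simp add: strip_def)
    moreover have "norm (snd (lat q - x)) \<le> norm (lat q - x)" by (metis norm_snd_le prod.collapse)
    ultimately have "\<bar>of_int (snd q) - snd x\<bar> \<le> R" by simp
    then have "snd q \<in> J" by (auto simp: J_def abs_le_iff)
    moreover have "fst q \<in> I (snd q)" using q by (simp add: I_def)
    ultimately show "q \<in> (\<Union>j\<in>J. (\<lambda>i. (i, j)) ` I j)" by (cases q) auto
  qed
  then have "hits (strip a b R d) x \<le> card (\<Union>j\<in>J. (\<lambda>i. (i, j)) ` I j)"
    unfolding hits_def using finJ finI by (intro card_mono) auto
  also have "\<dots> \<le> (\<Sum>j\<in>J. card ((\<lambda>i. (i, j)) ` I j))" by (rule card_UN_le[OF finJ])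
  also have "\<dots> = (\<Sum>j\<in>J. card (I j))" by (intro sum.cong refl card_image) (auto simp: inj_on_def)
  finally have "real (hits (strip a b R d) x) \<le> (\<Sum>j\<in>J. real (card (I j)))" by (metis of_nat_le_iff of_nat_sum)
  also have "\<dots> \<le> real (card J) * (b - a + 1)" using sum_bounded_above[of J "\<lambda>j. real (card (I j))" "b - a + 1"] cardI by simp
  also have "\<dots> \<le> (2 * R + 1) * (b - a + 1)"
  proof (rule mult_right_mono)
    show "real (card J) \<le> 2 * R + 1"
      unfolding J_def using card_int_in_interval[of "snd x - R" "snd x + R"] R by simp
  qed (use ab in simp)
  finally show ?thesis .
qed

definition tally :: "real \<Rightarrow> real \<Rightarrow> real \<Rightarrow> (int \<times> int) set \<Rightarrow> real \<times> real \<Rightarrow> real" where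
  "tally a b R D x = (\<Sum>d\<in>D. real (hits (strip a b R (lat d)) x))"

lemma tally_nonneg: "tally a b R D x \<ge> 0"
  by (simp add: tally_def sum_nonneg)

lemma measurable_tally [measurable]: "tally a b R D \<in> borel_measurable borel"
  unfolding tally_def[abs_def]
  by (intro borel_measurable_sum measurable_hits bounded_strip borel_strip)

lemma expectation_tally:
  "(\<integral>\<^sup>+x. ennreal (tally a b R D x) \<partial>torus) = ennreal (\<Sum>d\<in>D. measure lborel (strip a b R (lat d)))"
proof -
  have "(\<integral>\<^sup>+x. ennreal (tally a b R D x) \<partial>torus)
      = (\<integral>\<^sup>+x. (\<Sum>d\<in>D. ennreal (real (hits (strip a b R (lat d)) x))) \<partial>torus)"
    by (simp add: tally_def sum_ennreal)
  also have "\<dots> = (\<Sum>d\<in>D. \<integral>\<^sup>+x. ennreal (real (hits (strip a b R (lat d)) x)) \<partial>torus)"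
    using measurable_hits[OF bounded_strip borel_strip] by (intro nn_integral_sum) simp
  also have "\<dots> = (\<Sum>d\<in>D. ennreal (measure lborel (strip a b R (lat d))))"
    by (simp add: expectation_hits bounded_strip emeasure_strip)
  finally show ?thesis by (simp add: sum_ennreal)
qed

definition variance_bound :: "real \<Rightarrow> real \<Rightarrow> real \<Rightarrow> real \<Rightarrow> nat \<Rightarrow> nat \<Rightarrow> real" where
  "variance_bound a b R w N N' =
     ((b - a)\<^sup>2 * (8 * R + 1) / 4 * (12 * R / w * harm N') +
      (2 * R + 1) * (b - a + 1) * (R * (b - a) / w) * (6 * R / w)) * (36 * R\<^sup>2 * harm N)"

text \<open>
The excess \<open>e d d'\<close> of the correlation over the product of the means is \<open>O(R / \<bar>D\<bar>)\<close> when the determinant \<open>D\<close> of \<open>d, d'\<close> is nonzero.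
For parallel \<open>d, d'\<close> the bound of one of the counts by its maximum is enough, since for each \<open>d\<close> there are only
\<open>O(R gcd / w)\<close> such \<open>d'\<close>. Both contributions are proportional to the gcd of \<open>d\<close>, and the last factor of \<open>variance_bound\<close> is
the bound for the sum of the gcds.
\<close>
lemma second_moment_tally:
  assumes ab: "a \<le> b" and w: "w \<ge> 1" and R: "R \<ge> 1" and N: "real N = 2 * R" and N': "8 * R\<^sup>2 \<le> real N'"
  defines "\<mu> \<equiv> \<Sum>d\<in>good R w. measure lborel (strip a b R (lat d))"
  shows "(\<integral>\<^sup>+x. ennreal ((tally a b R (good R w) x)\<^sup>2) \<partial>torus) \<le> ennreal (\<mu>\<^sup>2 + variance_bound a b R w N N')"
proof -
  let ?G = "good R w" and ?S = "\<lambda>d. strip a b R (lat d)"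
  define c where "c = (b - a)\<^sup>2 * (8 * R + 1) / 4"
  define K where "K = (2 * R + 1) * (b - a + 1)"
  have c0: "c \<ge> 0" using R by (simp add: c_def)
  have K0: "K \<ge> 0" using R ab by (simp add: K_def)
  have d1: "\<bar>fst (lat d)\<bar> \<ge> w" "\<bar>fst (lat d)\<bar> \<ge> 1" "fst (lat d) \<noteq> 0" if "d \<in> ?G" for d
    using good_bounds(1)[OF that] w by auto
  have hm[measurable]: "(\<lambda>x. real (hits (?S d) x)) \<in> borel_measurable borel" for d
    by (intro measurable_hits bounded_strip borel_strip)
  define e where "e d d' = (if wedge d d' = 0 then K * measure lborel (?S d) else c / \<bar>real_of_int (wedge d d')\<bar>)" for d d'
  have e0: "e d d' \<ge> 0" for d d' using c0 K0 by (simp add: e_def)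
  have pair: "(\<integral>\<^sup>+x. ennreal (real (hits (?S d) x)) * ennreal (real (hits (?S d') x)) \<partial>torus)
      \<le> ennreal (measure lborel (?S d) * measure lborel (?S d') + e d d')" if d: "d \<in> ?G" "d' \<in> ?G" for d d'
  proof (cases "wedge d d' = 0")
    case True
    have "(\<integral>\<^sup>+x. ennreal (real (hits (?S d) x)) * ennreal (real (hits (?S d') x)) \<partial>torus)
        \<le> (\<integral>\<^sup>+x. ennreal (real (hits (?S d) x)) * ennreal K \<partial>torus)"
      using hits_strip_le[OF ab _ d1(2)[OF d(2)], of R] R
      by (intro nn_integral_mono mult_left_mono ennreal_leI) (auto simp: K_def)
    also have "\<dots> = ennreal (measure lborel (?S d)) * ennreal K"
      by (subst nn_integral_multc) (simp_all add: expectation_hits bounded_strip emeasure_strip)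
    also have "\<dots> = ennreal (e d d')" using True K0 by (simp add: e_def ennreal_mult[symmetric] mult.commute)
    also have "\<dots> \<le> ennreal (measure lborel (?S d) * measure lborel (?S d') + e d d')"
      by (intro ennreal_leI) simp
    finally show ?thesis .
  next
    case False
    have "(\<integral>\<^sup>+x. ennreal (real (hits (?S d) x)) * ennreal (real (hits (?S d') x)) \<partial>torus)
        = (\<integral>\<^sup>+q. overlap (?S d) (?S d') (lat q) \<partial>count_space UNIV)"
      by (rule correlation_hits) (auto simp: bounded_strip)
    also have "\<dots> \<le> emeasure lborel (?S d) * emeasure lborel (?S d')
        + ennreal ((b - a)\<^sup>2 * (8 * R + 1) / (4 * \<bar>real_of_int (wedge d d')\<bar>))"
    proof (rule sum_overlap_le[OF _ ab d1(3)[OF d(1)]])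
      show "real_of_int (wedge d d') = fst (lat d) * snd (lat d') - snd (lat d) * fst (lat d')"
        by (simp add: wedge_def)
      show "real_of_int (wedge d d') \<noteq> 0" using False by simp
    qed (use R in simp)
    also have "\<dots> = ennreal (measure lborel (?S d) * measure lborel (?S d') + e d d')"
      using False e0[of d d'] by (simp add: emeasure_strip ennreal_mult[symmetric] e_def c_def ennreal_plus[symmetric] del: ennreal_plus)
    finally show ?thesis .
  qed
  have "(\<integral>\<^sup>+x. ennreal ((tally a b R ?G x)\<^sup>2) \<partial>torus)
      = (\<integral>\<^sup>+x. (\<Sum>d\<in>?G. \<Sum>d'\<in>?G. ennreal (real (hits (?S d) x)) * ennreal (real (hits (?S d') x))) \<partial>torus)"
    by (simp add: tally_def power2_eq_square sum_product sum_nonneg ennreal_mult[symmetric])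
  also have "\<dots> = (\<Sum>d\<in>?G. \<Sum>d'\<in>?G. \<integral>\<^sup>+x. ennreal (real (hits (?S d) x)) * ennreal (real (hits (?S d') x)) \<partial>torus)"
    by (simp add: nn_integral_sum)
  also have "\<dots> \<le> (\<Sum>d\<in>?G. \<Sum>d'\<in>?G. ennreal (measure lborel (?S d) * measure lborel (?S d') + e d d'))"
    by (intro sum_mono pair)
  also have "\<dots> = ennreal (\<Sum>d\<in>?G. \<Sum>d'\<in>?G. measure lborel (?S d) * measure lborel (?S d') + e d d')"
    by (simp add: sum_ennreal e0 sum_nonneg del: ennreal_plus)
  also have "\<dots> \<le> ennreal (\<mu>\<^sup>2 + variance_bound a b R w N N')"
  proof (rule ennreal_leI)
    define s where "s d = real_of_int (gcd (fst d) (snd d))" for d :: "int \<times> int"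
    have "(\<Sum>d'\<in>?G. e d d') \<le> (c * (12 * R / w * harm N') + K * (R * (b - a) / w) * (6 * R / w)) * s d" if d: "d \<in> ?G" for d
    proof -
      have "(\<Sum>d'\<in>?G. e d d') = (\<Sum>d'\<in>{d' \<in> ?G. wedge d d' = 0}. e d d') + (\<Sum>d'\<in>{d' \<in> ?G. wedge d d' \<noteq> 0}. e d d')"
        using finite_good[of R w] by (subst sum.union_disjoint[symmetric]) (auto intro!: sum.cong)
      also have "(\<Sum>d'\<in>{d' \<in> ?G. wedge d d' = 0}. e d d') = real (card {d' \<in> ?G. wedge d d' = 0}) * (K * measure lborel (?S d))"
        by (simp add: e_def)
      also have "\<dots> \<le> (6 * R * s d / w) * (K * (R * (b - a) / w))"
      proof (intro mult_mono mult_left_mono K0)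
        show "real (card {d' \<in> ?G. wedge d d' = 0}) \<le> 6 * R * s d / w"
          unfolding s_def by (rule card_good_wedge_le[OF w d])
        have "emeasure lborel (?S d) \<le> ennreal (R * (b - a) / \<bar>fst (lat d)\<bar>)"
          using R by (intro emeasure_strip_le ab d1 d) auto
        then have "measure lborel (?S d) \<le> R * (b - a) / \<bar>fst (lat d)\<bar>"
          using R ab by (simp add: measure_def enn2real_leI)
        also have "\<dots> \<le> R * (b - a) / w" using d1(1)[OF d] w R ab by (intro divide_left_mono) auto
        finally show "measure lborel (?S d) \<le> R * (b - a) / w" .
      qed (use R w K0 in \<open>auto simp: s_def\<close>)
      also have "(\<Sum>d'\<in>{d' \<in> ?G. wedge d d' \<noteq> 0}. e d d') = c * (\<Sum>d'\<in>{d' \<in> ?G. wedge d d' \<noteq> 0}. 1 / \<bar>real_of_int (wedge d d')\<bar>)"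
        by (simp add: e_def sum_distrib_left)
      also have "\<dots> \<le> c * (12 * R * s d / w * harm N')"
        unfolding s_def by (intro mult_left_mono sum_inverse_wedge_le w d N' c0)
      finally have "(\<Sum>d'\<in>?G. e d d') \<le> (6 * R * s d / w) * (K * (R * (b - a) / w)) + c * (12 * R * s d / w * harm N')"
        by simp
      also have "\<dots> = (c * (12 * R / w * harm N') + K * (R * (b - a) / w) * (6 * R / w)) * s d"
        unfolding distrib_right by (simp add: mult_ac)
      finally show ?thesis .
    qed
    then have "(\<Sum>d\<in>?G. \<Sum>d'\<in>?G. e d d') \<le> (\<Sum>d\<in>?G. (c * (12 * R / w * harm N') + K * (R * (b - a) / w) * (6 * R / w)) * s d)"
      by (rule sum_mono)
    also have "\<dots> = (c * (12 * R / w * harm N') + K * (R * (b - a) / w) * (6 * R / w)) * (\<Sum>d\<in>?G. s d)"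
      by (simp add: sum_distrib_left)
    also have "\<dots> \<le> (c * (12 * R / w * harm N') + K * (R * (b - a) / w) * (6 * R / w)) * (36 * R\<^sup>2 * harm N)"
      unfolding s_def
    proof (intro mult_left_mono sum_gcd_good_le w R N)
      show "0 \<le> c * (12 * R / w * harm N') + K * (R * (b - a) / w) * (6 * R / w)"
        using c0 K0 R w ab harm_nonneg[of N', where 'a = real]
        by (intro add_nonneg_nonneg mult_nonneg_nonneg divide_nonneg_nonneg) auto
    qed
    also have "\<dots> = variance_bound a b R w N N'" by (simp add: variance_bound_def c_def K_def)
    finally have "(\<Sum>d\<in>?G. \<Sum>d'\<in>?G. e d d') \<le> variance_bound a b R w N N'" .
    moreover have "(\<Sum>d\<in>?G. \<Sum>d'\<in>?G. measure lborel (?S d) * measure lborel (?S d')) = \<mu>\<^sup>2"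
      by (simp add: \<mu>_def power2_eq_square sum_product)
    ultimately show "(\<Sum>d\<in>?G. \<Sum>d'\<in>?G. measure lborel (?S d) * measure lborel (?S d') + e d d')
        \<le> \<mu>\<^sup>2 + variance_bound a b R w N N'"
      by (simp add: sum.distrib)
  qed
  finally show ?thesis .
qed

lemma (in prob_space) nn_integral_variance_le:
  assumes f[measurable]: "f \<in> borel_measurable M" and f0: "\<And>x. f x \<ge> 0" and "\<mu> \<ge> 0" "V \<ge> (0::real)"
    and first: "(\<integral>\<^sup>+x. ennreal (f x) \<partial>M) = ennreal \<mu>"
    and second: "(\<integral>\<^sup>+x. ennreal ((f x)\<^sup>2) \<partial>M) \<le> ennreal (\<mu>\<^sup>2 + V)"
  shows "(\<integral>\<^sup>+x. ennreal ((f x - \<mu>)\<^sup>2) \<partial>M) \<le> ennreal V"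
proof -
  have i1: "integrable M f" using first by (intro integrableI_nonneg) (auto simp: f0)
  have e1: "expectation f = \<mu>"
    using first \<open>\<mu> \<ge> 0\<close> f0 by (subst integral_eq_nn_integral) auto
  have i2: "integrable M (\<lambda>x. (f x)\<^sup>2)"
    using second by (intro integrableI_nonneg) (auto simp: f0 intro: le_less_trans)
  have e2: "expectation (\<lambda>x. (f x)\<^sup>2) \<le> \<mu>\<^sup>2 + V"
    using second \<open>V \<ge> 0\<close> by (subst integral_eq_nn_integral) (auto intro!: enn2real_leI)
  have exp: "(\<lambda>x. (f x - \<mu>)\<^sup>2) = (\<lambda>x. (f x)\<^sup>2 - 2 * \<mu> * f x + \<mu>\<^sup>2)"
    by (simp add: power2_diff fun_eq_iff algebra_simps)
  have i3: "integrable M (\<lambda>x. (f x - \<mu>)\<^sup>2)" unfolding exp using i1 i2 by simp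
  have "(\<integral>\<^sup>+x. ennreal ((f x - \<mu>)\<^sup>2) \<partial>M) = ennreal (expectation (\<lambda>x. (f x - \<mu>)\<^sup>2))"
    using i3 by (intro nn_integral_eq_integral) auto
  also have "expectation (\<lambda>x. (f x - \<mu>)\<^sup>2) = expectation (\<lambda>x. (f x)\<^sup>2) - 2 * \<mu> * expectation f + \<mu>\<^sup>2"
    unfolding exp using i1 i2 by (simp add: prob_space)
  also have "ennreal \<dots> \<le> ennreal V"
    using e2 unfolding e1 by (intro ennreal_leI) (simp add: power2_eq_square)
  finally show ?thesis .
qed

section \<open>Almost sure convergence of the pair correlation\<close>

lemma AE_tendsto_zero_of_summable:
  fixes f :: "nat \<Rightarrow> 'a \<Rightarrow> real"
  assumes [measurable]: "\<And>k. f k \<in> borel_measurable M" and f0: "\<And>k x. f k x \<ge> 0"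
    and le: "\<And>k. (\<integral>\<^sup>+x. ennreal (f k x) \<partial>M) \<le> ennreal (c k)" and c: "summable c" "\<And>k. c k \<ge> 0"
  shows "AE x in M. (\<lambda>k. f k x) \<longlonglongrightarrow> 0"
proof -
  have "(\<integral>\<^sup>+x. (\<Sum>k. ennreal (f k x)) \<partial>M) = (\<Sum>k. \<integral>\<^sup>+x. ennreal (f k x) \<partial>M)"
    by (rule nn_integral_suminf) simp
  also have "\<dots> \<le> (\<Sum>k. ennreal (c k))" by (intro suminf_le le) auto
  also have "\<dots> = ennreal (\<Sum>k. c k)" by (rule suminf_ennreal2[OF c(2,1)])
  finally have "(\<integral>\<^sup>+x. (\<Sum>k. ennreal (f k x)) \<partial>M) \<noteq> \<infinity>" by (auto simp: top_unique)
  then have "AE x in M. (\<Sum>k. ennreal (f k x)) \<noteq> \<infinity>" by (intro nn_integral_PInf_AE) simp_all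
  then show ?thesis
  proof eventually_elim
    case (elim x)
    then have "summable (\<lambda>k. f k x)" by (intro summable_suminf_not_top) (auto simp: f0)
    then show ?case by (rule summable_LIMSEQ_zero)
  qed
qed

text \<open>
The sequence of radii is polynomial, so that consecutive terms have ratio tending to 1. The exponents 16 and 12 realise
\<open>w = R powr (3/4)\<close>; with them the relative errors, logarithms included, decay at least like \<open>1 / k\<^sup>2\<close>.
\<close>
definition radius :: "nat \<Rightarrow> real" where "radius k = real (Suc k) ^ 16"

definition cutoff :: "nat \<Rightarrow> real" where "cutoff k = real (Suc k) ^ 12"

lemma radius_ge_1: "radius k \<ge> 1" and cutoff_ge_1: "cutoff k \<ge> 1"
  by (simp_all only: radius_def cutoff_def) (intro one_le_power, simp)+

text \<open>
Harmonic numbers grow logarithmically; a linear bound in the index \<open>k\<close> of the radius is all that is needed, because it is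
absorbed by the powers of \<open>k\<close> that are gained elsewhere.
\<close>
lemma harm_radius_le:
  fixes k :: nat
  shows "harm (2 * Suc k ^ 16) \<le> 16 * real (Suc k)" and "harm (8 * Suc k ^ 32) \<le> 32 * real (Suc k)"
proof -
  define n where "n = real (Suc k)"
  have n: "n \<ge> 1" by (simp add: n_def)
  have ln: "ln n \<le> n - 1" by (rule ln_le_minus_one) (use n in simp)
  have "ln (real (2 * Suc k ^ 16)) = ln 2 + 16 * ln n" "ln (real (8 * Suc k ^ 32)) = ln 8 + 32 * ln n"
    unfolding of_nat_mult of_nat_power of_nat_numeral n_def by (simp_all add: ln_mult_pos ln_realpow del: of_nat_Suc)
  note eqs = this
  have le: "harm (2 * Suc k ^ 16) \<le> 1 + (ln 2 + 16 * ln n)"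
    unfolding eqs(1)[symmetric] by (rule harm_le) simp
  have le': "harm (8 * Suc k ^ 32) \<le> 1 + (ln 8 + 32 * ln n)"
    unfolding eqs(2)[symmetric] by (rule harm_le) simp
  have l: "ln (2::real) \<le> 1" "ln (8::real) \<le> 7"
    using ln_le_minus_one[of "2::real"] ln_le_minus_one[of "8::real"] by simp_all
  show "harm (2 * Suc k ^ 16) \<le> 16 * real (Suc k)" unfolding n_def[symmetric]
    by (rule order_trans[OF le]) (use l ln in linarith)
  show "harm (8 * Suc k ^ 32) \<le> 32 * real (Suc k)" unfolding n_def[symmetric]
    by (rule order_trans[OF le']) (use l ln in linarith)
qed

lemma summable_inverse_Suc_square: "summable (\<lambda>k. C * (1 / real (Suc k) ^ 2))"
proof -
  have "summable (\<lambda>n. inverse (real n ^ 2))" by (rule inverse_power_summable) simp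
  then have "summable (\<lambda>k. inverse (real (Suc k) ^ 2))" by (subst summable_Suc_iff)
  then show ?thesis by (intro summable_mult) (simp only: inverse_eq_divide)
qed

lemma variance_bound_radius:
  assumes ab: "a \<le> b"
  defines "B \<equiv> b - a"
  defines "C \<equiv> 576 * (864 * B\<^sup>2 + 18 * B * (B + 1))"
  shows "variance_bound a b (radius k) (cutoff k) (2 * Suc k ^ 16) (8 * Suc k ^ 32) / radius k ^ 4
      \<le> C * (1 / real (Suc k) ^ 2)"
    and "variance_bound a b (radius k) (cutoff k) (2 * Suc k ^ 16) (8 * Suc k ^ 32) \<ge> 0"
proof -
  define n where "n = real (Suc k)"
  define R where "R = n ^ 16"
  define w where "w = n ^ 12"
  define H where "H = (harm (2 * Suc k ^ 16) :: real)"
  define H' where "H' = (harm (8 * Suc k ^ 32) :: real)"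
  have n: "n \<ge> 1" by (simp add: n_def)
  have R: "R \<ge> 1" "w \<ge> 1" using n by (auto simp: R_def w_def)
  have B: "B \<ge> 0" using ab by (simp add: B_def)
  have H: "0 \<le> H" "H \<le> 16 * n" "0 \<le> H'" "H' \<le> 32 * n"
    using harm_radius_le[of k] by (simp_all only: H_def H'_def n_def harm_nonneg)
  have eq: "variance_bound a b (radius k) (cutoff k) (2 * Suc k ^ 16) (8 * Suc k ^ 32)
      = (B\<^sup>2 * (8 * R + 1) / 4 * (12 * R / w * H') + (2 * R + 1) * (B + 1) * (R * B / w) * (6 * R / w)) * (36 * R\<^sup>2 * H)"
    unfolding variance_bound_def radius_def cutoff_def n_def[symmetric] R_def[symmetric] w_def[symmetric]
      H_def[symmetric] H'_def[symmetric] B_def[symmetric] by (rule refl)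
  show "variance_bound a b (radius k) (cutoff k) (2 * Suc k ^ 16) (8 * Suc k ^ 32) \<ge> 0"
    unfolding eq using R B H
    by (intro mult_nonneg_nonneg add_nonneg_nonneg divide_nonneg_nonneg zero_le_power2) auto
  (* With R = n^16 and w = n^12, a linear bound for the harmonic number leaves n / w = n^(-11), and the parallel
     differences contribute R / w^2 = n^(-8); the remaining factor harm N costs one more power of n. *)
  have t1: "B\<^sup>2 * (8 * R + 1) / 4 * (12 * R / w * H') \<le> 864 * B\<^sup>2 * R\<^sup>2 / n ^ 11"
  proof -
    have "B\<^sup>2 * (8 * R + 1) / 4 * (12 * R / w * H') \<le> B\<^sup>2 * (9 * R) / 4 * (12 * R / w * (32 * n))"
      using R B H by (intro mult_mono divide_right_mono mult_left_mono) auto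
    also have "\<dots> = 864 * B\<^sup>2 * R\<^sup>2 * (n / w)" using R by (simp add: power2_eq_square)
    also have "n / w = 1 / n ^ 11" using n by (simp add: w_def power_numeral_reduce)
    finally show ?thesis by simp
  qed
  have t2: "(2 * R + 1) * (B + 1) * (R * B / w) * (6 * R / w) \<le> 18 * B * (B + 1) * R\<^sup>2 / n ^ 8"
  proof -
    have "(2 * R + 1) * (B + 1) * (R * B / w) * (6 * R / w) \<le> (3 * R) * (B + 1) * (R * B / w) * (6 * R / w)"
      using R B by (intro mult_right_mono mult_nonneg_nonneg divide_nonneg_nonneg) auto
    also have "\<dots> = 18 * B * (B + 1) * R\<^sup>2 * (R / (w * w))" using R by (simp add: power2_eq_square mult_ac)
    also have "R / (w * w) = 1 / n ^ 8"
    proof -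
      have "w * w = R * n ^ 8" unfolding w_def R_def power_add[symmetric] by simp
      then show ?thesis using R by simp
    qed
    finally show ?thesis by simp
  qed
  have p: "1 / n ^ 11 \<le> 1 / n ^ 3" "1 / n ^ 8 \<le> 1 / n ^ 3"
    using n by (auto intro!: divide_left_mono power_increasing)
  have "B\<^sup>2 * (8 * R + 1) / 4 * (12 * R / w * H') + (2 * R + 1) * (B + 1) * (R * B / w) * (6 * R / w)
      \<le> (864 * B\<^sup>2 * R\<^sup>2) * (1 / n ^ 11) + (18 * B * (B + 1) * R\<^sup>2) * (1 / n ^ 8)"
    using t1 t2 by simp
  also have "\<dots> \<le> (864 * B\<^sup>2 * R\<^sup>2) * (1 / n ^ 3) + (18 * B * (B + 1) * R\<^sup>2) * (1 / n ^ 3)"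
    using B by (intro add_mono mult_left_mono p) auto
  also have "\<dots> = (864 * B\<^sup>2 + 18 * B * (B + 1)) * R\<^sup>2 * (1 / n ^ 3)" by (simp only: distrib_right)
  finally have le: "B\<^sup>2 * (8 * R + 1) / 4 * (12 * R / w * H') + (2 * R + 1) * (B + 1) * (R * B / w) * (6 * R / w)
      \<le> (864 * B\<^sup>2 + 18 * B * (B + 1)) * R\<^sup>2 * (1 / n ^ 3)" .
  have "variance_bound a b (radius k) (cutoff k) (2 * Suc k ^ 16) (8 * Suc k ^ 32)
      \<le> (864 * B\<^sup>2 + 18 * B * (B + 1)) * R\<^sup>2 * (1 / n ^ 3) * (36 * R\<^sup>2 * (16 * n))"
    unfolding eq using R B H n le by (intro mult_mono mult_left_mono) auto
  also have "\<dots> = C * (1 / n ^ 2) * R ^ 4"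
  proof -
    have "1 / n ^ 3 * n = 1 / n ^ 2" using n by (simp add: power_numeral_reduce)
    moreover have "Q * r * t * (36 * r * (16 * n)) = 576 * Q * (t * n) * (r * r)" for Q r t :: real
      by simp
    then have "(864 * B\<^sup>2 + 18 * B * (B + 1)) * R\<^sup>2 * (1 / n ^ 3) * (36 * R\<^sup>2 * (16 * n))
        = C * (1 / n ^ 3 * n) * (R\<^sup>2 * R\<^sup>2)" unfolding C_def .
    moreover have "R\<^sup>2 * R\<^sup>2 = R ^ 4" by (simp add: power_add[symmetric])
    ultimately show ?thesis by simp
  qed
  finally show "variance_bound a b (radius k) (cutoff k) (2 * Suc k ^ 16) (8 * Suc k ^ 32) / radius k ^ 4
      \<le> C * (1 / real (Suc k) ^ 2)"
    using R unfolding radius_def n_def[symmetric] R_def[symmetric] by (simp add: pos_divide_le_eq)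
qed

lemma radius_N: "real (2 * Suc k ^ 16) = 2 * radius k" "8 * (radius k)\<^sup>2 \<le> real (8 * Suc k ^ 32)"
  by (simp_all only: radius_def of_nat_mult of_nat_power of_nat_numeral power_mult[symmetric]) simp_all

lemma AE_tally_good:
  assumes ab: "a \<le> b"
  shows "AE x in torus. (\<lambda>k. tally a b (radius k) (good (radius k) (cutoff k)) x / (radius k)\<^sup>2) \<longlonglongrightarrow> pi\<^sup>2 * (b - a)"
proof -
  interpret prob_space torus by (rule prob_space_torus)
  define T where "T k = tally a b (radius k) (good (radius k) (cutoff k))" for k
  define \<mu> where "\<mu> k = (\<Sum>d\<in>good (radius k) (cutoff k). measure lborel (strip a b (radius k) (lat d)))" for k
  define V where "V k = variance_bound a b (radius k) (cutoff k) (2 * Suc k ^ 16) (8 * Suc k ^ 32)" for k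
  define C where "C = 576 * (864 * (b - a)\<^sup>2 + 18 * (b - a) * ((b - a) + 1))"
  have C: "C \<ge> 0" using ab by (simp add: C_def)
  have T[measurable]: "T k \<in> borel_measurable torus" for k unfolding T_def by measurable
  have R0: "radius k > 0" for k using radius_ge_1[of k] by linarith
  have V0: "V k \<ge> 0" for k unfolding V_def by (rule variance_bound_radius(2)[OF ab])
  have var: "(\<integral>\<^sup>+x. ennreal ((T k x - \<mu> k)\<^sup>2) \<partial>torus) \<le> ennreal (V k)" for k
  proof (rule nn_integral_variance_le[OF T _ _ V0])
    show "(\<integral>\<^sup>+x. ennreal (T k x) \<partial>torus) = ennreal (\<mu> k)" unfolding T_def \<mu>_def by (rule expectation_tally)
    show "(\<integral>\<^sup>+x. ennreal ((T k x)\<^sup>2) \<partial>torus) \<le> ennreal ((\<mu> k)\<^sup>2 + V k)"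
      unfolding T_def \<mu>_def V_def
      by (rule second_moment_tally[OF ab cutoff_ge_1 radius_ge_1 radius_N])
  qed (simp_all add: T_def \<mu>_def tally_nonneg sum_nonneg)
  have var0: "AE x in torus. (\<lambda>k. ((T k x - \<mu> k) / (radius k)\<^sup>2)\<^sup>2) \<longlonglongrightarrow> 0"
  proof (rule AE_tendsto_zero_of_summable[where c = "\<lambda>k. C * (1 / real (Suc k) ^ 2)"])
    show "(\<integral>\<^sup>+x. ennreal (((T k x - \<mu> k) / (radius k)\<^sup>2)\<^sup>2) \<partial>torus) \<le> ennreal (C * (1 / real (Suc k) ^ 2))" for k
    proof -
      have "ennreal (((T k x - \<mu> k) / (radius k)\<^sup>2)\<^sup>2) = ennreal ((T k x - \<mu> k)\<^sup>2) * ennreal (1 / radius k ^ 4)" for x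
        using R0[of k] by (simp add: ennreal_mult[symmetric] power_divide power_mult[symmetric])
      then have "(\<integral>\<^sup>+x. ennreal (((T k x - \<mu> k) / (radius k)\<^sup>2)\<^sup>2) \<partial>torus)
          = (\<integral>\<^sup>+x. ennreal ((T k x - \<mu> k)\<^sup>2) \<partial>torus) * ennreal (1 / radius k ^ 4)"
        by (simp add: nn_integral_multc)
      also have "\<dots> \<le> ennreal (V k) * ennreal (1 / radius k ^ 4)" by (intro mult_right_mono var) simp
      also have "\<dots> = ennreal (V k / radius k ^ 4)" using V0[of k] R0[of k] by (simp add: ennreal_mult[symmetric])
      also have "\<dots> \<le> ennreal (C * (1 / real (Suc k) ^ 2))"
        unfolding V_def C_def by (intro ennreal_leI variance_bound_radius(1)[OF ab])
      finally show ?thesis .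
    qed
    show "summable (\<lambda>k. C * (1 / real (Suc k) ^ 2))" by (rule summable_inverse_Suc_square)
  qed (use C in auto)
  have mean: "(\<lambda>k. \<mu> k / (radius k)\<^sup>2) \<longlonglongrightarrow> pi\<^sup>2 * (b - a)"
    unfolding \<mu>_def
  proof (rule mean_good[OF ab cutoff_ge_1 radius_ge_1])
    have inv: "(\<lambda>k. 1 / real (Suc k)) \<longlonglongrightarrow> 0"
      using LIMSEQ_inverse_real_of_nat by (simp add: inverse_eq_divide)
    show "(\<lambda>k. 1 / radius k) \<longlonglongrightarrow> 0"
      using tendsto_power[OF inv, of 16] by (simp add: radius_def power_divide)
    have "(\<lambda>k. cutoff k / radius k) = (\<lambda>k. (1 / real (Suc k)) ^ 4)"
    proof
      fix k
      have "radius k = cutoff k * real (Suc k) ^ 4" unfolding radius_def cutoff_def power_add[symmetric] by simp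
      then show "cutoff k / radius k = (1 / real (Suc k)) ^ 4"
        using cutoff_ge_1[of k] by (simp add: power_divide)
    qed
    then show "(\<lambda>k. cutoff k / radius k) \<longlonglongrightarrow> 0" using tendsto_power[OF inv, of 4] by simp
  qed
  from var0 show ?thesis
    unfolding T_def[symmetric]
  proof eventually_elim
    case (elim x)
    have "(\<lambda>k. (T k x - \<mu> k) / (radius k)\<^sup>2) \<longlonglongrightarrow> 0"
    proof -
      have "(\<lambda>k. sqrt (((T k x - \<mu> k) / (radius k)\<^sup>2)\<^sup>2)) \<longlonglongrightarrow> sqrt 0"
        by (intro tendsto_real_sqrt elim)
      then have "(\<lambda>k. \<bar>(T k x - \<mu> k) / (radius k)\<^sup>2\<bar>) \<longlonglongrightarrow> 0"
        by (simp only: real_sqrt_abs real_sqrt_zero)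
      then show ?thesis by (rule tendsto_rabs_zero_cancel)
    qed
    from tendsto_add[OF this mean]
    show ?case by (simp add: diff_divide_distrib)
  qed
qed

lemma AE_tally_bad:
  assumes ab: "a \<le> b"
  shows "AE x in torus. (\<lambda>k. tally a b (radius k) (bad (radius k) (cutoff k)) x / (radius k)\<^sup>2) \<longlonglongrightarrow> 0"
proof (rule AE_tendsto_zero_of_summable[where c = "\<lambda>k. 128 * (b - a) * (1 / real (Suc k) ^ 2)"])
  fix k
  define n where "n = real (Suc k)"
  have n: "n \<ge> 1" by (simp add: n_def)
  have R0: "radius k > 0" using radius_ge_1[of k] by linarith
  define M where "M = (\<Sum>d\<in>bad (radius k) (cutoff k). measure lborel (strip a b (radius k) (lat d)))"
  have M0: "M \<ge> 0" by (simp add: M_def sum_nonneg)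
  have "M \<le> radius k * (b - a) * ((2 * cutoff k + 2) * (2 * harm (2 * Suc k ^ 16)))"
    unfolding M_def by (rule sum_bad_le[OF ab cutoff_ge_1 radius_ge_1 radius_N(1)])
  also have "\<dots> \<le> radius k * (b - a) * ((4 * cutoff k) * (2 * (16 * n)))"
    using cutoff_ge_1[of k] R0 ab harm_radius_le(1)[of k]
    by (intro mult_left_mono mult_mono) (auto simp: n_def harm_nonneg)
  also have "\<dots> = 128 * (b - a) * (cutoff k * n) * radius k" by simp
  also have "\<dots> \<le> 128 * (b - a) * (radius k / n ^ 2) * radius k"
  proof (intro mult_right_mono mult_left_mono)
    have "cutoff k * n * n ^ 2 = n ^ 15"
      unfolding cutoff_def n_def[symmetric] by (simp add: power_numeral_reduce)
    also have "\<dots> \<le> radius k" unfolding radius_def n_def[symmetric] using n by (intro power_increasing) auto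
    finally show "cutoff k * n \<le> radius k / n ^ 2" using n by (simp add: pos_le_divide_eq)
  qed (use ab R0 in auto)
  finally have "M / (radius k)\<^sup>2 \<le> 128 * (b - a) * (1 / n ^ 2)"
    using R0 by (simp add: pos_divide_le_eq power2_eq_square)
  moreover have "(\<integral>\<^sup>+x. ennreal (tally a b (radius k) (bad (radius k) (cutoff k)) x / (radius k)\<^sup>2) \<partial>torus)
      = ennreal (M / (radius k)\<^sup>2)"
  proof -
    have "(\<integral>\<^sup>+x. ennreal (tally a b (radius k) (bad (radius k) (cutoff k)) x / (radius k)\<^sup>2) \<partial>torus)
        = (\<integral>\<^sup>+x. ennreal (tally a b (radius k) (bad (radius k) (cutoff k)) x) * ennreal (1 / (radius k)\<^sup>2) \<partial>torus)"
      by (intro nn_integral_cong) (simp add: ennreal_mult[symmetric] tally_nonneg)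
    also have "\<dots> = ennreal M * ennreal (1 / (radius k)\<^sup>2)"
      by (subst nn_integral_multc) (simp_all add: expectation_tally M_def)
    finally show ?thesis using M0 by (simp add: ennreal_mult[symmetric])
  qed
  ultimately show "(\<integral>\<^sup>+x. ennreal (tally a b (radius k) (bad (radius k) (cutoff k)) x / (radius k)\<^sup>2) \<partial>torus)
      \<le> ennreal (128 * (b - a) * (1 / real (Suc k) ^ 2))"
    by (simp only: ennreal_leI n_def)
next
  show "summable (\<lambda>k. 128 * (b - a) * (1 / real (Suc k) ^ 2))" by (rule summable_inverse_Suc_square)
qed (use ab in \<open>auto simp: tally_nonneg\<close>)

definition close_pairs :: "(nat \<Rightarrow> real) \<Rightarrow> real \<Rightarrow> real \<Rightarrow> real \<Rightarrow> (nat \<times> nat) set" where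
  "close_pairs lam a b L = {(j, k). j \<noteq> k \<and> lam j \<le> L \<and> lam k \<le> L \<and> a \<le> lam j - lam k \<and> lam j - lam k \<le> b}"

lemma finite_close_pairs: "finite (close_pairs (lattice_seq \<alpha> \<beta>) a b L)"
proof (rule finite_subset)
  let ?J = "{j. lattice_seq \<alpha> \<beta> j \<le> L}"
  show "finite (?J \<times> ?J)"
    using lists_values_count(1)[OF lists_values_lattice_seq finite_shifted_sq_dist_le, of \<alpha> \<beta> L] by simp
qed (auto simp: close_pairs_def)

text \<open>
A bijection \<open>e\<close> that lists the lattice points turns a pair of indices \<open>(j, k)\<close> into \<open>(d, q) = (e j - e k, e k)\<close>; the
closeness conditions say that \<open>q - x\<close> lies in the strip of \<open>d\<close>, and two points of a disc of radius \<open>R\<close> differ by at most \<open>2 * R\<close>.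
\<close>
lemma card_close_pairs_lattice_seq:
  assumes R: "R \<ge> 0" and w: "w > 0"
  shows "real (card (close_pairs (lattice_seq (fst x) (snd x)) a b (R\<^sup>2)))
       = tally a b R (good R w) x + tally a b R (bad R w) x"
proof -
  define lam where "lam = lattice_seq (fst x) (snd x)"
  obtain e where e: "bij e" "\<And>j. lam j = shifted_sq_dist (fst x) (snd x) (e j)"
    using lists_values_lattice_seq[of "fst x" "snd x"] unfolding lists_values_def lam_def by blast
  have sd: "shifted_sq_dist (fst x) (snd x) p = (norm (lat p - x))\<^sup>2" for p
    by (cases p; cases x) (simp add: shifted_sq_dist_def lat_def norm_Pair)
  define D where "D = good R w \<union> bad R w"
  define S where "S d = {q. lat q - x \<in> strip a b R (lat d)}" for d
  have D: "d \<in> D \<longleftrightarrow> d \<noteq> 0 \<and> norm (lat d) \<le> 2 * R" for d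
    using w by (auto simp: D_def good_def bad_def)
  have S: "q \<in> S d \<longleftrightarrow> norm (lat q - x) \<le> R \<and> norm (lat (d + q) - x) \<le> R \<and>
      a \<le> (norm (lat (d + q) - x))\<^sup>2 - (norm (lat q - x))\<^sup>2 \<and> (norm (lat (d + q) - x))\<^sup>2 - (norm (lat q - x))\<^sup>2 \<le> b" for q d
  proof -
    have eq: "lat q - x + lat d = lat (d + q) - x" by (simp add: lat_simps(3)[symmetric] algebra_simps del: lat_simps)
    have "2 * (lat d \<bullet> (lat q - x)) + lat d \<bullet> lat d = (norm (lat q - x + lat d))\<^sup>2 - (norm (lat q - x))\<^sup>2"
      by (simp add: power2_norm_eq_inner inner_add_left inner_add_right inner_commute del: lat_simps)
    then show ?thesis unfolding S_def strip_def mem_Collect_eq eq by simp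
  qed
  define f where "f = (\<lambda>(j, k). (e j - e k, e k))"
  have inj_e: "e j = e k \<longleftrightarrow> j = k" for j k using e(1) by (meson bij_is_inj injD)
  have "bij_betw f (close_pairs lam a b (R\<^sup>2)) (Sigma D S)"
  proof (rule bij_betwI')
    fix p p' assume "p \<in> close_pairs lam a b (R\<^sup>2)" "p' \<in> close_pairs lam a b (R\<^sup>2)"
    show "(f p = f p') = (p = p')"
      by (cases p; cases p') (auto simp: f_def inj_e)
  next
    fix p assume p: "p \<in> close_pairs lam a b (R\<^sup>2)"
    obtain j k where jk: "p = (j, k)" by (cases p)
    have nj: "norm (lat (e j) - x) \<le> R" "norm (lat (e k) - x) \<le> R"
      using p R unfolding jk by (auto simp: close_pairs_def e(2) sd intro: power2_le_imp_le)
    have "norm (lat (e j - e k)) = norm ((lat (e j) - x) - (lat (e k) - x))"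
      by (simp add: lat_simps(4)[symmetric] del: lat_simps)
    also have "\<dots> \<le> 2 * R" using nj norm_triangle_ineq4[of "lat (e j) - x" "lat (e k) - x"] by linarith
    finally have "e j - e k \<in> D" using p by (auto simp: D jk close_pairs_def inj_e)
    moreover have "e k \<in> S (e j - e k)"
      using p nj unfolding jk by (auto simp: S close_pairs_def e(2) sd)
    ultimately show "f p \<in> Sigma D S" by (simp add: f_def jk)
  next
    fix y assume y: "y \<in> Sigma D S"
    obtain d q where dq: "y = (d, q)" by (cases y)
    obtain j k where jk: "e j = d + q" "e k = q" using bij_is_surj[OF e(1)] by (metis surjD)
    have "j \<noteq> k" using y jk by (auto simp: dq D)
    moreover have "lam j \<le> R\<^sup>2" "lam k \<le> R\<^sup>2" using y by (auto simp: e(2) sd jk dq S intro!: power_mono)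
    ultimately have "(j, k) \<in> close_pairs lam a b (R\<^sup>2)"
      using y by (auto simp: close_pairs_def dq S e(2) sd jk)
    moreover have "y = f (j, k)" by (simp add: f_def jk dq)
    ultimately show "\<exists>p\<in>close_pairs lam a b (R\<^sup>2). y = f p" by blast
  qed
  then have "card (close_pairs lam a b (R\<^sup>2)) = card (Sigma D S)" by (rule bij_betw_same_card)
  also have "\<dots> = (\<Sum>d\<in>D. card (S d))"
    by (rule card_SigmaI)
       (auto simp: D_def finite_good finite_bad S_def intro: finite_lat_bounded[OF bounded_strip])
  finally have "real (card (close_pairs lam a b (R\<^sup>2))) = (\<Sum>d\<in>D. real (hits (strip a b R (lat d)) x))"
    by (simp add: S_def hits_def)
  also have "\<dots> = tally a b R (good R w) x + tally a b R (bad R w) x"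
    unfolding D_def tally_def by (rule sum.union_disjoint[OF finite_good finite_bad]) (auto simp: good_def bad_def)
  finally show ?thesis by (simp add: lam_def)
qed

text \<open>
If \<open>x\<close> lies between consecutive sample points \<open>l \<le> x \<le> h\<close>, then \<open>F l / h \<le> F x / x \<le> F h / l\<close>, and \<open>l / h\<close> tends to 1.
\<close>
lemma tendsto_quotient_of_polynomial_subsequence:
  fixes F :: "real \<Rightarrow> real" and m :: nat
  assumes mono: "\<And>x y. x \<le> y \<Longrightarrow> F x \<le> F y" and F0: "\<And>x. F x \<ge> 0" and m: "m > 0"
    and lim: "(\<lambda>k. F (real (Suc k) ^ m) / real (Suc k) ^ m) \<longlonglongrightarrow> c"
  shows "((\<lambda>x. F x / x) \<longlongrightarrow> c) at_top"
proof -
  define u where "u k = F (real (Suc k) ^ m) / real (Suc k) ^ m" for k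
  define r where "r k = (real (Suc k) / real (Suc (Suc k))) ^ m" for k
  have r: "r \<longlonglongrightarrow> 1"
  proof -
    have "(\<lambda>k. real (Suc k) / real (Suc (Suc k))) \<longlonglongrightarrow> 1"
      using LIMSEQ_Suc[OF LIMSEQ_n_over_Suc_n] by simp
    from tendsto_power[OF this, of m] show ?thesis by (simp add: r_def[abs_def])
  qed
  have u: "u \<longlonglongrightarrow> c" using lim by (simp add: u_def[abs_def])
  (* K x is the index k with (k + 1)^m <= x < (k + 2)^m. *)
  define K where "K x = nat \<lfloor>root m x\<rfloor> - 1" for x
  have K: "filterlim K sequentially at_top"
    unfolding filterlim_at_top
  proof
    fix Z :: nat
    show "\<forall>\<^sub>F x in at_top. Z \<le> K x"
      using eventually_ge_at_top[of "real (Suc Z) ^ m"]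
    proof eventually_elim
      case (elim x)
      then have "root m (real (Suc Z) ^ m) \<le> root m x" using m by simp
      then have "real (Suc Z) \<le> root m x" using m by (simp add: real_root_power_cancel)
      then have "int (Suc Z) \<le> \<lfloor>root m x\<rfloor>" by (simp add: le_floor_iff)
      then show "Z \<le> K x" by (simp add: K_def)
    qed
  qed
  have between: "real (Suc (K x)) ^ m \<le> x \<and> x \<le> real (Suc (Suc (K x))) ^ m" if x: "x \<ge> 1" for x
  proof -
    have "root m x \<ge> 1" using x m by simp
    then have fl: "\<lfloor>root m x\<rfloor> \<ge> 1" by simp
    then have "real (Suc (K x)) = of_int \<lfloor>root m x\<rfloor>" by (simp add: K_def)
    then have "real (Suc (K x)) \<le> root m x" "root m x \<le> real (Suc (Suc (K x)))" by linarith+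
    then have "real (Suc (K x)) ^ m \<le> root m x ^ m" "root m x ^ m \<le> real (Suc (Suc (K x))) ^ m"
      using \<open>root m x \<ge> 1\<close> by (auto intro!: power_mono)
    then show ?thesis using m x by (simp add: real_root_pow_pos2)
  qed
  have lower: "u (K x) * r (K x) \<le> F x / x" if x: "x \<ge> 1" for x
  proof -
    let ?l = "real (Suc (K x)) ^ m" and ?h = "real (Suc (Suc (K x))) ^ m"
    have "u (K x) * r (K x) = F ?l / ?h" by (simp add: u_def r_def power_divide del: of_nat_Suc)
    also have "\<dots> \<le> F x / x"
      using between[OF x] x by (intro frac_le F0 mono) auto
    finally show ?thesis .
  qed
  have upper: "F x / x \<le> u (Suc (K x)) / r (K x)" if x: "x \<ge> 1" for x
  proof -
    let ?l = "real (Suc (K x)) ^ m" and ?h = "real (Suc (Suc (K x))) ^ m"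
    have "F x / x \<le> F ?h / ?l" using between[OF x] x by (intro frac_le F0 mono) auto
    also have "\<dots> = u (Suc (K x)) / r (K x)" by (simp add: u_def r_def power_divide del: of_nat_Suc)
    finally show ?thesis .
  qed
  show ?thesis
  proof (rule tendsto_sandwich)
    show "\<forall>\<^sub>F x in at_top. u (K x) * r (K x) \<le> F x / x"
      using eventually_ge_at_top[of 1] by eventually_elim (rule lower)
    show "\<forall>\<^sub>F x in at_top. F x / x \<le> u (Suc (K x)) / r (K x)"
      using eventually_ge_at_top[of 1] by eventually_elim (rule upper)
    have "(\<lambda>k. u k * r k) \<longlonglongrightarrow> c * 1" by (intro tendsto_mult u r)
    from filterlim_compose[OF this K] show "((\<lambda>x. u (K x) * r (K x)) \<longlongrightarrow> c) at_top" by simp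
    have "(\<lambda>k. u (Suc k) / r k) \<longlonglongrightarrow> c / 1" by (intro tendsto_divide LIMSEQ_Suc u r) simp
    from filterlim_compose[OF this K] show "((\<lambda>x. u (Suc (K x)) / r (K x)) \<longlongrightarrow> c) at_top" by simp
  qed
qed

lemma AE_torus_pair_correlation:
  assumes ab: "a \<le> b"
  shows "AE x in torus. ((\<lambda>L. pair_correlation (lattice_seq (fst x) (snd x)) a b L) \<longlongrightarrow> pi * (b - a)) at_top"
  using AE_tally_good[OF ab] AE_tally_bad[OF ab]
proof eventually_elim
  case (elim x)
  define lam where "lam = lattice_seq (fst x) (snd x)"
  define F where "F L = real (card (close_pairs lam a b L))" for L
  have sq: "(radius k)\<^sup>2 = real (Suc k) ^ 32" for k by (simp add: radius_def power_mult[symmetric] del: of_nat_Suc)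
  have "F ((radius k)\<^sup>2) = tally a b (radius k) (good (radius k) (cutoff k)) x + tally a b (radius k) (bad (radius k) (cutoff k)) x" for k
    unfolding F_def lam_def using radius_ge_1[of k] cutoff_ge_1[of k]
    by (intro card_close_pairs_lattice_seq) auto
  then have "(\<lambda>k. F ((radius k)\<^sup>2) / (radius k)\<^sup>2) \<longlonglongrightarrow> pi\<^sup>2 * (b - a) + 0"
    using tendsto_add[OF elim] by (simp only: add_divide_distrib)
  then have "(\<lambda>k. F (real (Suc k) ^ 32) / real (Suc k) ^ 32) \<longlonglongrightarrow> pi\<^sup>2 * (b - a)"
    unfolding sq by simp
  then have "((\<lambda>L. F L / L) \<longlongrightarrow> pi\<^sup>2 * (b - a)) at_top"
  proof (rule tendsto_quotient_of_polynomial_subsequence[rotated 3])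
    show "F L \<le> F L'" if "L \<le> L'" for L L'
      unfolding F_def
    proof (intro of_nat_mono card_mono)
      show "finite (close_pairs lam a b L')" unfolding lam_def by (rule finite_close_pairs)
      show "close_pairs lam a b L \<subseteq> close_pairs lam a b L'" using that by (auto simp: close_pairs_def)
    qed
  qed (simp_all add: F_def)
  from tendsto_divide[OF this tendsto_const[of pi]]
  have "((\<lambda>L. F L / L / pi) \<longlongrightarrow> pi * (b - a)) at_top" by (simp add: power2_eq_square)
  moreover have "pair_correlation lam a b L = F L / L / pi" for L
    unfolding pair_correlation_def F_def close_pairs_def by (simp add: mult.commute)
  ultimately show ?case by (simp add: lam_def)
qed

text \<open>
The product of the uniform distributions lives on the closed unit square, which differs from the half-open one by subsets of two lines.
\<close>
lemma AE_uniform_square: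
  assumes "AE x in torus. P x"
  shows "AE x in uniform_measure lborel {0..1::real} \<Otimes>\<^sub>M uniform_measure lborel {0..1::real}. P x"
proof -
  let ?u = "\<lambda>t::real. indicator {0..1} t / emeasure lborel {0..1::real}"
  have U: "uniform_measure lborel {0..1::real} = density lborel ?u" by (simp add: uniform_measure_def)
  have "prob_space (uniform_measure lborel {0..1::real})" by (rule prob_space_uniform_measure) auto
  then have sf: "sigma_finite_measure (density lborel ?u)" unfolding U[symmetric] by (rule prob_space_imp_sigma_finite)
  have prod: "uniform_measure lborel {0..1::real} \<Otimes>\<^sub>M uniform_measure lborel {0..1::real}
      = density lborel (\<lambda>(x, y). ?u x * ?u y)"
    unfolding U by (subst pair_measure_density[OF _ _ lborel.sigma_finite_measure_axioms sf]) (simp_all add: lborel_prod)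
  have line1: "AE x in (lborel :: (real \<times> real) measure). fst x \<noteq> 1"
  proof (rule AE_I[where N = "{1} \<times> (UNIV :: real set)"])
    show "emeasure lborel ({1::real} \<times> (UNIV :: real set)) = 0"
      unfolding lborel_prod[symmetric] by (subst lborel.emeasure_pair_measure_Times) auto
    show "{1::real} \<times> (UNIV :: real set) \<in> sets lborel"
      unfolding lborel_prod[symmetric] by (intro pair_measureI) auto
  qed auto
  have line2: "AE x in (lborel :: (real \<times> real) measure). snd x \<noteq> 1"
  proof (rule AE_I[where N = "(UNIV :: real set) \<times> {1}"])
    show "emeasure lborel ((UNIV :: real set) \<times> {1::real}) = 0"
      unfolding lborel_prod[symmetric] by (subst lborel.emeasure_pair_measure_Times) auto
    show "(UNIV :: real set) \<times> {1::real} \<in> sets lborel"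
      unfolding lborel_prod[symmetric] by (intro pair_measureI) auto
  qed auto
  have "AE x in lborel. x \<in> unit_square \<longrightarrow> P x"
    using assms unfolding torus_def by (subst (asm) AE_density) (auto simp: indicator_def elim: AE_mp)
  then have "AE x in lborel. x \<in> {0..1} \<times> {0..1} \<longrightarrow> P x"
    using line1 line2 by eventually_elim (auto simp: less_le)
  moreover have "(\<lambda>(x, y). ?u x * ?u y) \<in> borel_measurable (lborel :: (real \<times> real) measure)"
    unfolding lborel_prod[symmetric] by measurable
  ultimately show ?thesis
    unfolding prod
  proof (subst AE_density)
    assume "AE x in lborel. x \<in> {0..1} \<times> {0..1} \<longrightarrow> P x"
    then show "AE x in lborel. 0 < (case x of (x, y) \<Rightarrow> ?u x * ?u y) \<longrightarrow> P x"
      by eventually_elim (auto simp: indicator_def of_bool_def divide_ennreal_def split: if_splits)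
  qed
qed

theorem corollary1p9:
  fixes M :: "'w measure" and \<alpha> \<beta> :: "'w \<Rightarrow> real" and a b :: real
  assumes "prob_space M"
    and "prob_space.indep_var M borel \<alpha> borel \<beta>"
    and "distr M borel \<alpha> = uniform_measure lborel {0..1}"
    and "distr M borel \<beta> = uniform_measure lborel {0..1}"
    and "a \<le> b"
  shows "AE \<omega> in M.
    ((\<lambda>L. pair_correlation (lattice_seq (\<alpha> \<omega>) (\<beta> \<omega>)) a b L) \<longlongrightarrow> pi * (b - a)) at_top"
proof -
  interpret prob_space M by fact
  have rv: "\<alpha> \<in> borel_measurable M" "\<beta> \<in> borel_measurable M"
    and joint: "distr M borel \<alpha> \<Otimes>\<^sub>M distr M borel \<beta> = distr M (borel \<Otimes>\<^sub>M borel) (\<lambda>\<omega>. (\<alpha> \<omega>, \<beta> \<omega>))"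
    using assms(2) unfolding indep_var_distribution_eq by auto
  have "AE x in distr M (borel \<Otimes>\<^sub>M borel) (\<lambda>\<omega>. (\<alpha> \<omega>, \<beta> \<omega>)).
      ((\<lambda>L. pair_correlation (lattice_seq (fst x) (snd x)) a b L) \<longlongrightarrow> pi * (b - a)) at_top"
    unfolding joint[symmetric] assms(3,4)
    by (rule AE_uniform_square[OF AE_torus_pair_correlation[OF \<open>a \<le> b\<close>]])
  then have "AE \<omega> in M. ((\<lambda>L. pair_correlation (lattice_seq (fst (\<alpha> \<omega>, \<beta> \<omega>)) (snd (\<alpha> \<omega>, \<beta> \<omega>))) a b L)
      \<longlongrightarrow> pi * (b - a)) at_top"
    by (rule AE_distrD[rotated]) (use rv in measurable)
  then show ?thesis by simp
qed

end
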